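(* For every fixed integer $\ell\ge1$ and every fixed $c\in\mathbb R$, $$S_{\ell,c}(x)\sim\widehat S_\ell(x)\sim\operatorname{li}(x)\sim\pi(x)\sim R(x),\qquad x\to\infty.$$ In particular, $$\lim_{x\to\infty}\frac{S_{\ell,c}(x)}{R(x)}=1.$$
   Context: For an integer $\ell\ge1$ and $n\ge 1$ put $L_n^{(\ell)}=\frac{n(\ell(n-1)+2)}{2}$ and $h_n^{(\ell)}=L_{n+1}^{(\ell)}-L_n^{(\ell)}=1+\ell n$. For real $x$ let $\nu_\ell(x)=\frac{\sqrt{8\ell x+(\ell-2)^2}+\ell-2}{2\ell}$ and $n_x^{(\ell)}=\lceil \nu_\ell(x)\rceil$ (so with $n=n_x^{(\ell)}$ one has $L_{n-1}^{(\ell)}<x\le L_n^{(\ell)}$). For $j\ge1$ let $s_j^{(\ell)}=h_j^{(\ell)}/\log L_{j+1}^{(\ell)}$ and $\Sigma_n^{(\ell)}=\sum_{j=1}^{n-1}s_j^{(\ell)}$. For $x\ge L_2^{(\ell)}$ define $$\widehat S_\ell(x)=\Sigma_{n_x^{(\ell)}}^{(\ell)}-\frac{L_{n_x^{(\ell)}}^{(\ell)}-x}{\log L_{n_x^{(\ell)}}^{(\ell)}},\qquad q_\ell(x)=\frac{h_{n_x^{(\ell)}-1}^{(\ell)}}{\sqrt{\ell}\,\log L_{n_x^{(\ell)}}^{(\ell)}},$$ and for $c\in\mathbb R$ let $S_{\ell,c}(x)=\widehat S_\ell(x)-c\,q_\ell(x)$. Here $\pi(x)$ is the number of primes $p\le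 x$, $\operatorname{li}(x)=\mathrm{PV}\!\int_0^x\frac{dt}{\log t}$ (principal value), and $R(x)=\sum_{k=1}^{\infty}\frac{\mu(k)}{k}\operatorname{li}(x^{1/k})$ is the Riemann prime-counting function, with $\mu$ the Möbius function. The notation $f(x)\sim g(x)$ means $f(x)/g(x)\to1$. *)

theory Defs
  imports
    "HOL-Analysis.Analysis"
    "HOL-Computational_Algebra.Computational_Algebra"
    "HOL-Library.Landau_Symbols"
begin

definition L_seq :: "nat \<Rightarrow> nat \<Rightarrow> real" where
  "L_seq l n = real n * (real l * (real n - 1) + 2) / 2"

definition h_seq :: "nat \<Rightarrow> nat \<Rightarrow> real" where
  "h_seq l n = L_seq l (n + 1) - L_seq l n"

lemma h_seq_eq: "h_seq l n = 1 + real l * real n"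
  by (simp add: h_seq_def L_seq_def field_simps)

definition \<nu> :: "nat \<Rightarrow> real \<Rightarrow> real" where
  "\<nu> l x = (sqrt (8 * real l * x + (real l - 2)\<^sup>2) + real l - 2) / (2 * real l)"

definition n_idx :: "nat \<Rightarrow> real \<Rightarrow> nat" where
  "n_idx l x = nat \<lceil>\<nu> l x\<rceil>"

text \<open>The index \<open>n_idx l x\<close> is the one with \<open>L_seq l (n - 1) < x \<le> L_seq l n\<close>.\<close>

lemma n_idx_bounds:
  assumes "l \<ge> 1" and "x > 0"
  shows "n_idx l x \<ge> 1" and "L_seq l (n_idx l x - 1) < x" and "x \<le> L_seq l (n_idx l x)"
proof -
  define s where "s = sqrt (8 * real l * x + (real l - 2)\<^sup>2)"
  have l: "real l \<ge> 1" using assms by simp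
  have s2: "s\<^sup>2 = 8 * real l * x + (real l - 2)\<^sup>2"
    unfolding s_def using l assms by simp
  have "sqrt ((real l - 2)\<^sup>2) < s"
    unfolding s_def using l assms by (intro real_sqrt_less_mono) simp
  then have s: "\<bar>real l - 2\<bar> < s" by simp
  define v where "v = \<nu> l x"
  have v: "2 * real l * v = s + real l - 2"
    unfolding v_def \<nu>_def s_def using l by (simp add: field_simps)
  have "0 < 2 * real l * v" using v s by linarith
  then have v0: "v > 0" using l by (simp add: zero_less_mult_iff)
  have "(2 * real l * v - (real l - 2))\<^sup>2 = 8 * real l * x + (real l - 2)\<^sup>2"
    using v s2 by simp
  then have "real l * (v * (real l * (v - 1) + 2)) = real l * (2 * x)"
    by (simp add: power2_eq_square algebra_simps)
  then have x: "v * (real l * (v - 1) + 2) / 2 = x" using l by simp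
  have diff: "L_seq l m - x = (real m - v) * (real l * real m + (s + 2 - real l) / 2) / 2" for m
  proof -
    have "L_seq l m - x = (real m - v) * (real l * real m + real l * v + 2 - real l) / 2"
      by (simp add: L_seq_def x[symmetric] algebra_simps diff_divide_distrib add_divide_distrib)
    also have "real l * v = (s + real l - 2) / 2" using v by simp
    finally show ?thesis by (simp add: field_simps)
  qed
  have pos: "real l * real m + (s + 2 - real l) / 2 > 0" for m
    using s l by (intro add_nonneg_pos) auto
  have c: "real (n_idx l x) \<ge> v" "real (n_idx l x) < v + 1"
    unfolding n_idx_def using v0 ceiling_correct[of v]
    by (auto simp: v_def[symmetric] of_nat_nat)
  show n1: "n_idx l x \<ge> 1" using c v0 by linarith
  show "x \<le> L_seq l (n_idx l x)"
    using diff[of "n_idx l x"] pos[of "n_idx l x"] c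
    by (smt (verit) divide_nonneg_pos mult_nonneg_nonneg)
  have "real (n_idx l x - 1) - v < 0" using c n1 by (simp add: of_nat_diff)
  then have "(real (n_idx l x - 1) - v) *
      (real l * real (n_idx l x - 1) + (s + 2 - real l) / 2) < 0"
    using pos by (intro mult_neg_pos)
  then have "L_seq l (n_idx l x - 1) - x < 0"
    unfolding diff by (rule divide_neg_pos) simp
  then show "L_seq l (n_idx l x - 1) < x" by simp
qed

definition s_seq :: "nat \<Rightarrow> nat \<Rightarrow> real" where
  "s_seq l j = h_seq l j / ln (L_seq l (j + 1))"

definition \<Sigma>_sum :: "nat \<Rightarrow> nat \<Rightarrow> real" where
  "\<Sigma>_sum l n = (\<Sum>j\<in>{1..<n}. s_seq l j)"

text \<open>
  \<open>S_hat\<close>, \<open>q_term\<close> and \<open>S_shift\<close> are meaningful for \<open>x \<ge> L_seq l 2\<close>, where \<open>n_idx l x \<ge> 2\<close>,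
  so that the index \<open>n_idx l x - 1\<close> is a genuine subtraction and the logarithms are positive.
  Their values for smaller \<open>x\<close> are irrelevant.
\<close>

definition S_hat :: "nat \<Rightarrow> real \<Rightarrow> real" where
  "S_hat l x = \<Sigma>_sum l (n_idx l x) - (L_seq l (n_idx l x) - x) / ln (L_seq l (n_idx l x))"

definition q_term :: "nat \<Rightarrow> real \<Rightarrow> real" where
  "q_term l x = h_seq l (n_idx l x - 1) / (sqrt (real l) * ln (L_seq l (n_idx l x)))"

definition S_shift :: "nat \<Rightarrow> real \<Rightarrow> real \<Rightarrow> real" where
  "S_shift l c x = S_hat l x - c * q_term l x"

definition prime_pi :: "real \<Rightarrow> real" where
  "prime_pi x = real (card {p::nat. prime p \<and> real p \<le> x})"

text \<open>
  Cauchy principal value at the singularity \<open>t = 1\<close>: a symmetric neighbourhood of radius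
  \<open>\<epsilon>\<close> is removed, and \<open>\<epsilon>\<close> tends to 0 from above.  The value at the endpoint \<open>t = 0\<close>
  does not affect the integral.
\<close>

definition li :: "real \<Rightarrow> real" where
  "li x = Lim (at_right 0) (\<lambda>\<epsilon>. integral ({0..x} - {1 - \<epsilon><..<1 + \<epsilon>}) (\<lambda>t. 1 / ln t))"

definition moebius_mu :: "nat \<Rightarrow> real" where
  "moebius_mu n = (if squarefree n then (-1) ^ card (prime_factors n) else 0)"

text \<open>
  The series runs over \<open>k \<ge> 1\<close>, whence the shift by \<open>Suc\<close>; \<open>suminf\<close> is the limit
  of the partial sums, so no absolute convergence is presupposed.
\<close>

definition riemann_R :: "real \<Rightarrow> real" where
  "riemann_R x = (\<Sum>k. moebius_mu (Suc k) / real (Suc k) * li (x powr (1 / real (Suc k))))"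

end

theory Submission
  imports Defs "HOL-Complex_Analysis.Complex_Analysis" "HOL-Probability.Probability"
    "HOL-Number_Theory.Prime_Powers" "HOL-Real_Asymp.Real_Asymp"
begin

text \<open>
  All functions in question are asymptotic to \<open>x / ln x\<close>. For \<open>li\<close> this is calculus, and \<open>S_hat\<close> is a Riemann
  sum for \<open>li\<close> over a mesh of width \<open>O(sqrt x)\<close>, so it differs from \<open>li\<close> by \<open>O(sqrt x)\<close> only.

  For \<open>riemann_R\<close> even the convergence of the series needs that \<open>\<Sum>\<mu>(k) ln k / k\<close> converges, which \<open>\<pi>(x) ~ x / ln x\<close> alone
  does not give. It is obtained from \<open>Z(s) = s \<zeta>(1 + s)\<close> as follows. The
  functions \<open>m(t) = \<Sum>\<mu>(n) / n\<close> (over \<open>n \<le> e\<^sup>t\<close>) and \<open>\<psi>(e\<^sup>t) e\<^bsup>-t\<^esup> - 1\<close> have the Laplace transforms \<open>1 / Z\<close> and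
  \<open>- (1 + Z' / Z) / (1 + s)\<close>. By the 3-4-1 inequality, the second derivative of the former and the first derivative of
  the latter are \<open>O(|s|\<^bsup>-1/2\<^esup>)\<close> uniformly up to \<open>Re s = 0\<close>. Multiplying a function by \<open>t\<close> differentiates its
  transform, so the Gaussian means of \<open>t\<^sup>2 m(t)\<close> and \<open>t (\<psi>(e\<^sup>t) e\<^bsup>-t\<^esup> - 1)\<close> over windows of width \<open>\<eta>\<close> are
  \<open>O(\<eta>\<^bsup>-2/3\<^esup>)\<close>. As \<open>m\<close> varies slowly and \<open>\<psi>\<close> is monotone, this gives \<open>m(t) = O(t\<^bsup>-6/5\<^esup>)\<close>, hence the
  convergence of both \<open>\<Sum>\<mu>(k) / k\<close> and \<open>\<Sum>\<mu>(k) ln k / k\<close>, and the prime number theorem.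
\<close>

section \<open>The logarithmic integral and the sums over the mesh\<close>

text \<open>All bounds on \<open>szeta\<close> hold in the open half plane only, but uniformly as Re
  s decreases to 0, so no boundary values enter. The decay |s|^(-1/2) is too slow for an absolutely
  convergent inversion on a vertical line; the Gaussian weight cuts the frequencies off near 1 /
  \<eta>, at the price \<eta>^(-2/3). The exponents fit together as follows, with kappa = 1/50. Z is
  O(|s|^(1 + kappa)), and 3-4-1 gives |Z| at least of order |s|^(1 - kappa) \<sigma>^(3/4) at
  distance \<sigma> from the line. Going further left by means of Z' = O(|s|^(1 + kappa)) is
  balanced at \<sigma> = |s|^(-8 kappa) and leaves |Z| of order at least |s|^(1 - 7 kappa). Hence Z'
  / Z = O(|s|^(8 kappa)) and (1 / Z)'' = O(|s|^(-1 + 23 kappa)), below -1/2. The factor t^2 is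
  forced by the target: over a window of width \<eta> the function t^2 m changes by about t^2
  \<eta>, and equality with \<eta>^(-2/3) means \<eta> = t^(-6/5). A single factor t would give only
  t^(-3/5), too weak for the series with ln k. For \<psi> a limit is wanted without a rate, so
  \<eta> stays fixed while the error, divided by t, vanishes.\<close>

definition ein_deriv :: "real \<Rightarrow> real" where
  "ein_deriv t = (if t = 0 then 1 else (exp t - 1) / t)"

text \<open>Up to an additive constant the regular part of the exponential integral: Ei u = ln |u| +
  \<open>ein u\<close> + const for u > -1. The base point -1 instead of 0 puts 0 in the interior of
  the domain, so that \<open>ein\<close> is continuous there from both sides, which the principal
  value at \<open>x = 1\<close> uses.\<close>

definition ein :: "real \<Rightarrow> real" where
  "ein u = integral {-1..u} ein_deriv"

lemma isCont_ein_deriv: "isCont ein_deriv t"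
proof (cases "t = 0")
  case True
  have "((\<lambda>t::real. (exp t - 1) / t) \<longlongrightarrow> 1) (at 0)"
    by real_asymp
  then have "(ein_deriv \<longlongrightarrow> 1) (at 0)"
    by (rule Lim_transform_eventually) (auto simp: ein_deriv_def eventually_at intro!: exI[of _ 1])
  then show ?thesis using True by (simp add: isCont_def ein_deriv_def)
next
  case False
  have "isCont (\<lambda>t. (exp t - 1) / t) t" using False by (intro continuous_intros) auto
  moreover have "eventually (\<lambda>x. ein_deriv x = (exp x - 1) / x) (nhds t)"
    using t1_space_nhds[OF False] by eventually_elim (auto simp: ein_deriv_def)
  ultimately show ?thesis by (simp add: isCont_cong)
qed

lemma ein_has_derivative:
  assumes "u > -1"
  shows "(ein has_real_derivative ein_deriv u) (at u)"
proof -
  have "((\<lambda>x. integral {-1..x} ein_deriv) has_real_derivative ein_deriv u) (at u within {-1..u+1})"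
    using assms isCont_ein_deriv
    by (intro integral_has_real_derivative continuous_at_imp_continuous_on) auto
  then have "(ein has_real_derivative ein_deriv u) (at u within {-1..u+1})"
    by (simp add: ein_def[abs_def])
  then have "(ein has_real_derivative ein_deriv u) (at u within {-1<..<u+1})"
    by (rule DERIV_subset) auto
  then show ?thesis
    using assms by (simp add: at_within_open[of u "{-1<..<u+1}"])
qed

lemma ein_deriv_bounds:
  assumes "t \<ge> 0" shows "0 \<le> ein_deriv t" "ein_deriv t \<le> exp t"
proof -
  show "0 \<le> ein_deriv t" using assms by (auto simp: ein_deriv_def)
  show "ein_deriv t \<le> exp t"
  proof (cases "t = 0")
    case False
    then have t: "t > 0" using assms by simp
    have "exp t * (1 - t) \<le> exp t * exp (- t)"
      using exp_ge_add_one_self[of "-t"] by (intro mult_left_mono) auto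
    then have "exp t - 1 \<le> t * exp t"
      by (simp add: algebra_simps flip: exp_add)
    then show ?thesis using t by (simp add: ein_deriv_def divide_simps mult.commute)
  qed (simp add: ein_deriv_def)
qed

text \<open>Mean value theorem. The factor \<open>u\<close> matters: at u = ln x / k it supplies a
  second factor 1 / k besides the one in mu(k) / k, so that the errors in the Riemann series are
  summable.\<close>

lemma ein_bound:
  assumes "u \<ge> 0"
  shows "\<bar>ein u - ein 0\<bar> \<le> u * exp u"
proof (cases "u = 0")
  case False
  then have u: "u > 0" using assms by simp
  obtain z where z: "0 < z" "z < u" "ein u - ein 0 = (u - 0) * ein_deriv z"
    using MVT2[OF u, of ein ein_deriv] ein_has_derivative by force
  have "0 \<le> ein_deriv z" "ein_deriv z \<le> exp u"
    using ein_deriv_bounds[of z] z by (auto intro: order_trans)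
  then show ?thesis using z u by (simp add: abs_mult mult_left_mono)
qed simp

text \<open>An antiderivative of \<open>1 / ln x\<close> on both sides of the singularity \<open>x = 1\<close>; the principal value of the
  jump there is 0, so \<open>li\<close> differs from it by a constant.\<close>

definition li_prim :: "real \<Rightarrow> real" where
  "li_prim x = ln \<bar>ln x\<bar> + ein (ln x)"

lemma ln_half_gt: "x \<ge> 1 / 2 \<Longrightarrow> ln x > (-1 :: real)"
proof -
  assume x: "x \<ge> 1 / 2"
  have "exp (-1 :: real) < 1 / 2"
    using exp_ge_one_plus_x_over_n_power_n[of 2 1] exp_lower_Taylor_quadratic[of 1]
    by (simp add: exp_minus field_simps)
  then show ?thesis using x by (smt (verit) exp_gt_zero ln_exp ln_less_cancel_iff)
qed

text \<open>As exp (ln x) = x, the part -1 / (x ln x) of the derivative of \<open>ein (ln x)\<close>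
  cancels the derivative of ln |ln x|.\<close>

lemma li_prim_has_derivative:
  assumes "x \<ge> 1 / 2" "x \<noteq> 1"
  shows "(li_prim has_real_derivative 1 / ln x) (at x)"
proof -
  have nz: "ln x \<noteq> 0" using assms by simp
  have "((\<lambda>x. ln \<bar>x\<bar>) has_real_derivative 1 / ln x) (at (ln x))"
  proof (cases "ln x > 0")
    case True
    show ?thesis
      by (rule has_field_derivative_transform_within_open[OF DERIV_ln_divide[OF True], of "{0<..}"])
         (use True in auto)
  next
    case False
    then have "ln x < 0" using nz by simp
    then have "((\<lambda>x. ln (- x)) has_real_derivative 1 / ln x) (at (ln x))"
      by (auto intro!: derivative_eq_intros)
    then show ?thesis
      by (rule has_field_derivative_transform_within_open[of _ _ _ "{..<0}"])
         (use \<open>ln x < 0\<close> in auto)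
  qed
  then have "((\<lambda>x. ln \<bar>ln x\<bar>) has_real_derivative 1 / ln x * (1 / x)) (at x)"
    by (rule DERIV_chain2) (use assms in \<open>auto intro!: derivative_eq_intros\<close>)
  moreover have "((\<lambda>x. ein (ln x)) has_real_derivative ein_deriv (ln x) * (1 / x)) (at x)"
    using assms ln_half_gt[of x]
    by (intro DERIV_chain2[OF ein_has_derivative] derivative_eq_intros) auto
  ultimately have "(li_prim has_real_derivative 1 / ln x * (1 / x) + ein_deriv (ln x) * (1 / x)) (at x)"
    unfolding li_prim_def[abs_def] by (rule DERIV_add)
  also have "1 / ln x * (1 / x) + ein_deriv (ln x) * (1 / x) = 1 / ln x"
    using assms nz by (simp add: ein_deriv_def field_simps)
  finally show ?thesis .
qed

lemma has_integral_inverse_ln: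
  assumes "1 / 2 \<le> a" "a \<le> b" "1 \<notin> {a..b}"
  shows "((\<lambda>t. 1 / ln t) has_integral (li_prim b - li_prim a)) {a..b}"
proof (rule fundamental_theorem_of_calculus)
  fix x assume x: "x \<in> {a..b}"
  have "(li_prim has_real_derivative 1 / ln x) (at x within {a..b})"
    using x assms by (intro has_field_derivative_at_within[OF li_prim_has_derivative]) auto
  then show "(li_prim has_vector_derivative 1 / ln x) (at x within {a..b})"
    by (simp add: has_real_derivative_iff_has_vector_derivative)
qed fact

text \<open>At \<open>t = 0\<close> the formal value of \<open>1 / ln t\<close> is 0, which is also
  the limit from the right.\<close>

lemma continuous_on_inverse_ln: "continuous_on {0..1/2} (\<lambda>t::real. 1 / ln t)"
  unfolding continuous_on_eq_continuous_within
proof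
  fix t :: real assume t: "t \<in> {0..1/2}"
  show "continuous (at t within {0..1/2}) (\<lambda>t. 1 / ln t)"
  proof (cases "t = 0")
    case True
    have "((\<lambda>t::real. 1 / ln t) \<longlongrightarrow> 0) (at_right 0)" by real_asymp
    then have "((\<lambda>t::real. 1 / ln t) \<longlongrightarrow> 0) (at 0 within {0..1/2})"
      by (simp add: at_within_Icc_at_right)
    then show ?thesis using True by (simp add: continuous_within)
  next
    case False
    then have "t > 0" "ln t \<noteq> 0" using t by auto
    then show ?thesis by (intro continuous_intros) auto
  qed
qed

lemma li_eq:
  obtains K where "\<And>x. x > 1 \<Longrightarrow> li x = K + li_prim x"
proof
  define I where "I = integral {0..1/2} (\<lambda>t::real. 1 / ln t)"
  fix x :: real assume x: "x > 1"
  \<comment> \<open>The cut at 1/2 separates the endpoint 0, where continuity of the integrand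
    suffices, from the range on which \<open>li_prim\<close> is an antiderivative.\<close>
  define J where "J = (\<lambda>\<epsilon>. I + (li_prim (1 - \<epsilon>) - li_prim (1/2)) + (li_prim x - li_prim (1 + \<epsilon>)))"
  have "integral ({0..x} - {1 - \<epsilon><..<1 + \<epsilon>}) (\<lambda>t. 1 / ln t) = J \<epsilon>"
    if e: "\<epsilon> > 0" "\<epsilon> < 1/2" "\<epsilon> < x - 1" for \<epsilon>
  proof (rule integral_unique)
    have 1: "((\<lambda>t. 1 / ln t) has_integral I) {0..1/2}"
      unfolding I_def
      by (intro integrable_integral integrable_continuous_interval continuous_on_inverse_ln)
    have 2: "((\<lambda>t. 1 / ln t) has_integral (li_prim (1 - \<epsilon>) - li_prim (1/2))) {1/2..1-\<epsilon>}"
      using e by (intro has_integral_inverse_ln) auto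
    have 3: "((\<lambda>t. 1 / ln t) has_integral (li_prim x - li_prim (1 + \<epsilon>))) {1+\<epsilon>..x}"
      using e by (intro has_integral_inverse_ln) auto
    have 12: "((\<lambda>t. 1 / ln t) has_integral (I + (li_prim (1 - \<epsilon>) - li_prim (1/2)))) {0..1-\<epsilon>}"
      using e by (intro has_integral_combine[OF _ _ 1 2]) auto
    have "((\<lambda>t. 1 / ln t) has_integral J \<epsilon>) ({0..1-\<epsilon>} \<union> {1+\<epsilon>..x})"
      unfolding J_def using e by (intro has_integral_Un 12 3) auto
    also have "{0..1-\<epsilon>} \<union> {1+\<epsilon>..x} = {0..x} - {1 - \<epsilon><..<1 + \<epsilon>}"
      using e by auto
    finally show "((\<lambda>t. 1 / ln t) has_integral J \<epsilon>) ({0..x} - {1 - \<epsilon><..<1 + \<epsilon>})" .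
  qed
  then have ev: "eventually (\<lambda>\<epsilon>. J \<epsilon> = integral ({0..x} - {1 - \<epsilon><..<1 + \<epsilon>}) (\<lambda>t. 1 / ln t)) (at_right 0)"
    using x by (auto simp: eventually_at_right_field intro!: exI[of _ "min (1/2) (x - 1)"])
  \<comment> \<open>Both inner logarithms have absolute value \<epsilon> (1 + o(1)), so the
    divergent parts ln \<epsilon> cancel.\<close>
  have "((\<lambda>\<epsilon>::real. ln \<bar>ln (1 - \<epsilon>)\<bar> - ln \<bar>ln (1 + \<epsilon>)\<bar>) \<longlongrightarrow> 0) (at_right 0)"
    by real_asymp
  moreover have "isCont ein 0"
    by (rule DERIV_isCont[OF ein_has_derivative]) simp
  have "((\<lambda>\<epsilon>. ein (ln (1 - \<epsilon>)) - ein (ln (1 + \<epsilon>))) \<longlongrightarrow> ein 0 - ein 0) (at_right 0)"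
    by (intro tendsto_diff isCont_tendsto_compose[OF \<open>isCont ein 0\<close>]; real_asymp)
  ultimately have "((\<lambda>\<epsilon>. (ln \<bar>ln (1 - \<epsilon>)\<bar> - ln \<bar>ln (1 + \<epsilon>)\<bar>) +
      (ein (ln (1 - \<epsilon>)) - ein (ln (1 + \<epsilon>))) + (I - li_prim (1/2) + li_prim x))
      \<longlongrightarrow> 0 + (ein 0 - ein 0) + (I - li_prim (1/2) + li_prim x)) (at_right 0)"
    by (intro tendsto_add tendsto_const)
  then have "(J \<longlongrightarrow> I - li_prim (1/2) + li_prim x) (at_right 0)"
    unfolding J_def by (simp add: li_prim_def algebra_simps)
  from Lim_transform_eventually[OF this ev]
  have "((\<lambda>\<epsilon>. integral ({0..x} - {1 - \<epsilon><..<1 + \<epsilon>}) (\<lambda>t. 1 / ln t))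
     \<longlongrightarrow> I - li_prim (1/2) + li_prim x) (at_right 0)" .
  then show "li x = (I - li_prim (1/2)) + li_prim x"
    unfolding li_def by (intro tendsto_Lim) auto
qed


lemma li_prim_asymp: "li_prim \<sim>[at_top] (\<lambda>x. x / ln x)"
proof (rule asymp_equivI')
  show "((\<lambda>x. li_prim x / (x / ln x)) \<longlongrightarrow> 1) at_top"
  proof (rule lhospital_at_top_at_top)
    show "filterlim (\<lambda>x::real. x / ln x) at_top at_top" by real_asymp
    show "eventually (\<lambda>x::real. 1 / ln x - 1 / (ln x)\<^sup>2 \<noteq> 0) at_top"
      using eventually_gt_at_top[of "exp 1"]
    proof eventually_elim
      case (elim x)
      then have "1 < ln x" using exp_gt_zero by (smt (verit) ln_exp ln_less_cancel_iff)
      then show ?case by (simp add: power2_eq_square field_simps)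
    qed
    show "eventually (\<lambda>x. (li_prim has_real_derivative 1 / ln x) (at x)) at_top"
      using eventually_gt_at_top[of 1] by eventually_elim (intro li_prim_has_derivative; simp)
    show "eventually (\<lambda>x. ((\<lambda>x. x / ln x) has_real_derivative 1 / ln x - 1 / (ln x)\<^sup>2) (at x)) at_top"
      using eventually_gt_at_top[of 1]
      by eventually_elim (auto intro!: derivative_eq_intros simp: field_simps power2_eq_square)
    show "((\<lambda>x::real. (1 / ln x) / (1 / ln x - 1 / (ln x)\<^sup>2)) \<longlongrightarrow> 1) at_top" by real_asymp
  qed
qed

text \<open>One error budget for all comparisons: the mesh costs O(sqrt x), the terms k \<ge> 2 of
  the Riemann series cost sqrt x ln x.\<close>

lemma asymp_equiv_perturb:
  assumes "g \<sim>[at_top] (\<lambda>x::real. x / ln x)" "(\<lambda>x. f x - g x) \<in> O(\<lambda>x. sqrt x * ln x)"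
  shows "f \<sim>[at_top] (\<lambda>x. x / ln x)"
proof -
  have "(\<lambda>x::real. sqrt x * ln x) \<in> o(\<lambda>x. x / ln x)" by real_asymp
  then have "(\<lambda>x. f x - g x) \<in> o(\<lambda>x. x / ln x)"
    using assms(2) landau_o.big_small_trans by blast
  moreover have "(\<lambda>x. g x - x / ln x) \<in> o(\<lambda>x. x / ln x)"
    using assms(1) by (simp add: asymp_equiv_altdef)
  ultimately have "(\<lambda>x. (f x - g x) + (g x - x / ln x)) \<in> o(\<lambda>x. x / ln x)"
    by (rule sum_in_smallo)
  then show ?thesis by (simp add: asymp_equiv_altdef)
qed

lemma li_asymp: "li \<sim>[at_top] (\<lambda>x. x / ln x)"
proof -
  obtain K where K: "\<And>x. x > 1 \<Longrightarrow> li x = K + li_prim x" using li_eq by blast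
  have "(\<lambda>_. K) \<in> O(\<lambda>x::real. sqrt x * ln x)" by real_asymp
  moreover have "eventually (\<lambda>x. li x - li_prim x = K) at_top"
    using eventually_gt_at_top[of 1] by eventually_elim (simp add: K)
  ultimately have "(\<lambda>x. li x - li_prim x) \<in> O(\<lambda>x. sqrt x * ln x)"
    by (subst landau_o.big.in_cong) auto
  then show ?thesis by (rule asymp_equiv_perturb[OF li_prim_asymp])
qed

lemma ln_ge_1: "x \<ge> 3 \<Longrightarrow> ln x \<ge> (1 :: real)"
  using exp_le by (subst ln_ge_iff) auto

lemma li_prim_diff_bounds:
  assumes "3 \<le> a" "a \<le> b"
  shows "(b - a) / ln b \<le> li_prim b - li_prim a" "li_prim b - li_prim a \<le> (b - a) / ln a"
proof -
  have "(b - a) / ln b \<le> li_prim b - li_prim a \<and> li_prim b - li_prim a \<le> (b - a) / ln a"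
  proof (cases "a = b")
    case False
    then have ab: "a < b" using assms by simp
    obtain z where z: "a < z" "z < b" "li_prim b - li_prim a = (b - a) * (1 / ln z)"
      using MVT2[OF ab, of li_prim "\<lambda>x. 1 / ln x"] li_prim_has_derivative assms by force
    have "1 \<le> ln a" "ln a \<le> ln z" "ln z \<le> ln b" using z assms ln_ge_1 by auto
    then show ?thesis using z ab by (auto intro!: divide_left_mono mult_pos_pos)
  qed simp
  then show "(b - a) / ln b \<le> li_prim b - li_prim a" "li_prim b - li_prim a \<le> (b - a) / ln a"
    by auto
qed

section \<open>The quadratic mesh and its Riemann sums\<close>

lemma L_seq_Suc: "L_seq l (Suc n) = L_seq l n + h_seq l n"
  by (simp add: h_seq_def)

lemma L_seq_ge_3:
  assumes "l \<ge> 1" "n \<ge> 2" shows "L_seq l n \<ge> 3"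
  using assms(2)
proof (induction n rule: dec_induct)
  case base
  then show ?case using assms by (simp add: L_seq_def)
next
  case (step n)
  then show ?case by (simp add: L_seq_Suc h_seq_eq add_increasing2)
qed

lemma L_seq_ge_square:
  assumes "l \<ge> 1" shows "L_seq l n \<ge> real n ^ 2 / 2"
proof (cases n)
  case (Suc m)
  have "real n * (1 * (real n - 1) + 2) \<le> real n * (real l * (real n - 1) + 2)"
    using Suc assms by (intro mult_left_mono add_mono mult_right_mono) auto
  then show ?thesis using Suc by (simp add: L_seq_def power2_eq_square algebra_simps)
qed (simp add: L_seq_def)

text \<open>For n \<ge> 2 one has h \<le> 2 l n and L \<ge> l n^2 / 4, and 4 l^2 n^2 divided by l
  n^2 / 4 is 16 l.\<close>

lemma h_seq_sq_le:
  assumes "l \<ge> 1" "n \<ge> 2" shows "h_seq l n ^ 2 / L_seq l n \<le> 16 * real l"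
proof -
  have l: "real l \<ge> 1" "real n \<ge> 2" using assms by auto
  have "1 * 1 \<le> real l * real n" using l by (intro mult_mono) auto
  then have "h_seq l n \<le> 2 * (real l * real n)" by (simp add: h_seq_eq)
  moreover have "0 \<le> h_seq l n" by (simp add: h_seq_eq)
  ultimately have "h_seq l n ^ 2 \<le> (2 * (real l * real n)) ^ 2" by (intro power_mono)
  also have "\<dots> = 16 * real l * (real n * (real l * real n / 2) / 2)"
    by (simp add: power2_eq_square)
  also have "\<dots> \<le> 16 * real l * L_seq l n"
  proof -
    have "0 \<le> real l * (real n - 2)" using l by (intro mult_nonneg_nonneg) auto
    then have "real l * real n / 2 \<le> real l * (real n - 1) + 2" by (simp add: algebra_simps)
    then show ?thesis unfolding L_seq_def
      by (intro mult_left_mono divide_right_mono) auto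
  qed
  finally show ?thesis using L_seq_ge_3[OF assms] by (simp add: divide_le_eq)
qed

text \<open>Each step of the sum is a Riemann-sum error \<open>h (1 / ln L - 1 / ln (L + h)) = O(h\<^sup>2 / L)\<close>, which is bounded.\<close>

lemma \<Sigma>_sum_approx:
  assumes "l \<ge> 1" "n \<ge> 2"
  shows "\<bar>\<Sigma>_sum l n - li_prim (L_seq l n)\<bar>
    \<le> \<bar>\<Sigma>_sum l 2 - li_prim (L_seq l 2)\<bar> + 16 * real l * real n"
  using assms(2)
proof (induction n rule: dec_induct)
  case (step n)
  define a b h where "a = L_seq l n" and "b = L_seq l (Suc n)" and "h = h_seq l n"
  have ab: "b = a + h" "h \<ge> 0" "a \<ge> 3"
    using L_seq_ge_3[OF assms(1) step.hyps(1)]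
    by (auto simp: a_def b_def h_def L_seq_Suc h_seq_eq)
  have lna: "ln a \<ge> 1" "ln b \<ge> ln a" using ab by (auto intro: ln_ge_1)
  have "\<Sigma>_sum l (Suc n) = \<Sigma>_sum l n + h / ln b"
    using step.hyps by (simp add: \<Sigma>_sum_def s_seq_def h_def b_def atLeastLessThanSuc)
  then have eq: "\<Sigma>_sum l (Suc n) - li_prim b = (\<Sigma>_sum l n - li_prim a) + (h / ln b - (li_prim b - li_prim a))"
    by simp
  have "ln b - ln a \<le> h / a"
    using ab ln_le_minus_one[of "b / a"] by (simp add: ln_div field_simps)
  then have "h * (ln b - ln a) \<le> h * (h / a)" using ab by (intro mult_left_mono) auto
  also have "\<dots> \<le> 16 * real l"
    using h_seq_sq_le[OF assms(1) step.hyps(1)] by (simp add: a_def h_def power2_eq_square)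
  finally have "h * (ln b - ln a) \<le> 16 * real l" .
  moreover have "h / ln a - h / ln b = h * (ln b - ln a) / (ln a * ln b)"
    using lna by (simp add: field_simps)
  moreover have "1 * 1 \<le> ln a * ln b" using lna by (intro mult_mono) auto
  then have "h * (ln b - ln a) / (ln a * ln b) \<le> h * (ln b - ln a) / 1"
    using lna ab by (intro divide_left_mono) auto
  ultimately have "h / ln a - h / ln b \<le> 16 * real l" by linarith
  moreover have "h / ln b \<le> li_prim b - li_prim a" "li_prim b - li_prim a \<le> h / ln a"
    using li_prim_diff_bounds[of a b] ab by auto
  ultimately have "\<bar>h / ln b - (li_prim b - li_prim a)\<bar> \<le> 16 * real l" by linarith
  then show ?case using step.IH eq by (simp add: a_def b_def algebra_simps)
qed auto

lemma n_idx_le: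
  assumes "l \<ge> 1" "x > 0" shows "real (n_idx l x) \<le> 1 + sqrt (2 * x)"
proof -
  have "real (n_idx l x - 1) ^ 2 / 2 < x"
    using L_seq_ge_square[OF assms(1), of "n_idx l x - 1"] n_idx_bounds(2)[OF assms] by linarith
  then have "real (n_idx l x - 1) \<le> sqrt (2 * x)" by (intro real_le_rsqrt) auto
  then show ?thesis by simp
qed

lemma n_idx_ge_2:
  assumes "l \<ge> 1" "x > 1" shows "n_idx l x \<ge> 2"
proof (rule ccontr)
  assume "\<not> ?thesis"
  then have "n_idx l x = 1" using n_idx_bounds(1)[of l x] assms by simp
  then show False using n_idx_bounds(3)[of l x] assms by (simp add: L_seq_def)
qed

lemma h_seq_n_idx_bounds:
  assumes "l \<ge> 1" "x > 3"
  defines "n \<equiv> n_idx l x"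
  shows "0 \<le> L_seq l n - x" "L_seq l n - x \<le> h_seq l (n - 1)" "h_seq l (n - 1) \<le> 1 + real l * real n"
    "ln (L_seq l n) \<ge> 1"
proof -
  have n: "n \<ge> 2" using n_idx_ge_2[of l x] assms by (simp add: n_def)
  show "0 \<le> L_seq l n - x" using n_idx_bounds(3)[of l x] assms by (simp add: n_def)
  have "L_seq l n = L_seq l (n - 1) + h_seq l (n - 1)" using L_seq_Suc[of l "n - 1"] n by simp
  then show "L_seq l n - x \<le> h_seq l (n - 1)"
    using n_idx_bounds(2)[of l x] assms by (simp add: n_def)
  show "h_seq l (n - 1) \<le> 1 + real l * real n" by (simp add: h_seq_eq mult_left_mono)
  show "ln (L_seq l n) \<ge> 1" using L_seq_ge_3[OF assms(1) n] ln_ge_1 by blast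
qed

lemma q_term_bigo:
  assumes "l \<ge> 1" shows "q_term l \<in> O(\<lambda>x. sqrt x * ln x)"
proof -
  have "norm (q_term l x) \<le> 1 * norm (1 + real l * (1 + sqrt (2 * x)))" if x: "x > 3" for x
  proof -
    define n where "n = n_idx l x"
    note b = h_seq_n_idx_bounds[OF assms x, folded n_def]
    have q0: "0 \<le> q_term l x" unfolding q_term_def n_def[symmetric]
      using b by (intro divide_nonneg_nonneg mult_nonneg_nonneg) auto
    have "1 * 1 \<le> sqrt (real l) * ln (L_seq l n)" using b(4) assms by (intro mult_mono) auto
    then have "q_term l x \<le> h_seq l (n - 1) / 1" unfolding q_term_def n_def[symmetric]
      using b by (intro divide_left_mono) auto
    also have "\<dots> \<le> 1 + real l * real n" using b by simp
    also have "\<dots> \<le> 1 + real l * (1 + sqrt (2 * x))"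
      using n_idx_le[OF assms, of x] x by (simp add: n_def mult_left_mono)
    finally show ?thesis using q0 by simp
  qed
  then have "q_term l \<in> O(\<lambda>x. 1 + real l * (1 + sqrt (2 * x)))"
    by (intro bigoI[of _ 1] eventually_mono[OF eventually_gt_at_top[of 3]]) auto
  also have "(\<lambda>x. 1 + real l * (1 + sqrt (2 * x))) \<in> O(\<lambda>x. sqrt x * ln x)"
    using assms by real_asymp
  finally show ?thesis .
qed

text \<open>There are O(sqrt x) cells below x, each with a bounded error; the incomplete last cell
  costs at most the order of its own length, which is again O(sqrt x).\<close>

lemma S_hat_bigo:
  assumes "l \<ge> 1" shows "(\<lambda>x. S_hat l x - li_prim x) \<in> O(\<lambda>x. sqrt x * ln x)"
proof -
  define C where "C = \<bar>\<Sigma>_sum l 2 - li_prim (L_seq l 2)\<bar>"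
  define g where "g = (\<lambda>x. C + 16 * real l * (1 + sqrt (2 * x)) + (1 + real l * (1 + sqrt (2 * x))))"
  have "norm (S_hat l x - li_prim x) \<le> 1 * norm (g x)" if x: "x > 3" for x
  proof -
    define n where "n = n_idx l x"
    define L where "L = L_seq l n"
    note b = h_seq_n_idx_bounds[OF assms x, folded n_def, folded L_def]
    have n: "n \<ge> 2" using n_idx_ge_2[OF assms] x by (simp add: n_def)
    have nle: "real n \<le> 1 + sqrt (2 * x)" using n_idx_le[OF assms, of x] x by (simp add: n_def)
    have lnx: "ln x \<ge> 1" using ln_ge_1[of x] x by simp
    have 2: "(L - x) / ln x \<le> L - x"
      using b lnx divide_left_mono[of 1 "ln x" "L - x"] by simp
    have 3: "0 \<le> (L - x) / ln L" using b by simp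
    have 4: "(L - x) / ln L \<le> li_prim L - li_prim x" "li_prim L - li_prim x \<le> (L - x) / ln x"
      using li_prim_diff_bounds[of x L] x b by auto
    have "S_hat l x - li_prim x = (\<Sigma>_sum l n - li_prim L) + ((li_prim L - li_prim x) - (L - x) / ln L)"
      by (simp add: S_hat_def n_def L_def)
    moreover have "\<bar>(li_prim L - li_prim x) - (L - x) / ln L\<bar> \<le> 1 + real l * real n"
      using 2 3 4 b by linarith
    moreover have "\<bar>\<Sigma>_sum l n - li_prim L\<bar> \<le> C + 16 * real l * real n"
      using \<Sigma>_sum_approx[OF assms n] by (simp add: C_def L_def)
    ultimately have "\<bar>S_hat l x - li_prim x\<bar> \<le> C + 16 * real l * real n + (1 + real l * real n)"
      by linarith
    also have "\<dots> \<le> g x" unfolding g_def using nle by (intro add_mono mult_left_mono) auto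
    finally show ?thesis by simp
  qed
  then have "(\<lambda>x. S_hat l x - li_prim x) \<in> O(g)"
    by (intro bigoI[of _ 1] eventually_mono[OF eventually_gt_at_top[of 3]]) auto
  also have "g \<in> O(\<lambda>x. sqrt x * ln x)"
    unfolding g_def using assms by real_asymp
  finally show ?thesis .
qed

lemma S_hat_asymp: "l \<ge> 1 \<Longrightarrow> S_hat l \<sim>[at_top] (\<lambda>x. x / ln x)"
  by (rule asymp_equiv_perturb[OF li_prim_asymp S_hat_bigo])

lemma S_shift_asymp:
  assumes "l \<ge> 1" shows "S_shift l c \<sim>[at_top] (\<lambda>x. x / ln x)"
proof (rule asymp_equiv_perturb[OF S_hat_asymp[OF assms]])
  have "(\<lambda>x. (- c) * q_term l x) \<in> O(\<lambda>x. sqrt x * ln x)"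
    using q_term_bigo[OF assms] by (cases "c = 0") (simp_all del: mult_minus_left)
  then show "(\<lambda>x. S_shift l c x - S_hat l x) \<in> O(\<lambda>x. sqrt x * ln x)"
    by (simp add: S_shift_def)
qed

section \<open>Laplace transforms and Gaussian means\<close>

text \<open>The functions live on the whole line and vanish for t < 0, so that transforms and
  Gaussian means are plain integrals over \<open>lborel\<close>. Growth below every exponential
  makes the transform available on all of Re s > 0.\<close>

definition subexp :: "(real \<Rightarrow> real) \<Rightarrow> bool" where
  "subexp f \<longleftrightarrow> f \<in> borel_measurable borel \<and> (\<forall>t<0. f t = 0) \<and>
     (\<forall>\<sigma>>0. \<exists>C. \<forall>t. \<bar>f t\<bar> \<le> C * exp (\<sigma> * t))"

definition laplace :: "(real \<Rightarrow> real) \<Rightarrow> complex \<Rightarrow> complex" where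
  "laplace f s = (LBINT t. of_real (f t) * exp (- s * of_real t))"

lemma subexpD:
  assumes "subexp f"
  shows "f \<in> borel_measurable borel" "t < 0 \<Longrightarrow> f t = 0"
    "\<sigma> > 0 \<Longrightarrow> \<exists>C\<ge>0. \<forall>t. \<bar>f t\<bar> \<le> C * exp (\<sigma> * t)"
proof -
  show "f \<in> borel_measurable borel" "t < 0 \<Longrightarrow> f t = 0" using assms by (auto simp: subexp_def)
  assume "\<sigma> > 0"
  then obtain C where C: "\<bar>f t\<bar> \<le> C * exp (\<sigma> * t)" for t
    using assms unfolding subexp_def by blast
  have "C \<ge> 0" using C[of 0] by simp
  then show "\<exists>C\<ge>0. \<forall>t. \<bar>f t\<bar> \<le> C * exp (\<sigma> * t)" using C by blast
qed

lemma subexp_times_t: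
  assumes "subexp f" shows "subexp (\<lambda>t. t * f t)"
  unfolding subexp_def
proof (intro conjI allI impI)
  show "(\<lambda>t. t * f t) \<in> borel_measurable borel" using subexpD(1)[OF assms] by measurable
  show "t * f t = 0" if "t < 0" for t using subexpD(2)[OF assms that] by simp
  fix \<sigma> :: real assume s: "\<sigma> > 0"
  obtain C where C: "C \<ge> 0" "\<And>t. \<bar>f t\<bar> \<le> C * exp (\<sigma> / 2 * t)"
    using subexpD(3)[OF assms, of "\<sigma> / 2"] s by auto
  have "\<bar>t * f t\<bar> \<le> (2 / \<sigma> * C) * exp (\<sigma> * t)" for t
  proof (cases "t < 0")
    case False
    have "\<sigma> / 2 * t \<le> exp (\<sigma> / 2 * t)" using exp_ge_add_one_self[of "\<sigma> / 2 * t"] by linarith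
    then have "t \<le> 2 / \<sigma> * exp (\<sigma> / 2 * t)" using s by (simp add: field_simps)
    then have "\<bar>t\<bar> * \<bar>f t\<bar> \<le> (2 / \<sigma> * exp (\<sigma> / 2 * t)) * (C * exp (\<sigma> / 2 * t))"
      using False C s by (intro mult_mono) auto
    also have "\<dots> = (2 / \<sigma> * C) * (exp (\<sigma> / 2 * t) * exp (\<sigma> / 2 * t))" by simp
    also have "\<dots> = (2 / \<sigma> * C) * exp (\<sigma> * t)" by (simp flip: exp_add)
    finally show ?thesis by (simp add: abs_mult)
  qed (use s C subexpD(2)[OF assms] in auto)
  then show "\<exists>C. \<forall>t. \<bar>t * f t\<bar> \<le> C * exp (\<sigma> * t)" by blast
qed

lemma integrable_exp_minus:
  assumes "\<sigma> > (0::real)" shows "integrable lborel (\<lambda>t. indicator {0..} t * exp (- \<sigma> * t))"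
proof -
  interpret prob_space "density lborel (exponential_density \<sigma>)"
    using assms by (rule prob_space_exponential_density)
  have "integrable (density lborel (exponential_density \<sigma>)) (\<lambda>_. 1 :: real)" by simp
  then have "integrable lborel (\<lambda>t. exponential_density \<sigma> t * 1)"
    using assms by (subst (asm) integrable_density) (auto simp: exponential_density_nonneg)
  then have "integrable lborel (\<lambda>t. (1 / \<sigma>) * (exponential_density \<sigma> t * 1))"
    by (rule integrable_mult_right)
  also have "(\<lambda>t. (1 / \<sigma>) * (exponential_density \<sigma> t * 1)) = (\<lambda>t. indicator {0..} t * exp (- \<sigma> * t))"
    using assms by (auto simp: exponential_density_def fun_eq_iff indicator_def)
  finally show ?thesis .
qed

lemma laplace_integrable_real:
  assumes "subexp f" "\<sigma> > 0" shows "integrable lborel (\<lambda>t. f t * exp (- \<sigma> * t))"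
proof -
  obtain C where C: "C \<ge> 0" "\<And>t. \<bar>f t\<bar> \<le> C * exp (\<sigma> / 2 * t)"
    using subexpD(3)[OF assms(1), of "\<sigma> / 2"] assms by auto
  have [measurable]: "f \<in> borel_measurable borel" using subexpD(1)[OF assms(1)] .
  show ?thesis
  proof (rule Bochner_Integration.integrable_bound)
    show "integrable lborel (\<lambda>t. C * (indicator {0..} t * exp (- (\<sigma> / 2) * t)))"
      using assms by (intro integrable_mult_right integrable_exp_minus) auto
    show "(\<lambda>t. f t * exp (- \<sigma> * t)) \<in> borel_measurable lborel" by measurable
    show "AE t in lborel. norm (f t * exp (- \<sigma> * t)) \<le> norm (C * (indicator {0..} t * exp (- (\<sigma> / 2) * t)))"
    proof (intro AE_I2)
      fix t
      show "norm (f t * exp (- \<sigma> * t)) \<le> norm (C * (indicator {0..} t * exp (- (\<sigma> / 2) * t)))"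
      proof (cases "t < 0")
        case True then show ?thesis by (simp add: subexpD(2)[OF assms(1)])
      next
        case False
        have "\<bar>f t\<bar> * exp (- \<sigma> * t) \<le> C * exp (\<sigma> / 2 * t) * exp (- \<sigma> * t)"
          using C by (intro mult_right_mono) auto
        also have "\<dots> = C * exp (- (\<sigma> / 2) * t)" by (simp add: mult.assoc flip: exp_add)
        finally show ?thesis using C False by (simp add: abs_mult)
      qed
    qed
  qed
qed

lemma laplace_integrable:
  assumes "subexp f" "Re s > 0"
  shows "integrable lborel (\<lambda>t. of_real (f t) * exp (- s * of_real t))"
proof (rule Bochner_Integration.integrable_bound[OF laplace_integrable_real[OF assms]])
  have [measurable]: "f \<in> borel_measurable borel" using subexpD(1)[OF assms(1)] .
  show "(\<lambda>t. of_real (f t) * exp (- s * of_real t)) \<in> borel_measurable lborel" by measurable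
qed (auto simp: norm_mult abs_mult)

lemma norm_exp_minus_1_minus_le:
  fixes z :: complex
  shows "norm (exp z - 1 - z) \<le> norm z ^ 2 * exp \<bar>Re z\<bar>"
  using Taylor_exp[of z 1] by (simp add: numeral_2_eq_2 algebra_simps)

text \<open>Integrating the second-order bound for exp shows that the difference quotient is off by
  at most |h| M, where M is the absolute integral of t^2 f(t) exp (- \<sigma> t). One half of
  \<open>Re s\<close> absorbs the factor exp (|h| t), the other half keeps M finite.\<close>

lemma laplace_has_derivative:
  assumes "subexp f" "Re s > 0"
  shows "(laplace f has_field_derivative - laplace (\<lambda>t. t * f t) s) (at s)"
proof -
  define \<sigma> where "\<sigma> = Re s / 2"
  have sg: "\<sigma> > 0" using assms by (simp add: \<sigma>_def)
  define M where "M = (LBINT t. \<bar>t * (t * f t)\<bar> * exp (- \<sigma> * t))"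
  have f1: "subexp (\<lambda>t. t * f t)" by (rule subexp_times_t[OF assms(1)])
  have intM: "integrable lborel (\<lambda>t. \<bar>t * (t * f t)\<bar> * exp (- \<sigma> * t))"
    using integrable_abs[OF laplace_integrable_real[OF subexp_times_t[OF f1] sg]] by (simp add: abs_mult)
  have bound: "norm ((laplace f (s + h) - laplace f s) / h - (- laplace (\<lambda>t. t * f t) s)) \<le> norm h * M"
    if h: "h \<noteq> 0" "norm h < \<sigma>" for h
  proof -
    have "Re h > - \<sigma>" using abs_Re_le_cmod[of h] h by linarith
    then have rh: "Re (s + h) > 0" using assms unfolding \<sigma>_def by simp
    have "laplace f (s + h) - laplace f s + h * laplace (\<lambda>t. t * f t) s
      = (LBINT t. of_real (f t) * exp (- (s + h) * of_real t) - of_real (f t) * exp (- s * of_real t)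
           + h * (of_real (t * f t) * exp (- s * of_real t)))"
      unfolding laplace_def
      using laplace_integrable[OF assms] laplace_integrable[OF assms(1) rh] laplace_integrable[OF f1 assms(2)]
      by (subst Bochner_Integration.integral_add, (intro Bochner_Integration.integrable_diff integrable_mult_right; simp)+,
          subst Bochner_Integration.integral_diff) auto
    also have "norm \<dots> \<le> (LBINT t. norm h ^ 2 * (\<bar>t * (t * f t)\<bar> * exp (- \<sigma> * t)))"
    proof (rule Bochner_Integration.integral_norm_bound_integral)
      show "integrable lborel (\<lambda>t. of_real (f t) * exp (- (s + h) * of_real t) - of_real (f t) * exp (- s * of_real t)
           + h * (of_real (t * f t) * exp (- s * of_real t)))"
        using laplace_integrable[OF assms] laplace_integrable[OF assms(1) rh] laplace_integrable[OF f1 assms(2)]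
        by (intro Bochner_Integration.integrable_add Bochner_Integration.integrable_diff integrable_mult_right) auto
      show "integrable lborel (\<lambda>t. norm h ^ 2 * (\<bar>t * (t * f t)\<bar> * exp (- \<sigma> * t)))"
        by (intro integrable_mult_right intM)
      fix t :: real
      show "norm (of_real (f t) * exp (- (s + h) * of_real t) - of_real (f t) * exp (- s * of_real t)
           + h * (of_real (t * f t) * exp (- s * of_real t))) \<le> norm h ^ 2 * (\<bar>t * (t * f t)\<bar> * exp (- \<sigma> * t))"
      proof (cases "t < 0")
        case True then show ?thesis by (simp add: subexpD(2)[OF assms(1)])
      next
        case False
        define z where "z = - h * of_real t"
        have "of_real (f t) * exp (- (s + h) * of_real t) - of_real (f t) * exp (- s * of_real t)
           + h * (of_real (t * f t) * exp (- s * of_real t))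
          = of_real (f t) * exp (- s * of_real t) * (exp z - 1 - z)"
          by (simp add: z_def algebra_simps exp_add exp_diff exp_minus divide_simps)
        also have "norm \<dots> \<le> \<bar>f t\<bar> * exp (- Re s * t) * (norm z ^ 2 * exp \<bar>Re z\<bar>)"
          using norm_exp_minus_1_minus_le[of z] by (simp add: norm_mult mult_left_mono)
        also have "\<dots> \<le> \<bar>f t\<bar> * exp (- Re s * t) * (norm z ^ 2 * exp (\<sigma> * t))"
        proof -
          have "\<bar>Re z\<bar> \<le> norm z" by (rule abs_Re_le_cmod)
          also have "norm z \<le> \<sigma> * t" using h False by (auto simp: z_def norm_mult intro!: mult_right_mono)
          finally show ?thesis by (intro mult_left_mono) auto
        qed
        also have "\<dots> = norm h ^ 2 * (\<bar>t * (t * f t)\<bar> * (exp (- Re s * t) * exp (\<sigma> * t)))"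
          by (simp add: z_def norm_mult power_mult_distrib abs_mult power2_eq_square)
        also have "exp (- Re s * t) * exp (\<sigma> * t) = exp (- \<sigma> * t)"
          by (simp add: \<sigma>_def flip: exp_add)
        finally show ?thesis .
      qed
    qed
    also have "\<dots> = norm h ^ 2 * M" by (simp add: M_def)
    finally have *: "norm (laplace f (s + h) - laplace f s + h * laplace (\<lambda>t. t * f t) s) \<le> norm h ^ 2 * M" .
    have "(laplace f (s + h) - laplace f s) / h - (- laplace (\<lambda>t. t * f t) s)
       = (laplace f (s + h) - laplace f s + h * laplace (\<lambda>t. t * f t) s) / h"
      using h by (simp add: field_simps)
    also have "norm \<dots> \<le> norm h ^ 2 * M / norm h"
      using * by (simp add: norm_divide divide_right_mono)
    finally show ?thesis using h by (simp add: power2_eq_square)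
  qed
  have "((\<lambda>h. (laplace f (s + h) - laplace f s) / h - (- laplace (\<lambda>t. t * f t) s)) \<longlongrightarrow> 0) (at 0)"
  proof (rule Lim_null_comparison)
    show "eventually (\<lambda>h. norm ((laplace f (s + h) - laplace f s) / h - (- laplace (\<lambda>t. t * f t) s)) \<le> norm h * M) (at 0)"
      using sg bound by (auto simp: eventually_at dist_norm intro!: exI[of _ \<sigma>])
    show "((\<lambda>h::complex. norm h * M) \<longlongrightarrow> 0) (at 0)"
      by (auto intro!: tendsto_eq_intros)
  qed
  then show ?thesis unfolding DERIV_def by (rule LIM_zero_cancel)
qed

section \<open>Gaussian means as frequency averages of the transform\<close>

lemma gaussian_eq:
  assumes "\<eta> > 0"
  shows "complex_of_real (normal_density t0 \<eta> t)
    = of_real (1 / (sqrt (2 * pi) * \<eta>)) * (LINT x|std_normal_distribution. iexp ((t - t0) / \<eta> * x))"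
proof -
  \<comment> \<open>The characteristic function of the standard normal law is itself a Gaussian,
    which writes the density as a superposition of the frequencies x / \<eta>.\<close>
  have "(LINT x|std_normal_distribution. iexp ((t - t0) / \<eta> * x)) = char std_normal_distribution ((t - t0) / \<eta>)"
    by (simp add: char_def)
  also have "\<dots> = of_real (exp (- ((t - t0) / \<eta>)\<^sup>2 / 2))"
    by (simp add: char_std_normal_distribution)
  finally show ?thesis
    using assms by (simp add: normal_density_def power_divide real_sqrt_mult)
qed

text \<open>Split at |x| = a: inside, the integrand is at most 1 on a set of mass at most 2 a;
  outside, it is at most (a / \<eta>)^(-1/2), which equals a exactly for a = \<eta>^(1/3).\<close>

lemma std_normal_powr_bound:
  assumes "0 < \<eta>" "\<eta> \<le> 1"
  shows "integrable std_normal_distribution (\<lambda>x. (1 + \<bar>x / \<eta>\<bar>) powr (-1/2))"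
    "(LINT x|std_normal_distribution. (1 + \<bar>x / \<eta>\<bar>) powr (-1/2)) \<le> 3 * \<eta> powr (1/3)"
proof -
  interpret prob_space std_normal_distribution by (rule real_dist_normal_dist[THEN real_distribution.axioms(1)])
  show int: "integrable std_normal_distribution (\<lambda>x. (1 + \<bar>x / \<eta>\<bar>) powr (-1/2))"
  proof (rule integrable_const_bound[of _ 1])
    show "AE x in std_normal_distribution. norm ((1 + \<bar>x / \<eta>\<bar>) powr (-1/2)) \<le> 1"
      using powr_mono2'[of "-1/2" 1] by (auto intro!: AE_I2)
  qed measurable
  define a where "a = \<eta> powr (1/3)"
  have a: "a > 0" using assms by (simp add: a_def)
  have "(LINT x|std_normal_distribution. (1 + \<bar>x / \<eta>\<bar>) powr (-1/2))
     \<le> (LINT x|std_normal_distribution. indicator {-a..a} x + a)"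
  proof (rule integral_mono[OF int])
    show "integrable std_normal_distribution (\<lambda>x. indicator {-a..a} x + a)"
      by (intro Bochner_Integration.integrable_add integrable_const integrable_real_indicator)
         (auto simp: emeasure_eq_measure)
    fix x :: real
    show "(1 + \<bar>x / \<eta>\<bar>) powr (-1/2) \<le> indicator {-a..a} x + a"
    proof (cases "x \<in> {-a..a}")
      case True
      have "(1 + \<bar>x / \<eta>\<bar>) powr (-1/2) \<le> 1 powr (-1/2)" by (intro powr_mono2') auto
      then show ?thesis using True a by simp
    next
      case False
      then have "a < \<bar>x\<bar>" by auto
      then have "a / \<eta> \<le> 1 + \<bar>x / \<eta>\<bar>" using assms by (simp add: field_simps)
      then have "(1 + \<bar>x / \<eta>\<bar>) powr (-1/2) \<le> (a / \<eta>) powr (-1/2)"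
        using a assms by (intro powr_mono2') auto
      also have "a / \<eta> = \<eta> powr (-2/3)"
        using assms powr_diff[of \<eta> "1/3" 1] by (simp add: a_def)
      also have "(\<eta> powr (-2/3)) powr (-1/2) = a" by (simp add: powr_powr a_def)
      finally show ?thesis using False by simp
    qed
  qed
  also have "\<dots> = measure std_normal_distribution {-a..a} + a"
    using prob_space by (subst Bochner_Integration.integral_add) (auto simp: emeasure_eq_measure)
  also have "measure std_normal_distribution {-a..a} \<le> 2 * a"
  proof -
    have "emeasure std_normal_distribution {-a..a} = (\<integral>\<^sup>+x. ennreal (std_normal_density x) * indicator {-a..a} x \<partial>lborel)"
      by (subst emeasure_density) auto
    also have "\<dots> \<le> (\<integral>\<^sup>+x. 1 * indicator {-a..a} x \<partial>lborel)"
    proof (intro nn_integral_mono mult_right_mono)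
      fix x :: real
      have "1 / sqrt (2 * pi) \<le> 1" using pi_gt3 by (simp add: field_simps)
      moreover have "exp (- x\<^sup>2 / 2) \<le> 1" by simp
      ultimately have "1 / sqrt (2 * pi) * exp (- x\<^sup>2 / 2) \<le> 1 * 1"
        by (intro mult_mono) auto
      then show "ennreal (std_normal_density x) \<le> 1" by (simp add: std_normal_density_def)
    qed auto
    also have "\<dots> = ennreal (2 * a)" using a by simp
    finally show ?thesis using a by (simp add: emeasure_eq_measure ennreal_le_iff)
  qed
  finally show "(LINT x|std_normal_distribution. (1 + \<bar>x / \<eta>\<bar>) powr (-1/2)) \<le> 3 * \<eta> powr (1/3)"
    by (simp add: a_def)
qed

text \<open>Fubini, once the density is written as a frequency integral. The damping factor makes f
  absolutely integrable, and the frequency x / \<eta> becomes the imaginary part (up to sign) of the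
  argument of the transform.\<close>

lemma laplace_gaussian_eq:
  assumes "subexp f" "\<delta> > 0" "\<eta> > 0"
  shows "complex_of_real (LBINT t. f t * exp (- \<delta> * t) * normal_density t0 \<eta> t)
    = of_real (1 / (sqrt (2 * pi) * \<eta>)) *
      (LINT x|std_normal_distribution. iexp (- t0 / \<eta> * x) * laplace f (Complex \<delta> (- (x / \<eta>))))"
proof -
  interpret N: prob_space std_normal_distribution by (rule real_dist_normal_dist[THEN real_distribution.axioms(1)])
  interpret pair_sigma_finite std_normal_distribution lborel
    by unfold_locales
  define c where "c = complex_of_real (1 / (sqrt (2 * pi) * \<eta>))"
  have [measurable]: "f \<in> borel_measurable borel" using subexpD(1)[OF assms(1)] .
  define F where "F = (\<lambda>x t. of_real (f t * exp (- \<delta> * t)) * iexp ((t - t0) / \<eta> * x))"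
  have intF: "integrable (std_normal_distribution \<Otimes>\<^sub>M lborel) (\<lambda>(x, t). F x t)"
  proof -
    have "integrable (std_normal_distribution \<Otimes>\<^sub>M lborel) (\<lambda>(x, t). f t * exp (- \<delta> * t))"
    proof (rule Fubini_integrable)
      show "AE x in std_normal_distribution. integrable lborel (\<lambda>t. case (x, t) of (x, t) \<Rightarrow> f t * exp (- \<delta> * t))"
        using laplace_integrable_real[OF assms(1,2)] by simp
    qed auto
    then show ?thesis
    proof (rule Bochner_Integration.integrable_bound)
      show "(\<lambda>(x, t). F x t) \<in> borel_measurable (std_normal_distribution \<Otimes>\<^sub>M lborel)"
        unfolding F_def by measurable
    qed (auto simp: F_def norm_mult)
  qed
  have "complex_of_real (LBINT t. f t * exp (- \<delta> * t) * normal_density t0 \<eta> t)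
     = (LBINT t. of_real (f t * exp (- \<delta> * t)) * of_real (normal_density t0 \<eta> t))"
    by (simp flip: integral_complex_of_real)
  also have "\<dots> = (LBINT t. c * (LINT x|std_normal_distribution. F x t))"
    unfolding gaussian_eq[OF assms(3)] F_def c_def by (intro Bochner_Integration.integral_cong) auto
  also have "\<dots> = c * (LBINT t. (LINT x|std_normal_distribution. F x t))" by simp
  also have "(LBINT t. (LINT x|std_normal_distribution. F x t)) = (LINT x|std_normal_distribution. (LBINT t. F x t))"
    using Fubini_integral[OF intF] by simp
  also have "\<dots> = (LINT x|std_normal_distribution. iexp (- t0 / \<eta> * x) * laplace f (Complex \<delta> (- (x / \<eta>))))"
  proof (intro Bochner_Integration.integral_cong refl)
    fix x
    have "F x t = iexp (- t0 / \<eta> * x) * (of_real (f t) * exp (- Complex \<delta> (- (x / \<eta>)) * of_real t))" for t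
    proof -
      have "exp (complex_of_real (- \<delta> * t)) * iexp ((t - t0) / \<eta> * x)
        = iexp (- t0 / \<eta> * x) * exp (- Complex \<delta> (- (x / \<eta>)) * of_real t)"
        unfolding exp_add[symmetric]
        by (rule arg_cong[of _ _ exp]) (simp add: complex_eq_iff diff_divide_distrib algebra_simps)
      then show ?thesis unfolding F_def of_real_mult exp_of_real[symmetric] by (simp add: mult_ac)
    qed
    then show "(LBINT t. F x t) = iexp (- t0 / \<eta> * x) * laplace f (Complex \<delta> (- (x / \<eta>)))"
      by (simp add: laplace_def)
  qed
  finally show ?thesis by (simp add: c_def)
qed

text \<open>A non-integrable function has integral 0 by convention, so the bound covers it too. This
  serves for the transform as a function of the frequency, whose measurability is never
  established.\<close>

lemma norm_integral_le:
  fixes f :: "'a :: euclidean_space \<Rightarrow> 'b :: {banach, second_countable_topology}"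
  assumes "integrable M g" "\<And>x. norm (f x) \<le> g x"
  shows "norm (integral\<^sup>L M f) \<le> integral\<^sup>L M g"
proof (cases "integrable M f")
  case True
  then show ?thesis using assms by (intro Bochner_Integration.integral_norm_bound_integral)
next
  case False
  have "0 \<le> g x" for x using assms(2)[of x] norm_ge_zero order_trans by blast
  then show ?thesis using False by (simp add: not_integrable_integral_eq Bochner_Integration.integral_nonneg)
qed

text \<open>The normalisation 1 / \<eta> of the density meets an average of order \<eta>^(1/3),
  whence the exponent -2/3.\<close>

lemma laplace_gaussian_bound_shift:
  assumes "subexp f" "\<delta> > 0" "0 < \<eta>" "\<eta> \<le> 1" "B \<ge> 0"
    and B: "\<And>y. norm (laplace f (Complex \<delta> y)) \<le> B * (1 + \<bar>y\<bar>) powr (-1/2)"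
  shows "\<bar>LBINT t. f t * exp (- \<delta> * t) * normal_density t0 \<eta> t\<bar> \<le> 3 * B * \<eta> powr (-2/3)"
proof -
  define I where "I = (LINT x|std_normal_distribution. iexp (- t0 / \<eta> * x) * laplace f (Complex \<delta> (- (x / \<eta>))))"
  have "norm I \<le> (LINT x|std_normal_distribution. B * (1 + \<bar>x / \<eta>\<bar>) powr (-1/2))"
  proof -
    have "integrable std_normal_distribution (\<lambda>x. B * (1 + \<bar>x / \<eta>\<bar>) powr (-1/2))"
      using std_normal_powr_bound(1)[OF assms(3,4)] by simp
    then show ?thesis unfolding I_def
      by (rule norm_integral_le) (use B[of "- (_ / \<eta>)"] in \<open>auto simp: norm_mult\<close>)
  qed
  also have "\<dots> \<le> B * (3 * \<eta> powr (1/3))"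
    using std_normal_powr_bound(2)[OF assms(3,4)] assms by (simp add: mult_left_mono)
  finally have I: "norm I \<le> B * (3 * \<eta> powr (1/3))" .
  have "\<bar>LBINT t. f t * exp (- \<delta> * t) * normal_density t0 \<eta> t\<bar>
     = norm (complex_of_real (LBINT t. f t * exp (- \<delta> * t) * normal_density t0 \<eta> t))" by simp
  also have "\<dots> = 1 / (sqrt (2 * pi) * \<eta>) * norm I"
    unfolding laplace_gaussian_eq[OF assms(1-3)] I_def[symmetric] using assms by (simp add: norm_mult norm_divide)
  also have "\<dots> \<le> 1 / (1 * \<eta>) * (B * (3 * \<eta> powr (1/3)))"
    using assms I pi_gt3 by (intro mult_mono divide_left_mono mult_right_mono) auto
  also have "\<dots> = 3 * B * (\<eta> powr (1/3) / \<eta> powr 1)" using assms by simp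
  also have "\<eta> powr (1/3) / \<eta> powr 1 = \<eta> powr (-2/3)" by (subst powr_diff[symmetric]) simp
  finally show ?thesis .
qed

lemma laplace_gaussian_integrable:
  assumes "subexp f" "\<eta> > 0"
  shows "integrable lborel (\<lambda>t. f t * normal_density t0 \<eta> t)"
proof -
  have [measurable]: "f \<in> borel_measurable borel" using subexpD(1)[OF assms(1)] .
  define K where "K = exp (t0 + \<eta>\<^sup>2 / 2) / sqrt (2 * pi * \<eta>\<^sup>2)"
  have "integrable lborel (\<lambda>t. K * (f t * exp (- 1 * t)))"
    by (intro integrable_mult_right laplace_integrable_real assms) simp
  then show ?thesis
  proof (rule Bochner_Integration.integrable_bound)
    show "AE t in lborel. norm (f t * normal_density t0 \<eta> t) \<le> norm (K * (f t * exp (- 1 * t)))"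
    proof (intro AE_I2)
      fix t
      \<comment> \<open>Completing the square: the density is at most a multiple of exp (- t),
        against which every subexponential function is integrable.\<close>
      have "0 \<le> ((t - t0) - \<eta>\<^sup>2)\<^sup>2 / (2 * \<eta>\<^sup>2)" by simp
      also have "\<dots> = (t - t0)\<^sup>2 / (2 * \<eta>\<^sup>2) - (t - t0) + \<eta>\<^sup>2 / 2"
        using assms by (simp add: power2_eq_square field_simps)
      finally have "exp (- (t - t0)\<^sup>2 / (2 * \<eta>\<^sup>2)) \<le> exp ((t0 + \<eta>\<^sup>2 / 2) + (- 1 * t))"
        by simp
      also have "\<dots> = exp (t0 + \<eta>\<^sup>2 / 2) * exp (- 1 * t)" by (rule exp_add)
      finally have "normal_density t0 \<eta> t \<le> K * exp (- 1 * t)"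
        unfolding normal_density_def K_def by (simp add: divide_right_mono)
      then have "\<bar>f t\<bar> * normal_density t0 \<eta> t \<le> \<bar>f t\<bar> * (K * exp (- 1 * t))"
        by (intro mult_left_mono) auto
      moreover have "K \<ge> 0" by (simp add: K_def)
      ultimately show "norm (f t * normal_density t0 \<eta> t) \<le> norm (K * (f t * exp (- 1 * t)))"
        by (simp add: abs_mult mult_ac)
    qed
  qed measurable
qed

text \<open>The Gaussian is its own Fourier transform, so the mean of \<open>f\<close> at scale \<open>\<eta>\<close> is an average of its Laplace
  transform over frequencies up to about \<open>1 / \<eta>\<close>; only bounds in the open half plane are needed.\<close>

theorem laplace_gaussian_bound:
  assumes "subexp f" "\<delta>0 > 0" "0 < \<eta>" "\<eta> \<le> 1" "B \<ge> 0"
    and B: "\<And>\<delta> y. 0 < \<delta> \<Longrightarrow> \<delta> \<le> \<delta>0 \<Longrightarrow> norm (laplace f (Complex \<delta> y)) \<le> B * (1 + \<bar>y\<bar>) powr (-1/2)"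
  shows "\<bar>LBINT t. f t * normal_density t0 \<eta> t\<bar> \<le> 3 * B * \<eta> powr (-2/3)"
proof -
  have [measurable]: "f \<in> borel_measurable borel" using subexpD(1)[OF assms(1)] .
  \<comment> \<open>The damping tends to 0 within the range (0, \<delta>0] where the bound
    \<open>B\<close> holds. Since f vanishes for t < 0, the damping factor is at most 1 wherever f
    is not 0, so the undamped integrand is a majorant.\<close>
  have lim: "((\<lambda>n. LBINT t. f t * exp (- (\<delta>0 / real (Suc n)) * t) * normal_density t0 \<eta> t)
    \<longlonglongrightarrow> (LBINT t. f t * normal_density t0 \<eta> t))"
  proof (rule integral_dominated_convergence)
    show "integrable lborel (\<lambda>t. \<bar>f t * normal_density t0 \<eta> t\<bar>)"
      by (intro integrable_abs laplace_gaussian_integrable assms)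
    show "AE t in lborel. (\<lambda>n. f t * exp (- (\<delta>0 / real (Suc n)) * t) * normal_density t0 \<eta> t)
       \<longlonglongrightarrow> f t * normal_density t0 \<eta> t"
    proof (intro AE_I2)
      fix t
      have "(\<lambda>n. exp (- (\<delta>0 / real (Suc n)) * t)) \<longlonglongrightarrow> exp (- 0 * t)"
        by (intro tendsto_intros LIMSEQ_Suc[OF lim_const_over_n])
      from tendsto_mult[OF tendsto_mult[OF tendsto_const this] tendsto_const]
      show "(\<lambda>n. f t * exp (- (\<delta>0 / real (Suc n)) * t) * normal_density t0 \<eta> t)
       \<longlonglongrightarrow> f t * normal_density t0 \<eta> t" by simp
    qed
    fix n
    show "AE t in lborel. norm (f t * exp (- (\<delta>0 / real (Suc n)) * t) * normal_density t0 \<eta> t)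
        \<le> \<bar>f t * normal_density t0 \<eta> t\<bar>"
    proof (intro AE_I2)
      fix t
      show "norm (f t * exp (- (\<delta>0 / real (Suc n)) * t) * normal_density t0 \<eta> t)
        \<le> \<bar>f t * normal_density t0 \<eta> t\<bar>"
      proof (cases "t < 0")
        case False
        have "exp (- (\<delta>0 / real (Suc n)) * t) \<le> 1" using False assms by simp
        then show ?thesis by (auto simp: abs_mult intro!: mult_right_mono mult_left_le)
      qed (simp add: subexpD(2)[OF assms(1)])
    qed
  qed measurable
  show ?thesis
  proof (rule tendsto_upperbound[OF tendsto_rabs[OF lim]])
    have "\<bar>LBINT t. f t * exp (- (\<delta>0 / real (Suc n)) * t) * normal_density t0 \<eta> t\<bar> \<le> 3 * B * \<eta> powr (-2/3)" for n
      by (rule laplace_gaussian_bound_shift[OF assms(1)])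
         (use assms in \<open>auto simp: divide_le_eq mult_le_cancel_left1\<close>)
    then show "\<forall>\<^sub>F n in sequentially. \<bar>LBINT t. f t * exp (- (\<delta>0 / real (Suc n)) * t) * normal_density t0 \<eta> t\<bar> \<le> 3 * B * \<eta> powr (-2/3)"
      by simp
  qed simp
qed

section \<open>The function \<open>s \<zeta>(1 + s)\<close>\<close>

text \<open>Since \<open>zterm n s = s (n\<^bsup>-1-s\<^esup> - \<integral>x\<^bsup>-1-s\<^esup> dx)\<close> with the integral over \<open>[n, n + 1]\<close>, the sum of these terms is
  \<open>s \<zeta>(1 + s) - 1\<close>. Working with \<open>szeta s = s \<zeta>(1 + s)\<close> removes the pole.\<close>

definition zterm :: "nat \<Rightarrow> complex \<Rightarrow> complex" where
  "zterm n s = s * of_nat n powr (-1 - s) - of_nat n powr (- s) + of_nat (Suc n) powr (- s)"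

definition szeta :: "complex \<Rightarrow> complex" where
  "szeta s = 1 + (\<Sum>k. zterm (Suc k) s)"

text \<open>The first bound is by size, the second by cancellation. The decay orders 1 and 2 are
  lowered by the 1/100 that the strip extends to the left of 0.\<close>

lemma zterm_bound_coarse:
  assumes "n \<ge> 1" "Re s \<ge> -1/100" "Re s \<le> 3"
  shows "norm (zterm n s) \<le> 2 * norm s * real n powr (-99/100)"
    and "norm (zterm n s) \<le> norm s * norm (1 + s) * real n powr (-199/100)"
proof -
  have deriv: "((\<lambda>x. x powr a) has_field_derivative a * x powr (a - 1)) (at x within A)"
    if "x \<in> closed_segment (of_nat n) (of_nat (Suc n))" for x a :: complex and A
  proof -
    have "x \<notin> \<real>\<^sub>\<le>\<^sub>0"
    proof -
      have "Re x \<ge> real n" using that by (auto simp: closed_segment_def algebra_simps)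
      then show ?thesis using assms by (auto simp: complex_nonpos_Reals_iff)
    qed
    then show ?thesis by (auto intro!: derivative_eq_intros)
  qed
  have bnd: "norm (x powr a) \<le> real n powr c"
    if x: "x \<in> closed_segment (of_nat n) (of_nat (Suc n))" and a: "Re a \<le> c" "c \<le> 0" for x a :: complex and c
  proof -
    obtain u where u: "0 \<le> u" "u \<le> 1" "x = (1 - u) *\<^sub>R of_nat n + u *\<^sub>R of_nat (Suc n)"
      using x by (auto simp: closed_segment_def)
    define r where "r = (1 - u) * real n + u * real (Suc n)"
    have r: "r \<ge> real n" "x = of_real r"
      using u by (auto simp: r_def scaleR_conv_of_real algebra_simps)
    have "norm (x powr a) = r powr Re a"
      using r assms by (simp add: norm_powr_real_powr)
    also have "\<dots> \<le> r powr c" using r assms a by (intro powr_mono) auto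
    also have "\<dots> \<le> real n powr c" using r assms a by (intro powr_mono2') auto
    finally show ?thesis .
  qed
  let ?S = "closed_segment (of_nat n :: complex) (of_nat (Suc n))"
  have n: "of_nat n \<in> ?S" "of_nat (Suc n) \<in> ?S" by auto
  have len: "norm (of_nat (Suc n) - of_nat n :: complex) = 1" by simp
  have 1: "norm (of_nat (Suc n) powr (- s) - of_nat n powr (- s)) \<le> norm s * real n powr (-99/100) * norm (of_nat (Suc n) - of_nat n :: complex)"
  proof (rule field_differentiable_bound[OF convex_closed_segment deriv _ n(2) n(1)])
    fix x assume x: "x \<in> ?S"
    show "norm (- s * x powr (- s - 1)) \<le> norm s * real n powr (-99/100)"
    proof -
      have "Re (- s - 1) = - (1 + Re s)" "99/100 \<le> 1 + Re s" using assms(2) by auto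
      then have "Re (- s - 1) \<le> -99/100" by simp
      then have "norm (x powr (- s - 1)) \<le> real n powr (-99/100)" using bnd[OF x] by simp
      then show ?thesis by (simp add: norm_mult mult_left_mono)
    qed
  qed
  have 0: "norm (s * of_nat n powr (-1 - s)) \<le> norm s * real n powr (-99/100)"
  proof -
    have "Re (-1 - s) = - (1 + Re s)" "99/100 \<le> 1 + Re s" using assms(2) by auto
      then have "Re (-1 - s) \<le> -99/100" by simp
    then have "norm (of_nat n powr (-1 - s) :: complex) \<le> real n powr (-99/100)" using bnd[OF n(1)] by simp
    then show ?thesis by (simp add: norm_mult mult_left_mono)
  qed
  have "zterm n s = s * of_nat n powr (-1 - s) + (of_nat (Suc n) powr (- s) - of_nat n powr (- s))"
    by (simp add: zterm_def)
  also have "norm \<dots> \<le> norm (s * of_nat n powr (-1 - s)) + norm (of_nat (Suc n) powr (- s) - of_nat n powr (- s))"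
    by (rule norm_triangle_ineq)
  finally show "norm (zterm n s) \<le> 2 * norm s * real n powr (-99/100)"
    using 0 1 len by simp

  \<comment> \<open>The increment of \<open>\<phi>\<close> over [n, n + 1] is
    \<open>zterm n s\<close>. The added linear part makes the derivative vanish at x = n, so a
    second application of the mean value bound gains a further factor 1 / n.\<close>
  define \<phi> where "\<phi> = (\<lambda>x::complex. x powr (- s) + s * of_nat n powr (-1 - s) * (x - of_nat n))"
  have "norm (\<phi> (of_nat (Suc n)) - \<phi> (of_nat n)) \<le> norm s * (norm (1 + s) * real n powr (-199/100)) * norm (of_nat (Suc n) - of_nat n :: complex)"
  proof (rule field_differentiable_bound[OF convex_closed_segment _ _ n(2) n(1)])
    fix x assume x: "x \<in> ?S"
    show "(\<phi> has_field_derivative (- s * x powr (- s - 1) + s * of_nat n powr (-1 - s))) (at x within ?S)"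
      unfolding \<phi>_def by (rule derivative_eq_intros deriv[OF x] refl)+ simp
    have "norm (x powr (-1 - s) - of_nat n powr (-1 - s)) \<le> norm (1 + s) * real n powr (-199/100) * norm (x - of_nat n)"
    proof (rule field_differentiable_bound[OF convex_closed_segment deriv _ x n(1)])
      fix y assume y: "y \<in> ?S"
      have "norm ((-1 - s) * y powr (-1 - s - 1)) = norm (1 + s) * norm (y powr (-1 - s - 1))"
        unfolding norm_mult using norm_minus_cancel[of "1 + s"] by simp
      also have "\<dots> \<le> norm (1 + s) * real n powr (-199/100)"
      proof (intro mult_left_mono bnd[OF y])
        have "Re (-1 - s - 1) = - (2 + Re s)" "199/100 \<le> 2 + Re s" using assms(2) by auto
        then show "Re (-1 - s - 1) \<le> -199/100" by simp
      qed auto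
      finally show "norm ((-1 - s) * y powr (-1 - s - 1)) \<le> norm (1 + s) * real n powr (-199/100)" .
    qed
    also have "norm (x - of_nat n) \<le> 1"
      using segment_bound(1)[OF x] len by simp
    then have "norm (1 + s) * real n powr (-199/100) * norm (x - of_nat n) \<le> norm (1 + s) * real n powr (-199/100)"
      by (intro mult_left_le) auto
    finally have "norm (x powr (-1 - s) - of_nat n powr (-1 - s)) \<le> norm (1 + s) * real n powr (-199/100)" .
    moreover have "- s * x powr (- s - 1) + s * of_nat n powr (-1 - s) = - s * (x powr (-1 - s) - of_nat n powr (-1 - s))"
      by (simp add: minus_diff_commute[of s 1] right_diff_distrib)
    ultimately show "norm (- s * x powr (- s - 1) + s * of_nat n powr (-1 - s)) \<le> norm s * (norm (1 + s) * real n powr (-199/100))"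
      by (simp add: norm_mult mult_left_mono)
  qed
  moreover have "\<phi> (of_nat (Suc n)) - \<phi> (of_nat n) = zterm n s"
    by (simp add: \<phi>_def zterm_def)
  ultimately show "norm (zterm n s) \<le> norm s * norm (1 + s) * real n powr (-199/100)"
    using len by (simp add: mult.assoc)
qed

lemma min_le_powr:
  fixes a b c :: real
  assumes "0 \<le> c" "c \<le> a" "c \<le> b" "0 \<le> \<theta>" "\<theta> \<le> 1"
  shows "c \<le> a powr (1 - \<theta>) * b powr \<theta>"
proof (cases "c = 0")
  case False
  then have "c > 0" using assms by simp
  then have "c = c powr (1 - \<theta>) * c powr \<theta>" by (simp flip: powr_add)
  also have "\<dots> \<le> a powr (1 - \<theta>) * b powr \<theta>" using assms by (intro mult_mono powr_mono2) auto
  finally show ?thesis .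
qed simp

text \<open>Interpolating between the two bounds above gives a summable majorant at the price of only \<open>|1 + s|\<^bsup>1/50\<^esup>\<close>. The exponent
  must be small, because it is amplified about twentyfold in the bounds for \<open>1 / szeta\<close>.\<close>

lemma zterm_bound:
  assumes "n \<ge> 1" "Re s \<ge> -1/100" "Re s \<le> 3"
  shows "norm (zterm n s) \<le> 2 * norm s * norm (1 + s) powr (1/50) * real n powr (-101/100)"
proof (cases "s = 0")
  case False
  have n: "real n > 0" using assms by simp
  \<comment> \<open>The weight 1/50 gives the exponent (49 * 99 + 199) / 5000 = 101/100, just beyond
    1.\<close>
  have "norm (zterm n s) / norm s \<le> (2 * real n powr (-99/100)) powr (1 - 1/50) * (norm (1 + s) * real n powr (-199/100)) powr (1/50)"
    using zterm_bound_coarse[OF assms] False by (intro min_le_powr) (auto simp: field_simps)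
  also have "\<dots> = (2 powr (49/50)) * norm (1 + s) powr (1/50) * (real n powr ((-99/100) * (49/50)) * real n powr ((-199/100) * (1/50)))"
    by (simp add: powr_mult powr_powr)
  also have "real n powr ((-99/100) * (49/50)) * real n powr ((-199/100) * (1/50)) = real n powr (-101/100)"
    by (simp flip: powr_add)
  also have "2 powr (49/50) \<le> (2 powr 1 :: real)" by (intro powr_mono) auto
  finally have "norm (zterm n s) / norm s \<le> 2 * norm (1 + s) powr (1/50) * real n powr (-101/100)"
    by (simp add: mult_right_mono)
  then show ?thesis using False by (simp add: field_simps)
qed (use assms in \<open>simp add: zterm_def del: of_nat_Suc\<close>)

text \<open>The margin to the left of Re s = 0 leaves room for discs of a fixed radius around every
  point with Re s > 0, so that Cauchy's inequality bounds derivatives uniformly up to the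
  line.\<close>

definition wide_strip :: "complex set" where
  "wide_strip = {s. -1/100 < Re s \<and> Re s < 3}"

lemma open_wide_strip: "open wide_strip"
  unfolding wide_strip_def by (auto intro!: open_Collect_conj open_halfspace_Re_gt open_halfspace_Re_lt)

definition szeta_const :: real where "szeta_const = 2 * (\<Sum>k. real (Suc k) powr (-101/100))"

lemma summable_Suc_powr: "a < -1 \<Longrightarrow> summable (\<lambda>k. real (Suc k) powr a)"
  by (subst summable_Suc_iff) (simp add: summable_real_powr_iff)

lemma summable_zterm_majorant: "summable (\<lambda>k. real (Suc k) powr (-101/100))"
  by (rule summable_Suc_powr) simp

lemma szeta_const_pos: "szeta_const > 0"
  unfolding szeta_const_def using suminf_pos[OF summable_zterm_majorant] by simp

lemma zterm_sums:
  assumes "s \<in> wide_strip"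
  shows "(\<lambda>k. zterm (Suc k) s) sums (szeta s - 1)"
    and "norm (szeta s - 1) \<le> szeta_const * norm s * norm (1 + s) powr (1/50)"
proof -
  define c where "c = 2 * norm s * norm (1 + s) powr (1/50)"
  have b: "norm (zterm (Suc k) s) \<le> c * real (Suc k) powr (-101/100)" for k
    using zterm_bound[of "Suc k" s] assms by (simp add: wide_strip_def c_def)
  have sm: "summable (\<lambda>k. c * real (Suc k) powr (-101/100))"
    by (intro summable_mult summable_zterm_majorant)
  have sm': "summable (\<lambda>k. norm (zterm (Suc k) s))"
    by (rule summable_comparison_test'[OF sm, of 0]) (use b in auto)
  show "(\<lambda>k. zterm (Suc k) s) sums (szeta s - 1)"
    using summable_norm_cancel[OF sm'] by (simp add: szeta_def summable_sums)
  have "norm (szeta s - 1) \<le> (\<Sum>k. norm (zterm (Suc k) s))"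
    unfolding szeta_def using summable_norm[OF sm'] by simp
  also have "\<dots> \<le> (\<Sum>k. c * real (Suc k) powr (-101/100))"
    by (intro suminf_le b sm sm')
  also have "\<dots> = szeta_const * norm s * norm (1 + s) powr (1/50)"
    by (subst suminf_mult[OF summable_zterm_majorant]) (simp add: szeta_const_def c_def)
  finally show "norm (szeta s - 1) \<le> szeta_const * norm s * norm (1 + s) powr (1/50)" .
qed

lemma zterm_holomorphic: "n \<ge> 1 \<Longrightarrow> zterm n field_differentiable at s"
proof -
  assume n: "n \<ge> 1"
  have pw: "(\<lambda>s. of_nat m powr (a - s) :: complex) field_differentiable at s" if "m \<ge> 1" for m a
    unfolding field_differentiable_def
    by (rule exI, rule DERIV_chain2[OF has_field_derivative_powr_right])
       (use that in \<open>auto intro!: derivative_eq_intros\<close>)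
  have "(\<lambda>s. s * of_nat n powr (-1 - s) - of_nat n powr (0 - s) + of_nat (Suc n) powr (0 - s)) field_differentiable at s"
    by (intro field_differentiable_add field_differentiable_diff field_differentiable_mult pw
          field_differentiable_ident) (use n in auto)
  then show ?thesis by (simp add: zterm_def[abs_def])
qed

lemma holomorphic_szeta: "szeta holomorphic_on wide_strip"
proof -
  have dom: "\<exists>d h. 0 < d \<and> summable h \<and> range h \<subseteq> \<real>\<^sub>\<ge>\<^sub>0 \<and>
     (\<forall>\<^sub>F n in sequentially. \<forall>y\<in>ball s d \<inter> wide_strip. cmod (zterm (Suc n) y) \<le> cmod (h n))"
    if s: "s \<in> wide_strip" for s
  proof (intro exI conjI)
    define c where "c = 2 * (norm s + 1) * (norm s + 2) powr (1/50)"
    show "summable (\<lambda>k. complex_of_real (c * real (Suc k) powr (-101/100)))"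
      by (subst summable_of_real_iff) (intro summable_mult summable_zterm_majorant)
    have c: "c \<ge> 0" by (simp add: c_def)
    then show "range (\<lambda>k. complex_of_real (c * real (Suc k) powr (-101/100))) \<subseteq> \<real>\<^sub>\<ge>\<^sub>0"
      by (auto simp: nonneg_Reals_of_real_iff)
    have "norm (zterm (Suc n) y) \<le> norm (complex_of_real (c * real (Suc n) powr (-101/100)))"
      if y: "y \<in> ball s 1" "y \<in> wide_strip" for n y
    proof -
      have "norm y \<le> norm s + norm (y - s)" using norm_triangle_ineq[of s "y - s"] by simp
      also have "norm (y - s) \<le> 1" using y by (simp add: dist_norm norm_minus_commute)
      finally have ny: "norm y \<le> norm s + 1" by simp
      then have ny1: "norm (1 + y) \<le> norm s + 2" using norm_triangle_ineq[of 1 y] by simp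
      have "norm (zterm (Suc n) y) \<le> 2 * norm y * norm (1 + y) powr (1/50) * real (Suc n) powr (-101/100)"
        using zterm_bound[of "Suc n" y] y by (simp add: wide_strip_def)
      also have "\<dots> \<le> c * real (Suc n) powr (-101/100)"
        unfolding c_def using ny ny1
        by (intro mult_right_mono[OF mult_mono[OF mult_left_mono powr_mono2]]) auto
      also have "\<dots> = norm (complex_of_real (c * real (Suc n) powr (-101/100)))"
        using c by (simp add: norm_mult)
      finally show ?thesis .
    qed
    then show "\<forall>\<^sub>F n in sequentially. \<forall>y\<in>ball s 1 \<inter> wide_strip. cmod (zterm (Suc n) y) \<le> cmod (complex_of_real (c * real (Suc n) powr (-101/100)))"
      by auto
  qed simp
  have diff: "zterm (Suc n) field_differentiable at x" for n x
    by (rule zterm_holomorphic) simp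
  obtain g where g: "\<forall>x\<in>wide_strip. (\<lambda>n. zterm (Suc n) x) sums g x \<and> g field_differentiable at x"
    by (rule series_differentiable_comparison_complex[OF open_wide_strip diff dom])
  then have "g holomorphic_on wide_strip"
    by (auto simp: holomorphic_on_def intro: field_differentiable_at_within)
  then have "(\<lambda>s. 1 + g s) holomorphic_on wide_strip" by (intro holomorphic_intros)
  then show ?thesis
    by (rule holomorphic_transform) (use g in \<open>auto simp: szeta_def sums_iff\<close>)
qed

text \<open>The Dirichlet series below are all taken at the argument \<open>1 + s\<close>.\<close>

definition dterm :: "complex \<Rightarrow> nat \<Rightarrow> complex" where
  "dterm s n = exp (- (1 + s) * of_real (ln (real n)))"

lemma dterm_mult: "m \<ge> 1 \<Longrightarrow> n \<ge> 1 \<Longrightarrow> dterm s (m * n) = dterm s m * dterm s n"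
  by (simp add: dterm_def ln_mult flip: exp_add) (simp add: algebra_simps)

lemma dterm_powr: "n \<ge> 1 \<Longrightarrow> of_nat n powr (-1 - s) = dterm s n"
  by (simp add: dterm_def powr_def Ln_of_nat algebra_simps)

lemma norm_dterm: "n \<ge> 1 \<Longrightarrow> norm (dterm s n) = real n powr (- 1 - Re s)"
  by (simp add: dterm_def powr_def algebra_simps)

definition strip :: "complex set" where "strip = {s. 0 < Re s \<and> Re s < 3}"

lemma open_strip: "open strip"
  unfolding strip_def by (auto intro!: open_Collect_conj open_halfspace_Re_gt open_halfspace_Re_lt)

lemma strip_subset_wide_strip: "strip \<subseteq> wide_strip" by (auto simp: strip_def wide_strip_def)

text \<open>The integral parts of \<open>zterm\<close> telescope to
  \<open>- 1 + of_nat (Suc N) powr (- s)\<close>, whose last term tends to 0 for Re s > 0. This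
  identifies \<open>szeta s\<close> with s zeta(1 + s).\<close>

lemma zeta_sums:
  assumes "s \<in> strip" shows "(\<lambda>k. dterm s (Suc k)) sums (szeta s / s)"
proof -
  have s0: "s \<noteq> 0" "Re s > 0" using assms by (auto simp: strip_def)
  have part: "(\<Sum>k<N. zterm (Suc k) s) = s * (\<Sum>k<N. dterm s (Suc k)) - 1 + of_nat (Suc N) powr (- s)" for N
  proof (induction N)
    case (Suc N)
    then show ?case using dterm_powr[of "Suc N" s]
      by (simp add: zterm_def algebra_simps del: of_nat_Suc)
  qed auto
  have lim0: "(\<lambda>N. of_nat (Suc N) powr (- s)) \<longlonglongrightarrow> (0 :: complex)"
  proof (rule tendsto_norm_zero_cancel)
    have "(\<lambda>N. real (Suc N) powr (- Re s)) \<longlonglongrightarrow> 0"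
      using s0 by (intro tendsto_neg_powr filterlim_compose[OF filterlim_real_sequentially filterlim_Suc]) auto
    then show "(\<lambda>N. norm (of_nat (Suc N) powr (- s) :: complex)) \<longlonglongrightarrow> 0"
      by (simp add: norm_powr_real_powr del: of_nat_Suc)
  qed
  have "(\<lambda>N. ((\<Sum>k<N. zterm (Suc k) s) + 1 - of_nat (Suc N) powr (- s)) / s) \<longlonglongrightarrow> ((szeta s - 1) + 1 - 0) / s"
    using zterm_sums(1)[of s] assms strip_subset_wide_strip s0
    by (intro tendsto_intros lim0) (auto simp: sums_def)
  then show ?thesis unfolding sums_def part using s0 by (simp del: of_nat_Suc)
qed

section \<open>Absolutely convergent Dirichlet series and their products\<close>

lemma summable_norm_dterm:
  assumes "Re s > 0" shows "summable (\<lambda>k. norm (dterm s (Suc k)))"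
  using assms summable_Suc_powr[of "-1 - Re s"] by (simp add: norm_dterm del: of_nat_Suc)

lemma summable_dterm_bounded:
  assumes "Re s > 0" "\<And>n. n \<ge> 1 \<Longrightarrow> norm (a n) \<le> C"
  shows "summable (\<lambda>k. norm (a (Suc k) * dterm s (Suc k)))"
proof (rule summable_comparison_test'[of _ 0])
  show "summable (\<lambda>k. C * norm (dterm s (Suc k)))" by (intro summable_mult summable_norm_dterm assms)
  fix k :: nat
  show "norm (norm (a (Suc k) * dterm s (Suc k))) \<le> C * norm (dterm s (Suc k))"
    using assms(2)[of "Suc k"] by (simp add: norm_mult mult_right_mono)
qed

lemma summable_dterm_ln:
  assumes "Re s > 0" "\<And>n. n \<ge> 1 \<Longrightarrow> norm (a n) \<le> ln (real n)"
  shows "summable (\<lambda>k. norm (a (Suc k) * dterm s (Suc k)))"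
proof (rule summable_comparison_test'[of _ 0])
  define e where "e = Re s / 2"
  have e: "e > 0" using assms by (simp add: e_def)
  have "summable (\<lambda>k. real (Suc k) powr (-1 - e))"
    using e by (intro summable_Suc_powr) simp
  then show "summable (\<lambda>k. (1 / e) * real (Suc k) powr (-1 - e))" by (rule summable_mult)
  fix k :: nat
  have "ln (real (Suc k)) \<le> real (Suc k) powr e / e"
    using ln_powr_bound[of "real (Suc k)" e] e by simp
  then have "norm (a (Suc k)) \<le> real (Suc k) powr e / e" using assms(2)[of "Suc k"] by simp
  then have "norm (a (Suc k)) * norm (dterm s (Suc k)) \<le> (real (Suc k) powr e / e) * norm (dterm s (Suc k))"
    by (rule mult_right_mono) simp
  then have "norm (a (Suc k) * dterm s (Suc k)) \<le> (real (Suc k) powr e / e) * real (Suc k) powr (-1 - Re s)"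
    by (simp add: norm_mult norm_dterm del: of_nat_Suc)
  also have "\<dots> = (1 / e) * real (Suc k) powr (e + (-1 - Re s))"
    by (simp add: powr_add del: of_nat_Suc)
  also have "e + (-1 - Re s) = -1 - e" by (simp add: e_def)
  finally show "norm (norm (a (Suc k) * dterm s (Suc k))) \<le> (1 / e) * real (Suc k) powr (-1 - e)"
    by simp
qed

text \<open>Absolute convergence permits rearranging the double series: a pair (d, m) is recorded as
  its product n = d m together with the divisor d, and the sum over d is taken first.\<close>

lemma dirichlet_product:
  fixes a b :: "nat \<Rightarrow> complex"
  assumes a: "summable (\<lambda>k. norm (a (Suc k) * dterm s (Suc k)))"
    and b: "summable (\<lambda>k. norm (b (Suc k) * dterm s (Suc k)))"
  shows "(\<lambda>k. (\<Sum>d | d dvd Suc k. a d * b (Suc k div d)) * dterm s (Suc k)) sums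
     ((\<Sum>k. a (Suc k) * dterm s (Suc k)) * (\<Sum>k. b (Suc k) * dterm s (Suc k)))"
proof -
  define f g where "f = (\<lambda>n. a n * dterm s n)" and "g = (\<lambda>n. b n * dterm s n)"
  define A B where "A = (\<Sum>k. f (Suc k))" and "B = (\<Sum>k. g (Suc k))"
  have bij: "bij_betw Suc UNIV {1..}"
    by (rule bij_betwI[of _ _ _ "\<lambda>n. n - 1"]) auto
  have has: "(h has_sum (\<Sum>k. h (Suc k))) {1..}" "(\<lambda>n. norm (h n)) summable_on {1..}"
    if "summable (\<lambda>k. norm (h (Suc k)))" for h :: "nat \<Rightarrow> complex"
  proof -
    have "((\<lambda>k. h (Suc k)) has_sum (\<Sum>k. h (Suc k))) UNIV"
      using that by (intro norm_summable_imp_has_sum) (auto intro: summable_sums summable_norm_cancel)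
    then show "(h has_sum (\<Sum>k. h (Suc k))) {1..}"
      using has_sum_reindex_bij_betw[OF bij, of h] by simp
    have "((\<lambda>k. norm (h (Suc k))) has_sum (\<Sum>k. norm (h (Suc k)))) UNIV"
      using that by (intro norm_summable_imp_has_sum) (auto intro: summable_sums)
    then show "(\<lambda>n. norm (h n)) summable_on {1..}"
      using has_sum_reindex_bij_betw[OF bij, of "\<lambda>n. norm (h n)"] by (auto simp: summable_on_def)
  qed
  note fs = has[of f, folded A_def] and gs = has[of g, folded B_def]
  have f0: "summable (\<lambda>k. norm (f (Suc k)))" and g0: "summable (\<lambda>k. norm (g (Suc k)))"
    using a b by (simp_all add: f_def g_def)
  have sm: "(\<lambda>x. norm ((\<lambda>(m, n). f m * g n) x)) summable_on {1..} \<times> {1..}"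
  proof -
    have "(\<lambda>(m, n). norm (f m) * norm (g n)) summable_on {1..} \<times> {1..}"
    proof (rule summable_on_SigmaI)
      fix m :: nat
      show "((\<lambda>n. case (m, n) of (m, n) \<Rightarrow> norm (f m) * norm (g n)) has_sum
          norm (f m) * (\<Sum>\<^sub>\<infinity>n\<in>{1..}. norm (g n))) {1..}"
        using gs(2)[OF g0] by (auto intro: has_sum_cmult_right)
      show "(\<lambda>m. norm (f m) * (\<Sum>\<^sub>\<infinity>n\<in>{1..}. norm (g n))) summable_on {1..}"
        using fs(2)[OF f0] by (rule summable_on_cmult_left)
    qed auto
    then show ?thesis by (simp add: case_prod_unfold norm_mult)
  qed
  have "((\<lambda>(m, n). f m * g n) has_sum A * B) ({1..} \<times> {1..})"
  proof (rule has_sum_SigmaI)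
    show "((\<lambda>n. case (m, n) of (m, n) \<Rightarrow> f m * g n) has_sum f m * B) {1..}" for m
      using gs(1)[OF g0] by (auto intro: has_sum_cmult_right)
    show "((\<lambda>m. f m * B) has_sum A * B) {1..}"
      using fs(1)[OF f0] by (rule has_sum_cmult_left)
    show "(\<lambda>(m, n). f m * g n) summable_on {1..} \<times> {1..}"
      using sm by (rule abs_summable_summable)
  qed
  also have "((\<lambda>(m, n). f m * g n) has_sum A * B) ({1..} \<times> {1..}) \<longleftrightarrow>
     ((\<lambda>(n, d). a d * b (n div d) * dterm s n) has_sum A * B) (Sigma {1..} (\<lambda>n. {d. d dvd n}))"
  proof (rule has_sum_reindex_bij_witness[of _ "\<lambda>(n, d). (d, n div d)" "\<lambda>(d, m). (d * m, d)"])
    fix x :: "nat \<times> nat" assume x: "x \<in> {1..} \<times> {1..}"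
    then show "(case (case x of (d, m) \<Rightarrow> (d * m, d)) of (n, d) \<Rightarrow> a d * b (n div d) * dterm s n) =
        (case x of (m, n) \<Rightarrow> f m * g n)"
      by (auto simp: f_def g_def dterm_mult)
  qed (auto simp: Suc_le_eq dvd_div_eq_0_iff intro: Nat.gr0I)
  finally have "((\<lambda>n. \<Sum>d | d dvd n. a d * b (n div d) * dterm s n) has_sum A * B) {1..}"
    by (rule has_sum_SigmaD) (auto intro!: has_sum_finite)
  then have "((\<lambda>n. (\<Sum>d | d dvd n. a d * b (n div d)) * dterm s n) has_sum A * B) {1..}"
    by (simp add: sum_distrib_right)
  then have "((\<lambda>k. (\<Sum>d | d dvd Suc k. a d * b (Suc k div d)) * dterm s (Suc k)) has_sum A * B) UNIV"
    using has_sum_reindex_bij_betw[OF bij, of "\<lambda>n. (\<Sum>d | d dvd n. a d * b (n div d)) * dterm s n" "A * B"] by simp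
  then show ?thesis unfolding A_def B_def f_def g_def by (rule has_sum_imp_sums)
qed

text \<open>Squarefree divisors correspond to sets of prime factors, and the signed count of the
  subsets of P is (1 - 1)^|P|.\<close>

lemma sum_divisors_moebius:
  assumes "n > 0" shows "(\<Sum>d | d dvd n. moebius_mu d) = (if n = 1 then 1 else 0)"
proof -
  define P where "P = prime_factors n"
  have P: "finite P" "\<And>p. p \<in> P \<Longrightarrow> prime p" by (auto simp: P_def)
  have "(\<Sum>d | d dvd n. moebius_mu d) = (\<Sum>d | d dvd n \<and> squarefree d. (-1) ^ card (prime_factors d))"
    using assms by (intro sum.mono_neutral_cong_right) (auto simp: moebius_mu_def)
  also have "\<dots> = (\<Sum>A\<in>Pow P. (-1) ^ card A)"
  proof (rule sum.reindex_bij_witness[of _ "\<lambda>A. \<Prod>A" prime_factors])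
    fix d assume d: "d \<in> {d. d dvd n \<and> squarefree d}"
    then have d0: "d > 0" using assms by (auto intro: Nat.gr0I)
    show "\<Prod> (prime_factors d) = d"
    proof -
      have "d = (\<Prod>p\<in>prime_factors d. p ^ multiplicity p d)"
        using d0 by (simp add: prime_factorization_nat)
      also have "\<dots> = (\<Prod>p\<in>prime_factors d. p)"
        using d d0 by (intro prod.cong refl) (auto simp: squarefree_factorial_semiring')
      finally show ?thesis by simp
    qed
    show "prime_factors d \<in> Pow P"
      using d assms by (auto simp: P_def prime_factors_dvd)
  next
    fix A assume A: "A \<in> Pow P"
    then have fin: "finite A" and pr: "\<And>p. p \<in> A \<Longrightarrow> prime p" using P by (auto intro: finite_subset)
    have "\<Prod>A \<noteq> 0" using fin pr[of 0] by auto
    then have "prime_factors (\<Prod>A) = {p. prime p \<and> p dvd \<Prod>A}" by (rule prime_factors_dvd)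
    also have "\<dots> = A"
    proof (intro equalityI subsetI)
      fix x assume "x \<in> {p. prime p \<and> p dvd \<Prod>A}"
      then obtain y where "prime x" "y \<in> A" "x dvd y" using fin by (auto simp: prime_dvd_prod_iff)
      then show "x \<in> A" using pr[of y] primes_dvd_imp_eq[of x y] by simp
    qed (use fin pr in \<open>auto intro: dvd_prodI\<close>)
    finally show pf: "prime_factors (\<Prod>A) = A" .
    have "\<Prod>A dvd n" using fin pr A
    proof (induction A rule: finite_induct)
      case (insert p A)
      have "coprime p (\<Prod>A)"
        using insert by (intro prod_coprime_right primes_coprime) auto
      then show ?case using insert by (auto simp: P_def intro!: divides_mult)
    qed auto
    moreover have "squarefree (\<Prod>A)"
      using pr by (intro squarefree_prod_coprime primes_coprime squarefree_prime) auto
    ultimately show "\<Prod>A \<in> {d. d dvd n \<and> squarefree d}" by simp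
  qed auto
  also have "\<dots> = (\<Prod>p\<in>P. (-1) + 1)"
    using P by (subst prod_add) (auto intro!: sum.cong)
  also have "\<dots> = (if P = {} then 1 else 0)" using P(1) by (simp add: card_gt_0_iff)
  also have "P = {} \<longleftrightarrow> n = 1"
    using assms by (auto simp: P_def prime_factorization_empty_iff)
  finally show ?thesis .
qed

lemma moebius_bound: "\<bar>moebius_mu n\<bar> \<le> 1"
  by (simp add: moebius_mu_def power_abs)

lemma summable_moebius_series:
  "Re s > 0 \<Longrightarrow> summable (\<lambda>k. norm (of_real (moebius_mu (Suc k)) * dterm s (Suc k)))"
  using summable_dterm_bounded[of s "\<lambda>n. of_real (moebius_mu n)" 1] moebius_bound by simp

text \<open>The convolution of mu with 1 is the unit, so the series times zeta(1 + s) is 1. This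
  also yields that \<open>szeta\<close> has no zero in the open strip.\<close>

lemma moebius_series:
  assumes "s \<in> strip"
  shows "(\<lambda>k. of_real (moebius_mu (Suc k)) * dterm s (Suc k)) sums (s / szeta s)" and "szeta s \<noteq> 0"
proof -
  have s: "Re s > 0" "s \<noteq> 0" using assms by (auto simp: strip_def)
  define M where "M = (\<Sum>k. of_real (moebius_mu (Suc k)) * dterm s (Suc k))"
  note sm = summable_moebius_series[OF s(1)]
  have "(\<lambda>k. (\<Sum>d | d dvd Suc k. of_real (moebius_mu d) * 1) * dterm s (Suc k)) sums (M * (\<Sum>k. 1 * dterm s (Suc k)))"
    unfolding M_def using summable_norm_dterm[OF s(1)] by (intro dirichlet_product sm) simp
  also have "(\<lambda>k. (\<Sum>d | d dvd Suc k. complex_of_real (moebius_mu d) * 1) * dterm s (Suc k))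
     = (\<lambda>k. if k = 0 then 1 else 0)"
  proof
    fix k
    have "(\<Sum>d | d dvd Suc k. complex_of_real (moebius_mu d) * 1) = of_real (\<Sum>d | d dvd Suc k. moebius_mu d)"
      by simp
    then show "(\<Sum>d | d dvd Suc k. complex_of_real (moebius_mu d) * 1) * dterm s (Suc k) = (if k = 0 then 1 else 0)"
      using sum_divisors_moebius[of "Suc k"] by (auto simp: dterm_def)
  qed
  finally have "(\<lambda>k. if k = 0 then 1 else 0) sums (M * (\<Sum>k. dterm s (Suc k)))" by simp
  moreover have "(\<lambda>k. if k = 0 then 1 else 0) sums (1 :: complex)"
    using sums_single[of 0 "\<lambda>_. 1 :: complex"] by simp
  ultimately have "M * (\<Sum>k. dterm s (Suc k)) = 1" by (rule sums_unique2)
  then have "M * (szeta s / s) = 1" using sums_unique[OF zeta_sums[OF assms]] by simp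
  then show "szeta s \<noteq> 0" by auto
  then have "M = s / szeta s" using \<open>M * (szeta s / s) = 1\<close> s by (simp add: field_simps)
  then show "(\<lambda>k. of_real (moebius_mu (Suc k)) * dterm s (Suc k)) sums (s / szeta s)"
    using summable_sums[OF summable_norm_cancel[OF sm]] by (simp add: M_def)
qed

lemma szeta_deriv: "s \<in> wide_strip \<Longrightarrow> (szeta has_field_derivative deriv szeta s) (at s)"
  using holomorphic_szeta open_wide_strip by (rule holomorphic_derivI)

lemma szeta_deriv2: "s \<in> wide_strip \<Longrightarrow> (deriv szeta has_field_derivative deriv (deriv szeta) s) (at s)"
  using holomorphic_deriv[OF holomorphic_szeta open_wide_strip] open_wide_strip by (rule holomorphic_derivI)

text \<open>Minus the derivative of \<open>szeta s / s\<close>, the series of zeta(1 + s) being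
  differentiated termwise.\<close>

lemma ln_series:
  assumes "s \<in> strip"
  shows "(\<lambda>k. of_real (ln (real (Suc k))) * dterm s (Suc k)) sums (szeta s / s ^ 2 - deriv szeta s / s)"
proof -
  have der: "((\<lambda>s. dterm s (Suc n)) has_field_derivative - (of_real (ln (real (Suc n))) * dterm x (Suc n))) (at x)" for n x
    unfolding dterm_def by (auto intro!: derivative_eq_intros simp del: of_nat_Suc)
  have "\<exists>d h. 0 < d \<and> summable h \<and> range h \<subseteq> \<real>\<^sub>\<ge>\<^sub>0 \<and>
     (\<forall>\<^sub>F n in sequentially. \<forall>y\<in>ball x d \<inter> strip. cmod (dterm y (Suc n)) \<le> cmod (h n))"
    if x: "x \<in> strip" for x
  proof (intro exI conjI)
    define e where "e = Re x / 2"
    show e: "0 < e" using x by (simp add: e_def strip_def)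
    show "summable (\<lambda>k. complex_of_real (real (Suc k) powr (-1 - e)))"
      using e by (subst summable_of_real_iff, intro summable_Suc_powr) simp
    show "range (\<lambda>k. complex_of_real (real (Suc k) powr (-1 - e))) \<subseteq> \<real>\<^sub>\<ge>\<^sub>0"
      by (auto simp: nonneg_Reals_of_real_iff)
    have "cmod (dterm y (Suc n)) \<le> cmod (complex_of_real (real (Suc n) powr (-1 - e)))"
      if "y \<in> ball x e" for n y
    proof -
      have "\<bar>Re (x - y)\<bar> < e" using that abs_Re_le_cmod[of "x - y"] by (simp add: dist_norm)
      then have "Re x - Re y < e" by simp
      moreover have "Re x = e + e" by (simp add: e_def)
      ultimately have "Re y \<ge> e" by linarith
      then have "real (Suc n) powr (-1 - Re y) \<le> real (Suc n) powr (-1 - e)" by (intro powr_mono) auto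
      then show ?thesis by (simp add: norm_dterm del: of_nat_Suc)
    qed
    then show "\<forall>\<^sub>F n in sequentially. \<forall>y\<in>ball x e \<inter> strip. cmod (dterm y (Suc n)) \<le> cmod (complex_of_real (real (Suc n) powr (-1 - e)))"
      by auto
  qed
  then have "\<exists>g g'. \<forall>x\<in>strip. ((\<lambda>n. dterm x (Suc n)) sums g x) \<and>
      ((\<lambda>n. - (of_real (ln (real (Suc n))) * dterm x (Suc n))) sums g' x) \<and> (g has_field_derivative g' x) (at x)"
    by (rule series_and_derivative_comparison_complex[OF open_strip der])
  then obtain g g' where g: "(\<lambda>n. dterm x (Suc n)) sums g x"
      "(\<lambda>n. - (of_real (ln (real (Suc n))) * dterm x (Suc n))) sums g' x"
      "(g has_field_derivative g' x) (at x)" if "x \<in> strip" for x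
    by blast
  have "s \<noteq> 0" "s \<in> wide_strip" using assms strip_subset_wide_strip by (auto simp: strip_def)
  have "((\<lambda>s. szeta s / s) has_field_derivative (deriv szeta s * s - szeta s * 1) / (s * s)) (at s)"
    by (intro derivative_intros szeta_deriv \<open>s \<in> wide_strip\<close> \<open>s \<noteq> 0\<close>)
  then have "(g has_field_derivative (deriv szeta s * s - szeta s * 1) / (s * s)) (at s)"
    by (rule has_field_derivative_transform_within_open[OF _ open_strip assms])
       (rule sums_unique2[OF zeta_sums g(1)])
  then have "g' s = (deriv szeta s * s - szeta s * 1) / (s * s)"
    using g(3)[OF assms] DERIV_unique by blast
  then have "(\<lambda>n. - (of_real (ln (real (Suc n))) * dterm s (Suc n))) sums ((deriv szeta s * s - szeta s * 1) / (s * s))"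
    using g(2)[OF assms] by simp
  from sums_minus[OF this]
  have "(\<lambda>n. of_real (ln (real (Suc n))) * dterm s (Suc n)) sums - ((deriv szeta s * s - szeta s * 1) / (s * s))"
    by (simp only: minus_minus)
  moreover have "- ((deriv szeta s * s - szeta s * 1) / (s * s)) = szeta s / s ^ 2 - deriv szeta s / s"
    using \<open>s \<noteq> 0\<close> by (simp add: field_simps power2_eq_square)
  ultimately show ?thesis by (simp only:)
qed

lemma mangoldt_le_ln: "n \<ge> 1 \<Longrightarrow> (mangoldt n :: real) \<le> ln (real n)"
proof -
  assume n: "n \<ge> 1"
  have "mangoldt n \<le> (\<Sum>d | d dvd n. mangoldt d :: real)"
    using n by (intro member_le_sum) (auto simp: mangoldt_nonneg)
  then show ?thesis using mangoldt_sum[of n, where ?'a = real] n by simp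
qed

lemma summable_mangoldt_series:
  "Re s > 0 \<Longrightarrow> summable (\<lambda>k. norm (of_real (mangoldt (Suc k)) * dterm s (Suc k)))"
  using summable_dterm_ln[of s "\<lambda>n. of_real (mangoldt n)"] mangoldt_le_ln
  by (simp del: of_real_mangoldt add: mangoldt_nonneg)

text \<open>The convolution of \<open>mangoldt\<close> with 1 is ln, so the series of ln is divided
  by zeta(1 + s). The result is - zeta' / zeta at 1 + s, with the pole 1 / s split off.\<close>

lemma mangoldt_series:
  assumes "s \<in> strip"
  shows "(\<lambda>k. of_real (mangoldt (Suc k)) * dterm s (Suc k)) sums (1 / s - deriv szeta s / szeta s)"
proof -
  have s: "Re s > 0" "s \<noteq> 0" "szeta s \<noteq> 0" using assms moebius_series by (auto simp: strip_def)
  define M where "M = (\<Sum>k. of_real (mangoldt (Suc k)) * dterm s (Suc k))"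
  note sm = summable_mangoldt_series[OF s(1)]
  have "(\<lambda>k. (\<Sum>d | d dvd Suc k. of_real (mangoldt d) * 1) * dterm s (Suc k)) sums (M * (\<Sum>k. 1 * dterm s (Suc k)))"
    unfolding M_def using summable_norm_dterm[OF s(1)] by (intro dirichlet_product sm) simp
  also have "(\<lambda>k. (\<Sum>d | d dvd Suc k. complex_of_real (mangoldt d) * 1) * dterm s (Suc k))
     = (\<lambda>k. of_real (ln (real (Suc k))) * dterm s (Suc k))"
    using mangoldt_sum[of "Suc _", where ?'a = complex] by simp
  finally have "(\<lambda>k. of_real (ln (real (Suc k))) * dterm s (Suc k)) sums (M * (\<Sum>k. dterm s (Suc k)))"
    by simp
  then have "M * (\<Sum>k. dterm s (Suc k)) = szeta s / s ^ 2 - deriv szeta s / s"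
    using ln_series[OF assms] by (rule sums_unique2)
  then have "M * (szeta s / s) = szeta s / s ^ 2 - deriv szeta s / s" using sums_unique[OF zeta_sums[OF assms]] by simp
  then have "M = 1 / s - deriv szeta s / szeta s" using s by (simp add: field_simps power2_eq_square)
  then show ?thesis
    using summable_sums[OF summable_norm_cancel[OF sm]] by (simp add: M_def)
qed

section \<open>Bounds up to the line\<close>

text \<open>A substitute for |s| where Re s is bounded. Being at least 1, it makes its powers
  monotone in the exponent.\<close>

definition ht :: "complex \<Rightarrow> real" where "ht s = 1 + \<bar>Im s\<bar>"

lemma ht_ge_1: "ht s \<ge> 1" by (simp add: ht_def)

lemma szeta_upper:
  assumes "s \<in> wide_strip"
  shows "norm (szeta s) \<le> (1 + 12 * szeta_const) * ht s powr (51/50)"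
proof -
  have ns: "norm s \<le> 3 * ht s" "norm (1 + s) \<le> 4 * ht s"
    using cmod_le[of s] cmod_le[of "1 + s"] assms by (auto simp: wide_strip_def ht_def abs_if split: if_splits)
  have W0: "ht s \<ge> 1" by (rule ht_ge_1)
  have "norm (szeta s - 1) \<le> szeta_const * norm s * norm (1 + s) powr (1/50)" by (rule zterm_sums(2)[OF assms])
  also have "\<dots> \<le> szeta_const * (3 * ht s) * (4 * ht s) powr (1/50)"
    using ns szeta_const_pos W0 by (intro mult_mono powr_mono2 mult_left_mono mult_nonneg_nonneg) auto
  also have "\<dots> = 3 * szeta_const * 4 powr (1/50) * (ht s powr 1 * ht s powr (1/50))"
    using W0 by (simp add: powr_mult)
  also have "ht s powr 1 * ht s powr (1/50) = ht s powr (51/50)" unfolding powr_add[symmetric] by simp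
  also have "3 * szeta_const * 4 powr (1/50) * ht s powr (51/50) \<le> 3 * szeta_const * 4 powr 1 * ht s powr (51/50)"
    using szeta_const_pos by (intro mult_right_mono mult_left_mono powr_mono) auto
  finally have "norm (szeta s - 1) \<le> 12 * szeta_const * ht s powr (51/50)" by simp
  moreover have "1 \<le> ht s powr (51/50)" using W0 by (intro ge_one_powr_ge_zero) auto
  moreover have "norm (szeta s) \<le> 1 + norm (szeta s - 1)" using norm_triangle_ineq[of 1 "szeta s - 1"] by simp
  ultimately show ?thesis by (simp add: algebra_simps)
qed

lemma szeta_derivs_upper:
  "\<exists>C\<ge>1. \<forall>s. 0 < Re s \<longrightarrow> Re s \<le> 2 \<longrightarrow> norm (szeta s) \<le> C * ht s powr (51/50) \<and>
     norm (deriv szeta s) \<le> C * ht s powr (51/50) \<and> norm (deriv (deriv szeta) s) \<le> C * ht s powr (51/50)"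
proof (intro exI conjI allI impI)
  define C0 where "C0 = 1 + 12 * szeta_const"
  \<comment> \<open>Cauchy's inequality for the second derivative on a circle of radius 1/200 gives
    2 * 4 * 200^2 = 320000, the 4 being a bound for the growth factor 2^(51/50) over the
    disc.\<close>
  define C where "C = 320000 * C0"
  have C0: "C0 \<ge> 1" using szeta_const_pos by (simp add: C0_def)
  show "C \<ge> 1" using C0 by (simp add: C_def)
  fix s :: complex assume s: "0 < Re s" "Re s \<le> 2"
  define V where "V = ht s powr (51/50)"
  have V0: "V \<ge> 0" by (simp add: V_def)
  have sub: "cball s (1/200) \<subseteq> wide_strip"
  proof
    fix w assume "w \<in> cball s (1/200)"
    then have "\<bar>Re (s - w)\<bar> \<le> 1/200" using abs_Re_le_cmod[of "s - w"] by (simp add: dist_norm)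
    then have "Re s - Re w \<le> 1/200" "Re w - Re s \<le> 1/200" unfolding abs_le_iff by simp_all
    moreover have "1/200 < (1/100 :: real)" "1/200 < (1 :: real)" by simp_all
    ultimately have "0 < 1/100 + Re w" "Re w < 3" using s by linarith+
    then show "w \<in> wide_strip" by (simp add: wide_strip_def)
  qed
  have bnd: "norm (szeta w) \<le> 4 * C0 * V" if "norm (s - w) = 1/200" for w
  proof -
    have "w \<in> wide_strip" using sub that by (auto simp: dist_norm)
    then have "norm (szeta w) \<le> C0 * ht w powr (51/50)" unfolding C0_def by (rule szeta_upper)
    also have "ht w \<le> 2 * ht s"
    proof -
      have "\<bar>Im (s - w)\<bar> \<le> 1" using abs_Im_le_cmod[of "s - w"] that by simp
      then show ?thesis by (auto simp: ht_def)
    qed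
    then have "C0 * ht w powr (51/50) \<le> C0 * (2 * ht s) powr (51/50)"
      using C0 ht_ge_1[of w] by (intro mult_left_mono powr_mono2) auto
    also have "\<dots> = C0 * 2 powr (51/50) * V"
      using ht_ge_1[of s] by (simp add: V_def powr_mult)
    also have "\<dots> \<le> C0 * 2 powr 2 * V"
      using C0 V0 by (intro mult_right_mono mult_left_mono powr_mono) auto
    finally show ?thesis by simp
  qed
  have "norm (szeta s) \<le> C0 * V" unfolding C0_def V_def using s by (intro szeta_upper) (auto simp: wide_strip_def)
  also have "\<dots> \<le> C * V" using C0 V0 by (intro mult_right_mono) (auto simp: C_def)
  finally show "norm (szeta s) \<le> C * ht s powr (51/50)" by (simp add: V_def)
  have hol: "szeta holomorphic_on ball s (1/200)" "continuous_on (cball s (1/200)) szeta"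
    using holomorphic_szeta sub ball_subset_cball
    by (blast intro: holomorphic_on_subset holomorphic_on_imp_continuous_on continuous_on_subset)+
  have cau: "norm ((deriv ^^ n) szeta s) \<le> fact n * (4 * C0 * V) / (1/200) ^ n" for n
    by (rule Cauchy_inequality[OF hol _ bnd]) auto
  have "norm (deriv szeta s) \<le> 800 * (C0 * V)" using cau[of 1] by simp
  also have "\<dots> \<le> C * V" using C0 V0 by (simp add: C_def)
  finally show "norm (deriv szeta s) \<le> C * ht s powr (51/50)" by (simp add: V_def)
  have "norm (deriv (deriv szeta) s) \<le> C * V" using cau[of 2] by (simp add: numeral_2_eq_2 C_def)
  then show "norm (deriv (deriv szeta) s) \<le> C * ht s powr (51/50)" by (simp add: V_def)
qed

text \<open>Locally ln |f| is the real part of a logarithm of f. Dividing by the value at the point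
  keeps the argument of \<open>Ln\<close> near 1, off the branch cut.\<close>

lemma ln_norm_has_derivative:
  assumes f: "(f has_field_derivative D) (at (Complex \<sigma> t))" and nz: "f (Complex \<sigma> t) \<noteq> 0"
  shows "((\<lambda>x. ln (norm (f (Complex x t)))) has_real_derivative Re (D / f (Complex \<sigma> t))) (at \<sigma>)"
proof -
  define z where "z = Complex \<sigma> t"
  have line: "((\<lambda>x. Complex x t) has_vector_derivative 1) (at \<sigma>)"
  proof -
    have "(\<lambda>x. Complex x t) = (\<lambda>x. of_real x + \<i> * of_real t)" by (auto simp: complex_eq_iff)
    then show ?thesis by (auto intro!: derivative_eq_intros)
  qed
  have "((\<lambda>w. Ln (f w / f z)) has_field_derivative inverse (f z / f z) * (D / f z)) (at z)"
    using f nz by (intro DERIV_chain2[of Ln] has_field_derivative_Ln DERIV_cdivide) (auto simp: z_def)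
  then have "((\<lambda>w. Ln (f w / f z)) has_field_derivative D / f z) (at z)"
    using nz by (simp add: z_def)
  then have "(((\<lambda>w. Ln (f w / f z)) \<circ> (\<lambda>x. Complex x t)) has_vector_derivative 1 * (D / f z)) (at \<sigma>)"
    using field_vector_diff_chain_at[OF line] by (simp add: z_def)
  then have "((\<lambda>x. Re (Ln (f (Complex x t) / f z))) has_real_derivative Re (D / f z)) (at \<sigma>)"
    unfolding o_def mult_1 by (rule has_field_derivative_Re)
  from DERIV_add[OF this DERIV_const[of "ln (norm (f z))"]]
  have D: "((\<lambda>x. Re (Ln (f (Complex x t) / f z)) + ln (norm (f z))) has_real_derivative Re (D / f z)) (at \<sigma>)"
    by simp
  have "eventually (\<lambda>x. f (Complex x t) \<noteq> 0) (nhds \<sigma>)"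
  proof -
    have "isCont (\<lambda>x. f (Complex x t)) \<sigma>"
      by (rule isCont_o2[OF has_vector_derivative_continuous[OF line] DERIV_isCont[OF f]])
    then have "eventually (\<lambda>x. f (Complex x t) \<noteq> 0) (at \<sigma>)"
      using nz unfolding isCont_def by (rule tendsto_imp_eventually_ne)
    then show ?thesis using nz by (simp add: eventually_nhds_conv_at)
  qed
  then have ev: "eventually (\<lambda>x. Re (Ln (f (Complex x t) / f z)) + ln (norm (f z)) = ln (norm (f (Complex x t)))) (nhds \<sigma>)"
    by eventually_elim (use nz in \<open>simp add: z_def norm_divide ln_div\<close>)
  show ?thesis using D unfolding DERIV_cong_ev[OF refl ev refl] by (simp add: z_def)
qed

section \<open>The 3-4-1 inequality for zeta(1 + s) and lower bounds for
  \<open>szeta\<close>\<close>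

definition zeta1 :: "complex \<Rightarrow> complex" where "zeta1 s = szeta s / s"

lemma zeta1_deriv:
  assumes "s \<in> strip"
  shows "(zeta1 has_field_derivative (deriv szeta s * s - szeta s) / (s * s)) (at s)" "zeta1 s \<noteq> 0"
    "(deriv szeta s * s - szeta s) / (s * s) / zeta1 s = - (\<Sum>k. of_real (mangoldt (Suc k)) * dterm s (Suc k))"
proof -
  have s: "s \<noteq> 0" "s \<in> wide_strip" "szeta s \<noteq> 0" using assms strip_subset_wide_strip moebius_series(2) by (auto simp: strip_def)
  have "((\<lambda>s. szeta s / s) has_field_derivative (deriv szeta s * s - szeta s * 1) / (s * s)) (at s)"
    by (intro derivative_intros szeta_deriv s)
  then show "(zeta1 has_field_derivative (deriv szeta s * s - szeta s) / (s * s)) (at s)"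
    by (simp add: zeta1_def[abs_def])
  show "zeta1 s \<noteq> 0" using s by (simp add: zeta1_def)
  show "(deriv szeta s * s - szeta s) / (s * s) / zeta1 s = - (\<Sum>k. of_real (mangoldt (Suc k)) * dterm s (Suc k))"
    unfolding sums_unique[OF mangoldt_series[OF assms], symmetric] zeta1_def using s by (simp add: field_simps)
qed

text \<open>The Moebius series bounds |1 / zeta(1 + s)| by the sum of n^(-1 - Re s), which is zeta(1
  + Re s). At Re s = 1 this is the starting point of the 3-4-1 comparison.\<close>

lemma zeta1_lower_trivial:
  assumes "s \<in> strip" shows "1 \<le> norm (zeta1 s) * norm (zeta1 (of_real (Re s)))"
proof -
  define r where "r = complex_of_real (Re s)"
  have r: "r \<in> strip" "Re s > 0" using assms by (auto simp: strip_def r_def)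
  have nd: "norm (dterm s (Suc k)) = Re (dterm r (Suc k))" "Im (dterm r (Suc k)) = 0" for k
    by (simp_all add: dterm_def r_def Re_exp Im_exp)
  have "norm (s / szeta s) \<le> (\<Sum>k. norm (dterm s (Suc k)))"
  proof -
    note sm = summable_moebius_series[OF r(2)]
    have "norm (s / szeta s) \<le> (\<Sum>k. norm (of_real (moebius_mu (Suc k)) * dterm s (Suc k)))"
      using summable_norm[OF sm] sums_unique[OF moebius_series(1)[OF assms]] by simp
    also have "\<dots> \<le> (\<Sum>k. norm (dterm s (Suc k)))"
      using moebius_bound summable_norm_dterm[OF r(2)]
      by (intro suminf_le sm) (auto simp: norm_mult intro!: mult_left_le_one_le)
    finally show ?thesis .
  qed
  also have "\<dots> = Re (zeta1 r)"
    unfolding nd zeta1_def using sums_unique[OF sums_Re[OF zeta_sums[OF r(1)]]] by simp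
  also have "\<dots> \<le> norm (zeta1 r)" by (rule complex_Re_le_cmod)
  finally have "norm (s / szeta s) \<le> norm (zeta1 r)" .
  moreover have "norm (zeta1 s) * norm (s / szeta s) = 1"
    using assms moebius_series(2)[OF assms] by (auto simp: zeta1_def norm_divide strip_def)
  moreover have "norm (zeta1 s) * norm (s / szeta s) \<le> norm (zeta1 s) * norm (zeta1 r)"
    using calculation by (intro mult_left_mono) auto
  ultimately show ?thesis by (simp add: r_def)
qed

text \<open>The logarithmic derivative of \<open>\<zeta>(1+\<sigma>)\<^sup>3 \<zeta>(1+\<sigma>+it)\<^sup>4 \<zeta>(1+\<sigma>+2it)\<close> in \<open>\<sigma>\<close> is nonpositive because
  \<open>3 + 4 cos \<theta> + cos 2\<theta> \<ge> 0\<close>, which avoids the logarithm of \<open>\<zeta>\<close>.\<close>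

lemma mertens_341:
  assumes "0 < \<sigma>" "\<sigma> \<le> 1"
  shows "3 * ln (norm (zeta1 (Complex 1 0))) + 4 * ln (norm (zeta1 (Complex 1 t))) + ln (norm (zeta1 (Complex 1 (2 * t))))
    \<le> 3 * ln (norm (zeta1 (Complex \<sigma> 0))) + 4 * ln (norm (zeta1 (Complex \<sigma> t))) + ln (norm (zeta1 (Complex \<sigma> (2 * t))))"
proof -
  define L where "L = (\<lambda>t x. ln (norm (zeta1 (Complex x t))))"
  define M where "M = (\<lambda>s. \<Sum>k. of_real (mangoldt (Suc k)) * dterm s (Suc k))"
  have dL: "(L t has_real_derivative - Re (M (Complex x t))) (at x)" if "0 < x" "x \<le> 1" for x t
  proof -
    have s: "Complex x t \<in> strip" using that by (simp add: strip_def)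
    show ?thesis using ln_norm_has_derivative[OF zeta1_deriv(1,2)[OF s]] zeta1_deriv(3)[OF s]
      by (simp add: L_def M_def)
  qed
  have "3 * L 0 1 + 4 * L t 1 + L (2 * t) 1 \<le> 3 * L 0 \<sigma> + 4 * L t \<sigma> + L (2 * t) \<sigma>"
  proof (rule DERIV_nonpos_imp_nonincreasing[of \<sigma> 1 "\<lambda>x. 3 * L 0 x + 4 * L t x + L (2 * t) x"])
    fix x assume x: "\<sigma> \<le> x" "x \<le> 1"
    then have x0: "0 < x" using assms by simp
    have "((\<lambda>x. 3 * L 0 x + 4 * L t x + L (2 * t) x) has_real_derivative
       3 * (- Re (M (Complex x 0))) + 4 * (- Re (M (Complex x t))) + (- Re (M (Complex x (2 * t))))) (at x)"
      by (intro derivative_intros DERIV_cmult dL x x0)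
    moreover have "3 * (- Re (M (Complex x 0))) + 4 * (- Re (M (Complex x t))) + (- Re (M (Complex x (2 * t)))) \<le> 0"
    proof -
      have sm: "(\<lambda>k. mangoldt (Suc k) * Re (dterm (Complex x u) (Suc k))) sums Re (M (Complex x u))" for u
      proof -
        have "Complex x u \<in> strip" using x x0 by (simp add: strip_def)
        then have "(\<lambda>k. of_real (mangoldt (Suc k)) * dterm (Complex x u) (Suc k)) sums M (Complex x u)"
          unfolding M_def using mangoldt_series sums_iff by blast
        from sums_Re[OF this] show ?thesis by (simp del: of_real_mangoldt)
      qed
      have S: "(\<lambda>k. 3 * (mangoldt (Suc k) * Re (dterm (Complex x 0) (Suc k)))
           + 4 * (mangoldt (Suc k) * Re (dterm (Complex x t) (Suc k)))
           + mangoldt (Suc k) * Re (dterm (Complex x (2 * t)) (Suc k)))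
         sums (3 * Re (M (Complex x 0)) + 4 * Re (M (Complex x t)) + Re (M (Complex x (2 * t))))"
        by (intro sums_add sums_mult sm)
      have N: "0 \<le> 3 * (mangoldt (Suc k) * Re (dterm (Complex x 0) (Suc k)))
           + 4 * (mangoldt (Suc k) * Re (dterm (Complex x t) (Suc k)))
           + mangoldt (Suc k) * Re (dterm (Complex x (2 * t)) (Suc k))" for k
      proof -
        define \<theta> where "\<theta> = t * ln (real (Suc k))"
        define e where "e = exp (- ((1 + x) * ln (real (Suc k))))"
        have "Re (dterm (Complex x u) (Suc k)) = e * cos (u * ln (real (Suc k)))" for u
          by (simp add: dterm_def Re_exp e_def algebra_simps)
        then have "3 * (mangoldt (Suc k) * Re (dterm (Complex x 0) (Suc k)))
           + 4 * (mangoldt (Suc k) * Re (dterm (Complex x t) (Suc k)))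
           + mangoldt (Suc k) * Re (dterm (Complex x (2 * t)) (Suc k))
          = mangoldt (Suc k) * e * (3 + 4 * cos \<theta> + cos (2 * \<theta>))"
          by (simp add: \<theta>_def algebra_simps)
        also have "3 + 4 * cos \<theta> + cos (2 * \<theta>) = 2 * (1 + cos \<theta>)\<^sup>2"
          unfolding cos_double_cos by (simp add: power2_eq_square algebra_simps)
        finally show ?thesis by (simp add: mangoldt_nonneg e_def)
      qed
      have "0 \<le> 3 * Re (M (Complex x 0)) + 4 * Re (M (Complex x t)) + Re (M (Complex x (2 * t)))"
        by (rule sums_le[OF N sums_zero S])
      then show ?thesis by simp
    qed
    ultimately show "\<exists>y. ((\<lambda>x. 3 * L 0 x + 4 * L t x + L (2 * t) x) has_real_derivative y) (at x) \<and> y \<le> 0"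
      by blast
  qed (use assms in auto)
  then show ?thesis by (simp add: L_def)
qed

text \<open>At real part 1 each of the 3 + 4 + 1 = 8 factors is at least 1 / C. At
  \<open>Re s\<close> the factor on the real axis is at most C / Re s and enters cubed. This
  accounts for C^(-11) and for the cube of \<open>Re s\<close>.\<close>

lemma zeta1_lower:
  assumes C: "C \<ge> 1" "\<And>s. 0 < Re s \<Longrightarrow> Re s \<le> 2 \<Longrightarrow> norm (szeta s) \<le> C * ht s powr (51/50)"
    and s: "0 < Re s" "Re s \<le> 1"
  shows "C powr (-11) * Re s ^ 3 \<le> norm (zeta1 s) ^ 4 * norm (zeta1 (Complex (Re s) (2 * Im s)))"
proof -
  have real: "0 < norm (zeta1 (Complex x 0))" "norm (zeta1 (Complex x 0)) \<le> C / x" if "0 < x" "x \<le> 1" for x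
  proof -
    show "0 < norm (zeta1 (Complex x 0))" using zeta1_deriv(2)[of "Complex x 0"] that by (simp add: strip_def)
    have "norm (Complex x 0) = x" using that by (simp add: cmod_def)
    then show "norm (zeta1 (Complex x 0)) \<le> C / x" using C(2)[of "Complex x 0"] that
      by (simp add: zeta1_def norm_divide ht_def divide_right_mono)
  qed
  have one: "- ln C \<le> ln (norm (zeta1 (Complex 1 t)))" for t
  proof -
    have st: "Complex 1 t \<in> strip" by (simp add: strip_def)
    have "1 \<le> norm (zeta1 (Complex 1 t)) * norm (zeta1 (Complex 1 0))"
      using zeta1_lower_trivial[OF st] by (simp add: complex_of_real_def)
    also have "\<dots> \<le> norm (zeta1 (Complex 1 t)) * C" using real(2)[of 1] by (intro mult_left_mono) auto
    finally have "1 / C \<le> norm (zeta1 (Complex 1 t))" using C by (simp add: field_simps)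
    then have "ln (1 / C) \<le> ln (norm (zeta1 (Complex 1 t)))"
      using C zeta1_deriv(2)[OF st] by (subst ln_le_cancel_iff) auto
    then show ?thesis using C by (simp add: ln_div)
  qed
  define \<sigma> t where "\<sigma> = Re s" and "t = Im s"
  have s_eq: "s = Complex \<sigma> t" by (simp add: \<sigma>_def t_def)
  have sg: "0 < \<sigma>" "\<sigma> \<le> 1" using s by (auto simp: \<sigma>_def)
  have nz: "norm (zeta1 (Complex \<sigma> u)) > 0" for u
    using zeta1_deriv(2)[of "Complex \<sigma> u"] sg by (simp add: strip_def)
  have "- 8 * ln C \<le> 3 * ln (norm (zeta1 (Complex 1 0))) + 4 * ln (norm (zeta1 (Complex 1 t))) + ln (norm (zeta1 (Complex 1 (2 * t))))"
    using one[of 0] one[of t] one[of "2 * t"] by linarith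
  also have "\<dots> \<le> 3 * ln (norm (zeta1 (Complex \<sigma> 0))) + 4 * ln (norm (zeta1 (Complex \<sigma> t))) + ln (norm (zeta1 (Complex \<sigma> (2 * t))))"
    by (rule mertens_341[OF sg])
  finally have A: "- 8 * ln C \<le> 3 * ln (norm (zeta1 (Complex \<sigma> 0))) + 4 * ln (norm (zeta1 (Complex \<sigma> t))) + ln (norm (zeta1 (Complex \<sigma> (2 * t))))" .
  have "ln (norm (zeta1 (Complex \<sigma> 0))) \<le> ln (C / \<sigma>)"
    using real[OF sg] sg C by (subst ln_le_cancel_iff) auto
  also have "ln (C / \<sigma>) = ln C - ln \<sigma>" using sg C by (simp add: ln_div)
  finally have B: "ln (norm (zeta1 (Complex \<sigma> 0))) \<le> ln C - ln \<sigma>" .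
  from A B have "- 11 * ln C + 3 * ln \<sigma> \<le> 4 * ln (norm (zeta1 (Complex \<sigma> t))) + ln (norm (zeta1 (Complex \<sigma> (2 * t))))"
    by linarith
  also have "\<dots> = ln (norm (zeta1 (Complex \<sigma> t)) ^ 4 * norm (zeta1 (Complex \<sigma> (2 * t))))"
    using nz by (simp add: ln_mult ln_realpow)
  also have "- 11 * ln C + 3 * ln \<sigma> = ln (C powr (-11) * \<sigma> ^ 3)"
    using sg C by (simp add: ln_mult ln_realpow ln_powr)
  finally have "C powr (-11) * \<sigma> ^ 3 \<le> norm (zeta1 (Complex \<sigma> t)) ^ 4 * norm (zeta1 (Complex \<sigma> (2 * t)))"
    using sg C nz by (subst (asm) ln_le_cancel_iff) auto
  then show ?thesis by (simp add: s_eq)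
qed

text \<open>Away from s = 0, |s| is comparable with \<open>ht s\<close>, and zeta is
  O(\<open>ht s powr (1/50)\<close>) at the doubled height. The fourth root of the 3-4-1 bound
  leaves \<open>Re s powr (3/4)\<close> and the exponent 1 - 1/200 of the height, rounded down to
  49/50.\<close>

lemma szeta_lower_away:
  assumes \<tau>: "0 < \<tau>" "\<tau> \<le> 1"
  shows "\<exists>c>0. c \<le> 1 \<and> (\<forall>s. 0 < Re s \<longrightarrow> Re s \<le> 1 \<longrightarrow> \<bar>Im s\<bar> \<ge> \<tau> \<longrightarrow>
     c * ht s powr (49/50) * Re s powr (3/4) \<le> norm (szeta s))"
proof -
  obtain C where C: "C \<ge> 1" "\<And>s. 0 < Re s \<Longrightarrow> Re s \<le> 2 \<Longrightarrow> norm (szeta s) \<le> C * ht s powr (51/50)"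
    "\<And>s. 0 < Re s \<Longrightarrow> Re s \<le> 2 \<Longrightarrow> norm (deriv szeta s) \<le> C * ht s powr (51/50)"
    "\<And>s. 0 < Re s \<Longrightarrow> Re s \<le> 2 \<Longrightarrow> norm (deriv (deriv szeta) s) \<le> C * ht s powr (51/50)"
    using szeta_derivs_upper by metis
  define b where "b = C powr (-11) * \<tau> / (4 * C) * (\<tau> / 2) ^ 4"
  define c where "c = min 1 (b powr (1/4))"
  have b0: "b > 0" using C \<tau> by (simp add: b_def)
  show ?thesis
  proof (intro exI conjI allI impI)
    show "c > 0" "c \<le> 1" using b0 by (auto simp: c_def)
    fix s assume s: "0 < Re s" "Re s \<le> 1" "\<bar>Im s\<bar> \<ge> \<tau>"
    define w where "w = ht s"
    have w1: "w \<ge> 1" unfolding w_def by (rule ht_ge_1)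
    have im: "w * (\<tau> / 2) \<le> \<bar>Im s\<bar>"
    proof -
      have "\<tau> * \<bar>Im s\<bar> \<le> 1 * \<bar>Im s\<bar>" using \<tau> by (intro mult_right_mono) auto
      then show ?thesis using s by (simp add: w_def ht_def algebra_simps)
    qed
    define s2 where "s2 = Complex (Re s) (2 * Im s)"
    have "norm (zeta1 s2) \<le> 4 * C / \<tau> * w powr (1/50)"
    proof -
      have "norm (szeta s2) \<le> C * ht s2 powr (51/50)" using C(2)[of s2] s by (simp add: s2_def)
      also have "\<dots> \<le> C * (2 * w) powr (51/50)"
        using C by (intro mult_left_mono powr_mono2) (auto simp: ht_def w_def s2_def)
      also have "\<dots> = C * 2 powr (51/50) * w powr (51/50)" using w1 by (simp add: powr_mult)
      also have "\<dots> \<le> C * 2 powr 2 * w powr (51/50)"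
        using C by (intro mult_right_mono mult_left_mono powr_mono) auto
      finally have "norm (szeta s2) \<le> 4 * C * w powr (51/50)" by simp
      moreover have "w * \<tau> \<le> norm s2"
        using im abs_Im_le_cmod[of s2] by (simp add: s2_def)
      moreover have "0 < w * \<tau>" using w1 \<tau> by simp
      ultimately have "norm (szeta s2) / norm s2 \<le> 4 * C * w powr (51/50) / (w * \<tau>)"
        using C by (intro frac_le) auto
      also have "\<dots> = 4 * C / \<tau> * (w powr (51/50) / w powr 1)" using w1 by simp
      also have "w powr (51/50) / w powr 1 = w powr (1/50)" by (subst powr_diff[symmetric]) simp
      finally show ?thesis by (simp add: zeta1_def norm_divide)
    qed
    then have "norm (zeta1 s) ^ 4 * norm (zeta1 s2) \<le> norm (zeta1 s) ^ 4 * (4 * C / \<tau> * w powr (1/50))"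
      by (intro mult_left_mono) auto
    with zeta1_lower[OF C(1,2) s(1,2)] have "C powr (-11) * Re s ^ 3 \<le> norm (zeta1 s) ^ 4 * (4 * C / \<tau> * w powr (1/50))"
      unfolding s2_def by linarith
    then have "C powr (-11) * \<tau> / (4 * C) * Re s ^ 3 * w powr (-1/50) \<le> norm (zeta1 s) ^ 4"
      using C \<tau> w1 by (simp add: field_simps powr_minus)
    then have "C powr (-11) * \<tau> / (4 * C) * Re s ^ 3 * w powr (-1/50) * (w * (\<tau> / 2)) ^ 4 \<le> norm (zeta1 s) ^ 4 * norm s ^ 4"
      using im abs_Im_le_cmod[of s] w1 \<tau> by (intro mult_mono power_mono) auto
    also have "\<dots> = norm (szeta s) ^ 4" using s by (auto simp: zeta1_def norm_divide power_divide)
    also have "C powr (-11) * \<tau> / (4 * C) * Re s ^ 3 * w powr (-1/50) * (w * (\<tau> / 2)) ^ 4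
       = b * (w powr (-1/50) * w ^ 4) * Re s ^ 3" by (simp add: b_def power_mult_distrib power_divide)
    also have "w ^ 4 = w powr 4" using w1 by simp
    also have "w powr (-1/50) * w powr 4 = w powr (199/50)" unfolding powr_add[symmetric] by simp
    also have "b * w powr (199/50) * Re s ^ 3 = (b powr (1/4) * w powr (199/200) * Re s powr (3/4)) ^ 4"
      using b0 w1 s by (simp add: power_mult_distrib powr_power)
    finally have "b powr (1/4) * w powr (199/200) * Re s powr (3/4) \<le> norm (szeta s)"
      by (subst (asm) power_mono_iff) auto
    moreover have "c * w powr (49/50) * Re s powr (3/4) \<le> b powr (1/4) * w powr (199/200) * Re s powr (3/4)"
      using w1 b0 by (intro mult_right_mono mult_mono powr_mono) (auto simp: c_def)
    ultimately show "c * ht s powr (49/50) * Re s powr (3/4) \<le> norm (szeta s)" by (simp add: w_def)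
  qed
qed

text \<open>Far from the real axis, the previous bound is used for \<open>Re s \<ge> \<sigma>\<close>, where \<open>\<sigma>\<close> is a small multiple of \<open>ht s powr (-8/50)\<close>,
  and is carried to the left of \<open>\<sigma>\<close> by the bound on the derivative. Near \<open>s = 0\<close> the value is close to 1.\<close>

lemma szeta_lower:
  "\<exists>c>0. \<exists>\<delta>>0. \<delta> \<le> 1 \<and> (\<forall>s. 0 < Re s \<longrightarrow> Re s \<le> \<delta> \<longrightarrow> c * ht s powr (43/50) \<le> norm (szeta s))"
proof -
  \<comment> \<open>For |s| \<le> 2 \<tau> and |1 + s|^(1/50) \<le> 3 the distance of
    \<open>szeta s\<close> from 1 is then at most 6 szeta_const \<tau> \<le> 1/2.\<close>
  define \<tau> where "\<tau> = min 1 (1 / (12 * szeta_const))"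
  have \<tau>: "0 < \<tau>" "\<tau> \<le> 1" "12 * szeta_const * \<tau> \<le> 1" using szeta_const_pos by (auto simp: \<tau>_def min_def field_simps)
  obtain C where C: "C \<ge> 1" "\<And>s. 0 < Re s \<Longrightarrow> Re s \<le> 2 \<Longrightarrow> norm (szeta s) \<le> C * ht s powr (51/50)"
    "\<And>s. 0 < Re s \<Longrightarrow> Re s \<le> 2 \<Longrightarrow> norm (deriv szeta s) \<le> C * ht s powr (51/50)"
    "\<And>s. 0 < Re s \<Longrightarrow> Re s \<le> 2 \<Longrightarrow> norm (deriv (deriv szeta) s) \<le> C * ht s powr (51/50)"
    using szeta_derivs_upper by metis
  obtain c where c: "c > 0" "c \<le> 1"
    "\<And>s. 0 < Re s \<Longrightarrow> Re s \<le> 1 \<Longrightarrow> \<bar>Im s\<bar> \<ge> \<tau> \<Longrightarrow> c * ht s powr (49/50) * Re s powr (3/4) \<le> norm (szeta s)"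
    using szeta_lower_away[OF \<tau>(1,2)] by metis
  \<comment> \<open>With this k the loss \<open>C * k ^ 4 = d\<close> along the segment to the left
    is one half of the lower bound \<open>c * k ^ 3 = 2 * d\<close> at its right end.\<close>
  define k where "k = c / (2 * C)"
  have k: "0 < k" "k \<le> 1" using c C by (auto simp: k_def)
  define d where "d = c * k ^ 3 / 2"
  have d: "d > 0" using c k by (simp add: d_def)
  have away: "d * ht s powr (43/50) \<le> norm (szeta s)" if s: "0 < Re s" "Re s \<le> 1" "\<bar>Im s\<bar> \<ge> \<tau>" for s
  proof -
    define w where "w = ht s"
    have w1: "w \<ge> 1" unfolding w_def by (rule ht_ge_1)
    \<comment> \<open>The exponent -8/50 solves 49/50 - (3/4) e = 51/50 - e: both sides, the lower
      bound and the loss, become 43/50.\<close>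
    define \<sigma> where "\<sigma> = k ^ 4 * w powr (-8/50)"
    have sg: "0 < \<sigma>" "\<sigma> \<le> 1"
    proof -
      show "0 < \<sigma>" using k w1 by (simp add: \<sigma>_def)
      have "w powr (-8/50) \<le> 1 powr (-8/50)" using w1 by (intro powr_mono2') auto
      moreover have "k ^ 4 \<le> 1" using k by (intro power_le_one) auto
      ultimately have "k ^ 4 * w powr (-8/50) \<le> 1 * 1" using k by (intro mult_mono) auto
      then show "\<sigma> \<le> 1" by (simp add: \<sigma>_def)
    qed
    have main: "c * w powr (49/50) * \<sigma> powr (3/4) = 2 * d * w powr (43/50)"
    proof -
      have "(k ^ 4) powr (3/4) = (k powr 4) powr (3/4)" using k by simp
      also have "\<dots> = k powr (4 * (3/4))" by (rule powr_powr)
      also have "\<dots> = k ^ 3" using k by simp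
      finally have "(k ^ 4) powr (3/4) = k ^ 3" .
      then have "\<sigma> powr (3/4) = k ^ 3 * w powr (-6/50)"
        using k w1 by (simp add: \<sigma>_def powr_mult powr_powr)
      then have "c * w powr (49/50) * \<sigma> powr (3/4) = c * k ^ 3 * (w powr (49/50) * w powr (-6/50))" by simp
      also have "w powr (49/50) * w powr (-6/50) = w powr (43/50)" by (simp flip: powr_add)
      finally show ?thesis by (simp add: d_def)
    qed
    show ?thesis
    proof (cases "Re s \<ge> \<sigma>")
      case True
      have "d * w powr (43/50) \<le> 2 * d * w powr (43/50)" using d by (intro mult_right_mono) auto
      also have "\<dots> = c * w powr (49/50) * \<sigma> powr (3/4)" using main by simp
      also have "\<dots> \<le> c * w powr (49/50) * Re s powr (3/4)"
        using True sg c by (intro mult_left_mono powr_mono2) auto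
      also have "\<dots> \<le> norm (szeta s)" using c(3)[OF s] by (simp add: w_def)
      finally show ?thesis by (simp add: w_def)
    next
      case False
      define s1 where "s1 = Complex \<sigma> (Im s)"
      have "norm (szeta s1 - szeta s) \<le> C * w powr (51/50) * norm (s1 - s)"
      proof (rule field_differentiable_bound[OF convex_closed_segment[of s s1]])
        fix z assume "z \<in> closed_segment s s1"
        then obtain u where u: "0 \<le> u" "u \<le> 1" "z = (1 - u) *\<^sub>R s + u *\<^sub>R s1"
          by (auto simp: closed_segment_def)
        have im: "Im z = Im s" unfolding u(3) by (simp add: s1_def algebra_simps)
        have "Re z = (1 - u) * Re s + u * \<sigma>" unfolding u(3) by (simp add: s1_def)
        moreover have "(1 - u) * Re s \<le> (1 - u) * \<sigma>" "u * Re s \<le> u * \<sigma>"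
          using u False by (auto intro!: mult_left_mono)
        ultimately have "Re s \<le> Re z" "Re z \<le> \<sigma>" by (auto simp: algebra_simps)
        then have re: "0 < Re z" "Re z \<le> 2" using s sg by auto
        then show "(szeta has_field_derivative deriv szeta z) (at z within closed_segment s s1)"
          by (intro has_field_derivative_at_within[OF szeta_deriv]) (auto simp: wide_strip_def)
        show "norm (deriv szeta z) \<le> C * w powr (51/50)" using C(3)[OF re] im by (simp add: w_def ht_def)
      qed auto
      also have "norm (s1 - s) = \<sigma> - Re s"
        using False by (simp add: s1_def cmod_def)
      also have "C * w powr (51/50) * (\<sigma> - Re s) \<le> C * w powr (51/50) * \<sigma>"
        using C s by (intro mult_left_mono) auto
      also have "\<dots> = C * k ^ 4 * (w powr (51/50) * w powr (-8/50))" by (simp add: \<sigma>_def)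
      also have "w powr (51/50) * w powr (-8/50) = w powr (43/50)" by (simp flip: powr_add)
      also have "C * k ^ 4 = d" using C by (simp add: d_def k_def power_divide eval_nat_numeral)
      finally have "norm (szeta s1 - szeta s) \<le> d * w powr (43/50)" .
      moreover have "2 * d * w powr (43/50) \<le> norm (szeta s1)"
        using c(3)[of s1] s sg main by (simp add: s1_def w_def ht_def)
      moreover have "norm (szeta s1) \<le> norm (szeta s) + norm (szeta s1 - szeta s)"
        using norm_triangle_ineq[of "szeta s" "szeta s1 - szeta s"] by simp
      ultimately show ?thesis by (simp add: w_def)
    qed
  qed
  show ?thesis
  proof (intro exI conjI allI impI)
    show "min d (1/4) > 0" "\<tau> > 0" "\<tau> \<le> 1" using d \<tau> by auto
    fix s assume s: "0 < Re s" "Re s \<le> \<tau>"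
    show "min d (1/4) * ht s powr (43/50) \<le> norm (szeta s)"
    proof (cases "\<bar>Im s\<bar> \<ge> \<tau>")
      case True
      have "min d (1/4) * ht s powr (43/50) \<le> d * ht s powr (43/50)" by (intro mult_right_mono) auto
      then show ?thesis using away[of s] True s \<tau> by linarith
    next
      case False
      have "norm s \<le> 2 * \<tau>" using cmod_le[of s] s False by simp
      moreover have "norm (1 + s) \<le> 3" using norm_triangle_ineq[of 1 s] calculation \<tau> by simp
      then have "norm (1 + s) powr (1/50) \<le> 3 powr (1/50)" by (intro powr_mono2) auto
      then have "norm (1 + s) powr (1/50) \<le> 3 powr 1" using powr_mono[of "1/50" 1 "3::real"] by simp
      then have "norm (1 + s) powr (1/50) \<le> 3" by simp
      ultimately have "szeta_const * norm s * norm (1 + s) powr (1/50) \<le> szeta_const * (2 * \<tau>) * 3"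
        using szeta_const_pos \<tau> by (intro mult_mono mult_left_mono) auto
      moreover have "norm (szeta s - 1) \<le> szeta_const * norm s * norm (1 + s) powr (1/50)"
        using s \<tau> by (intro zterm_sums(2)) (auto simp: wide_strip_def)
      ultimately have "norm (szeta s - 1) \<le> 1/2" using \<tau>(3) by linarith
      then have szeta: "norm (szeta s) \<ge> 1/2" using norm_triangle_ineq[of "szeta s" "1 - szeta s"] by (simp add: norm_minus_commute)
      have "ht s powr (43/50) \<le> 2 powr (43/50)" using False \<tau> by (intro powr_mono2) (auto simp: ht_def)
      also have "\<dots> \<le> 2 powr 1" by (intro powr_mono) auto
      finally have "min d (1/4) * ht s powr (43/50) \<le> 1/4 * 2" using d by (intro mult_mono) auto
      then show ?thesis using szeta by simp
    qed
  qed
qed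

text \<open>The second derivative of \<open>1 / szeta\<close>, and the derivative of \<open>- (1 + szeta' / szeta) / (1 + s)\<close>.\<close>

definition inverse_szeta_deriv2 :: "complex \<Rightarrow> complex" where
  "inverse_szeta_deriv2 s = 2 * deriv szeta s ^ 2 / szeta s ^ 3 - deriv (deriv szeta) s / szeta s ^ 2"

definition psi_transform_deriv :: "complex \<Rightarrow> complex" where
  "psi_transform_deriv s = (1 + deriv szeta s / szeta s) / (1 + s) ^ 2 - (deriv (deriv szeta) s / szeta s - (deriv szeta s / szeta s) ^ 2) / (1 + s)"

text \<open>Quotients by \<open>szeta\<close> are of order 51/50 - 43/50 = 8/50, their products of
  order 16/50. The remaining factor 1 / \<open>szeta\<close> brings (1 / szeta)'' to 16/50 - 43/50 =
  -27/50; in the other expression a factor 1 / (1 + s) brings 16/50 - 1 = -34/50.\<close>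

lemma szeta_quotient_bounds:
  "\<exists>B\<ge>0. \<exists>\<delta>>0. \<delta> \<le> 1 \<and> (\<forall>s. 0 < Re s \<longrightarrow> Re s \<le> \<delta> \<longrightarrow>
     norm (inverse_szeta_deriv2 s) \<le> B * ht s powr (-1/2) \<and>
     norm (psi_transform_deriv s)
       \<le> B * ht s powr (-1/2))"
proof -
  obtain C where C: "C \<ge> 1"
    "\<And>s. 0 < Re s \<Longrightarrow> Re s \<le> 2 \<Longrightarrow> norm (deriv szeta s) \<le> C * ht s powr (51/50)"
    "\<And>s. 0 < Re s \<Longrightarrow> Re s \<le> 2 \<Longrightarrow> norm (deriv (deriv szeta) s) \<le> C * ht s powr (51/50)"
    using szeta_derivs_upper by metis
  obtain c \<delta> where c: "c > 0" "\<delta> > 0" "\<delta> \<le> 1"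
    "\<And>s. 0 < Re s \<Longrightarrow> Re s \<le> \<delta> \<Longrightarrow> c * ht s powr (43/50) \<le> norm (szeta s)"
    using szeta_lower by metis
  define D where "D = C / c"
  have D: "D > 0" using C c by (simp add: D_def)
  define B where "B = (2 * D ^ 2 + D) / c + (4 * (1 + D) + 2 * (D + D ^ 2))"
  have main: "norm (inverse_szeta_deriv2 s) \<le> B * ht s powr (-1/2)"
     "norm (psi_transform_deriv s)
       \<le> B * ht s powr (-1/2)" if s: "0 < Re s" "Re s \<le> \<delta>" for s
  proof -
    define w where "w = ht s"
    have w: "w \<ge> 1" unfolding w_def by (rule ht_ge_1)
    have Zl: "c * w powr (43/50) \<le> norm (szeta s)" using c(4)[OF s] by (simp add: w_def)
    have pos: "0 < c * w powr (43/50)" using c w by simp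
    then have Z0: "szeta s \<noteq> 0" using Zl by auto
    have mono: "w powr a \<le> w powr b" if "a \<le> b" for a b using that w by (intro powr_mono) auto
    have q: "norm (x / szeta s) \<le> D * w powr (8/50)" if "norm x \<le> C * w powr (51/50)" for x
    proof -
      have "norm x / norm (szeta s) \<le> C * w powr (51/50) / (c * w powr (43/50))"
        using that Zl pos C by (intro frac_le) auto
      also have "\<dots> = D * (w powr (51/50) / w powr (43/50))" by (simp add: D_def)
      also have "w powr (51/50) / w powr (43/50) = w powr (8/50)" by (subst powr_diff[symmetric]) simp
      finally show ?thesis by (simp add: norm_divide)
    qed
    define r1 r2 i where "r1 = deriv szeta s / szeta s" and "r2 = deriv (deriv szeta) s / szeta s" and "i = inverse (1 + s)"
    have r: "norm r1 \<le> D * w powr (8/50)" "norm r2 \<le> D * w powr (8/50)"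
      unfolding r1_def r2_def by (rule q, use C(2,3)[of s] s c in \<open>simp add: w_def\<close>)+
    have r1sq: "norm (r1 ^ 2) \<le> D ^ 2 * w powr (16/50)"
    proof -
      have "norm (r1 ^ 2) \<le> (D * w powr (8/50)) ^ 2" unfolding norm_power using r by (intro power_mono) auto
      also have "\<dots> = D ^ 2 * (w powr (8/50) * w powr (8/50))" by (simp add: power2_eq_square)
      also have "w powr (8/50) * w powr (8/50) = w powr (16/50)" unfolding powr_add[symmetric] by simp
      finally show ?thesis .
    qed
    have i: "norm i \<le> 2 * w powr (-1)"
    proof -
      have "1 \<le> norm (1 + s)" using abs_Re_le_cmod[of "1 + s"] s by simp
      moreover have "\<bar>Im s\<bar> \<le> norm (1 + s)" using abs_Im_le_cmod[of "1 + s"] by simp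
      ultimately have "w / 2 \<le> norm (1 + s)" by (simp add: w_def ht_def)
      then have "inverse (norm (1 + s)) \<le> inverse (w / 2)" using w by (intro le_imp_inverse_le) auto
      then show ?thesis using w by (simp add: i_def norm_inverse norm_divide powr_minus inverse_eq_divide)
    qed
    have iZ: "norm (inverse (szeta s)) \<le> 1 / c * w powr (-43/50)"
    proof -
      have "inverse (norm (szeta s)) \<le> inverse (c * w powr (43/50))" using Zl pos by (intro le_imp_inverse_le) auto
      then show ?thesis by (simp add: norm_inverse norm_divide powr_minus inverse_eq_divide)
    qed
    have "inverse_szeta_deriv2 s = (2 * r1 ^ 2 - r2) * inverse (szeta s)"
      using Z0 by (simp add: inverse_szeta_deriv2_def r1_def r2_def field_simps power2_eq_square power3_eq_cube)
    also have "norm \<dots> \<le> (2 * (D ^ 2 * w powr (16/50)) + D * w powr (16/50)) * (1 / c * w powr (-43/50))"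
    proof (unfold norm_mult, intro mult_mono iZ)
      have "norm (2 * r1 ^ 2 - r2) \<le> 2 * norm (r1 ^ 2) + norm r2"
        using norm_triangle_ineq4[of "2 * r1 ^ 2" r2] by (simp add: norm_mult)
      also have "norm r2 \<le> D * w powr (16/50)"
      proof -
        have "D * w powr (8/50) \<le> D * w powr (16/50)" using D by (intro mult_left_mono mono) auto
        then show ?thesis using r(2) by linarith
      qed
      finally show "norm (2 * r1 ^ 2 - r2) \<le> 2 * (D ^ 2 * w powr (16/50)) + D * w powr (16/50)"
        using r1sq by simp
    qed (use D in auto)
    also have "\<dots> = (2 * D ^ 2 + D) / c * (w powr (16/50) * w powr (-43/50))" by (simp add: algebra_simps add_divide_distrib)
    also have "w powr (16/50) * w powr (-43/50) = w powr (-27/50)" unfolding powr_add[symmetric] by simp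
    also have "(2 * D ^ 2 + D) / c * w powr (-27/50) \<le> B * w powr (-1/2)"
      unfolding B_def using D c by (intro mult_mono mono) auto
    finally show "norm (inverse_szeta_deriv2 s) \<le> B * ht s powr (-1/2)"
      by (simp add: w_def)
    have "psi_transform_deriv s
      = (1 + r1) * (i * i) - (r2 - r1 ^ 2) * i"
      by (simp add: psi_transform_deriv_def r1_def r2_def i_def divide_inverse power2_eq_square)
    also have "norm \<dots> \<le> norm (1 + r1) * (norm i * norm i) + norm (r2 - r1 ^ 2) * norm i"
      using norm_triangle_ineq4[of "(1 + r1) * (i * i)" "(r2 - r1 ^ 2) * i"] by (simp add: norm_mult)
    also have "\<dots> \<le> ((1 + D) * w powr (16/50)) * ((2 * w powr (-1)) * (2 * 1)) + ((D + D ^ 2) * w powr (16/50)) * (2 * w powr (-1))"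
    proof (intro add_mono mult_mono i)
      have w8: "D * w powr (8/50) \<le> D * w powr (16/50)" "1 \<le> w powr (16/50)"
        using D w by (auto intro!: mult_left_mono mono ge_one_powr_ge_zero)
      have "norm (1 + r1) \<le> 1 + D * w powr (8/50)" using norm_triangle_ineq[of 1 r1] r by simp
      then show "norm (1 + r1) \<le> (1 + D) * w powr (16/50)" using w8 by (simp add: algebra_simps)
      have "norm (r2 - r1 ^ 2) \<le> norm r2 + norm (r1 ^ 2)" by (rule norm_triangle_ineq4)
      then show "norm (r2 - r1 ^ 2) \<le> (D + D ^ 2) * w powr (16/50)"
        using r r1sq w8 by (simp add: algebra_simps)
      have "w powr (-1) \<le> 1" using mono[of "-1" 0] w by simp
      then show "norm i \<le> 2 * 1" using i by simp
    qed (use D in auto)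
    also have "\<dots> = (4 * (1 + D) + 2 * (D + D ^ 2)) * (w powr (16/50) * w powr (-1))" by algebra
    also have "w powr (16/50) * w powr (-1) = w powr (-34/50)" unfolding powr_add[symmetric] by simp
    also have "(4 * (1 + D) + 2 * (D + D ^ 2)) * w powr (-34/50) \<le> B * w powr (-1/2)"
      unfolding B_def using D c by (intro mult_mono mono) auto
    finally show "norm (psi_transform_deriv s)
       \<le> B * ht s powr (-1/2)" by (simp add: w_def)
  qed
  have "B \<ge> 0" using D c by (simp add: B_def)
  then show ?thesis using main c(2,3) by blast
qed

section \<open>Summatory functions on a logarithmic scale\<close>

text \<open>In the variable t = ln x a Dirichlet series becomes a Laplace transform, and the sum is
  empty for t < 0.\<close>

definition summatory :: "(nat \<Rightarrow> real) \<Rightarrow> real \<Rightarrow> real" where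
  "summatory a t = (\<Sum>n\<in>{1..nat \<lfloor>exp t\<rfloor>}. a n)"

lemma summatory_measurable [measurable]: "summatory a \<in> borel_measurable borel"
  unfolding summatory_def[abs_def] by measurable

lemma summatory_neg: "t < 0 \<Longrightarrow> summatory a t = 0"
proof -
  assume "t < 0"
  then have "\<lfloor>exp t\<rfloor> = 0" by (simp add: floor_eq_iff)
  then show ?thesis by (simp add: summatory_def)
qed

lemma le_nat_floor_exp_iff: "n \<ge> 1 \<Longrightarrow> n \<le> nat \<lfloor>exp t\<rfloor> \<longleftrightarrow> ln (real n) \<le> t"
  by (simp add: le_nat_floor le_nat_iff le_floor_iff ln_le_cancel_iff[of "real n" "exp t", simplified, symmetric])

lemma has_integral_exp_tail:
  assumes "Re z > 0" "c \<ge> 0"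
  shows "integrable lborel (\<lambda>t. indicator {c..} t *\<^sub>R exp (- z * of_real t))"
    "(LBINT t. indicator {c..} t *\<^sub>R exp (- z * of_real t)) = exp (- z * of_real c) / z"
proof -
  have z0: "z \<noteq> 0" using assms by auto
  show int: "integrable lborel (\<lambda>t. indicator {c..} t *\<^sub>R exp (- z * of_real t))"
  proof (rule Bochner_Integration.integrable_bound[OF integrable_exp_minus[OF assms(1)]])
    show "AE t in lborel. norm (indicator {c..} t *\<^sub>R exp (- z * of_real t)) \<le> norm (indicator {0..} t * exp (- Re z * t))"
      using assms by (auto intro!: AE_I2 simp: indicator_def)
  qed measurable
  have "(LBINT t. indicator {c..} t *\<^sub>R exp (- z * of_real t)) = (LBINT t. indicator {c<..} t *\<^sub>R exp (- z * of_real t))"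
    by (rule integral_cong_AE) (use AE_lborel_singleton[of c] in \<open>auto simp: indicator_def\<close>)
  also have "\<dots> = (LBINT t=ereal c..\<infinity>. exp (- z * of_real t))"
    by (simp add: interval_integral_Ioi set_lebesgue_integral_def)
  also have "\<dots> = 0 - (- (exp (- z * of_real c) / z))"
  proof (rule interval_integral_FTC_integrable[where F = "\<lambda>t. - (exp (- z * of_real t) / z)"])
    show "((\<lambda>t. - (exp (- z * of_real t) / z)) has_vector_derivative exp (- z * of_real x)) (at x)" for x
      using z0 by (auto intro!: derivative_eq_intros has_vector_derivative_real_field)
    show "set_integrable lborel (einterval (ereal c) \<infinity>) (\<lambda>t. exp (- z * of_real t))"
    proof -
      have "set_integrable lborel {c..} (\<lambda>t. exp (- z * of_real t))" using int by (simp add: set_integrable_def)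
      then show ?thesis by (rule set_integrable_subset) (auto simp: einterval_iff)
    qed
    have "((\<lambda>t. - (exp (- z * of_real t) / z)) \<longlongrightarrow> - (exp (- z * of_real c) / z)) (at_right c)"
      using z0 by (intro tendsto_intros)
    then show "(((\<lambda>t. - (exp (- z * of_real t) / z)) \<circ> real_of_ereal) \<longlongrightarrow> - (exp (- z * of_real c) / z)) (at_right (ereal c))"
      by (simp add: ereal_tendsto_simps)
    have "((\<lambda>t. - (exp (- z * of_real t) / z)) \<longlongrightarrow> 0) at_top"
    proof (rule tendsto_norm_zero_cancel)
      have e: "((\<lambda>t. exp (- a * t)) \<longlongrightarrow> 0) at_top" if "a > 0" for a :: real
        using that by real_asymp
      have "((\<lambda>t. exp (- Re z * t) / norm z) \<longlongrightarrow> 0 / norm z) at_top"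
        using z0 assms(1) by (intro tendsto_divide e tendsto_const) auto
      then show "((\<lambda>t. norm (- (exp (- z * complex_of_real t) / z))) \<longlongrightarrow> 0) at_top"
        by (simp add: norm_divide)
    qed
    then show "(((\<lambda>t. - (exp (- z * of_real t) / z)) \<circ> real_of_ereal) \<longlongrightarrow> 0) (at_left \<infinity>)"
      by (simp add: ereal_tendsto_simps)
  qed (auto intro!: continuous_intros)
  finally show "(LBINT t. indicator {c..} t *\<^sub>R exp (- z * of_real t)) = exp (- z * of_real c) / z" by simp
qed

text \<open>Each n contributes a step of height \<open>a n\<close> starting at ln n, with transform
  a(n) n^(-z) / z; absolute summability allows integrating termwise.\<close>

lemma summatory_laplace:
  assumes z: "Re z > 0" and sm: "summable (\<lambda>k. \<bar>a (Suc k)\<bar> * real (Suc k) powr (- Re z))"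
  shows "(\<lambda>k. of_real (a (Suc k)) * exp (- z * of_real (ln (real (Suc k)))) / z) sums
     (LBINT t. of_real (summatory a t) * exp (- z * of_real t))"
proof -
  define f where "f = (\<lambda>k t. complex_of_real (a (Suc k)) * (indicator {ln (real (Suc k))..} t *\<^sub>R exp (- z * of_real t)))"
  have ln0: "0 \<le> ln (real (Suc k))" for k by simp
  have int: "integrable lborel (f k)" for k
    unfolding f_def by (intro integrable_mult_right has_integral_exp_tail z ln0)
  have val: "integral\<^sup>L lborel (f k) = of_real (a (Suc k)) * exp (- z * of_real (ln (real (Suc k)))) / z" for k
    unfolding f_def integral_mult_right_zero has_integral_exp_tail(2)[OF z ln0] by simp
  have nval: "(LBINT t. norm (f k t)) = \<bar>a (Suc k)\<bar> * real (Suc k) powr (- Re z) / Re z" for k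
  proof -
    have "complex_of_real (LBINT t. norm (f k t)) = (LBINT t. of_real (norm (f k t)))" by simp
    also have "\<dots> = (LBINT t. complex_of_real \<bar>a (Suc k)\<bar> * (indicator {ln (real (Suc k))..} t *\<^sub>R exp (- of_real (Re z) * of_real t)))"
      by (intro Bochner_Integration.integral_cong) (auto simp: f_def norm_mult exp_of_real[symmetric] indicator_def)
    also have "\<dots> = complex_of_real \<bar>a (Suc k)\<bar> * (exp (- of_real (Re z) * of_real (ln (real (Suc k)))) / of_real (Re z))"
      unfolding integral_mult_right_zero
      by (subst has_integral_exp_tail(2)[OF _ ln0]) (use z in auto)
    also have "\<dots> = complex_of_real (\<bar>a (Suc k)\<bar> * real (Suc k) powr (- Re z) / Re z)"
      by (simp add: powr_def exp_of_real[symmetric])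
    finally show ?thesis by (simp only: of_real_eq_iff)
  qed
  have fin: "f k t = (if k \<in> {..<nat \<lfloor>exp t\<rfloor>} then of_real (a (Suc k)) * exp (- z * of_real t) else 0)" for k t
    using le_nat_floor_exp_iff[of "Suc k" t] by (auto simp: f_def indicator_def)
  have sums: "(\<lambda>k. f k t) sums (of_real (summatory a t) * exp (- z * of_real t))" for t
  proof -
    have "(\<lambda>k. f k t) sums (\<Sum>k\<in>{..<nat \<lfloor>exp t\<rfloor>}. of_real (a (Suc k)) * exp (- z * of_real t))"
      unfolding fin by (rule sums_If_finite_set) simp
    also have "(\<Sum>k\<in>{..<nat \<lfloor>exp t\<rfloor>}. of_real (a (Suc k)) * exp (- z * of_real t))
       = of_real (\<Sum>k\<in>{..<nat \<lfloor>exp t\<rfloor>}. a (Suc k)) * exp (- z * of_real t)"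
      by (simp add: sum_distrib_right)
    also have "(\<Sum>k\<in>{..<nat \<lfloor>exp t\<rfloor>}. a (Suc k)) = summatory a t"
      unfolding summatory_def by (rule sum.reindex_bij_witness[of _ "\<lambda>n. n - 1" Suc]) auto
    finally show ?thesis .
  qed
  have "(\<lambda>k. integral\<^sup>L lborel (f k)) sums (LBINT t. (\<Sum>k. f k t))"
  proof (rule sums_integral[OF int])
    show "AE t in lborel. summable (\<lambda>k. norm (f k t))"
    proof (intro AE_I2 summable_finite[of "{..<nat \<lfloor>exp t\<rfloor>}" for t])
      fix t :: real and k :: nat assume "k \<notin> {..<nat \<lfloor>exp t\<rfloor>}"
      then show "norm (f k t) = 0" by (simp add: fin)
    qed simp
    show "summable (\<lambda>k. LBINT t. norm (f k t))"
      unfolding nval using sm by (rule summable_divide)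
  qed
  then show ?thesis unfolding val using sums_unique[OF sums] by simp
qed

lemma harm_le: "n \<ge> 1 \<Longrightarrow> (\<Sum>k\<in>{1..n}. 1 / real k) \<le> 1 + ln (real n)"
proof -
  assume n: "n \<ge> 1"
  have "harm (Suc (n - 1)) - ln (real (Suc (n - 1))) \<le> harm (Suc 0) - ln (real (Suc 0))"
    using decseqD[OF decseq_harm_diff_ln, of 0 "n - 1"] by simp
  then show ?thesis using n by (simp add: harm_def inverse_eq_divide)
qed

section \<open>The transforms of the two error functions\<close>

definition mu_mean :: "real \<Rightarrow> real" where
  "mu_mean = summatory (\<lambda>n. moebius_mu n / real n)"

text \<open>The case distinction removes the constant -1 for t < 0, since \<open>subexp\<close>
  demands a function vanishing there.\<close>

definition psi_error :: "real \<Rightarrow> real" where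
  "psi_error t = (if t < 0 then 0 else summatory mangoldt t * exp (- t) - 1)"

lemma floor_exp_ge_1: "(t::real) \<ge> 0 \<Longrightarrow> nat \<lfloor>exp t\<rfloor> \<ge> 1"
  using le_nat_floor_exp_iff[of 1 t] by simp

lemma floor_exp_le: "real (nat \<lfloor>exp t\<rfloor>) \<le> exp (t::real)"
  by (simp add: of_nat_nat)

lemma mu_mean_bound: "t \<ge> 0 \<Longrightarrow> \<bar>mu_mean t\<bar> \<le> 1 + t"
proof -
  assume t: "t \<ge> 0"
  define N where "N = nat \<lfloor>exp t\<rfloor>"
  have N: "N \<ge> 1" "real N \<le> exp t" using floor_exp_ge_1[OF t] floor_exp_le by (auto simp: N_def)
  have "\<bar>mu_mean t\<bar> \<le> (\<Sum>n\<in>{1..N}. \<bar>moebius_mu n / real n\<bar>)"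
    unfolding mu_mean_def summatory_def N_def[symmetric] by (rule sum_abs)
  also have "\<dots> \<le> (\<Sum>n\<in>{1..N}. 1 / real n)"
    by (intro sum_mono) (auto simp: abs_divide intro!: divide_right_mono moebius_bound)
  also have "\<dots> \<le> 1 + ln (real N)" by (rule harm_le[OF N(1)])
  also have "ln (real N) \<le> t" using N ln_le_cancel_iff[of "real N" "exp t"] by simp
  finally show ?thesis by simp
qed

lemma summatory_mangoldt_bound: "t \<ge> 0 \<Longrightarrow> 0 \<le> summatory mangoldt t \<and> summatory mangoldt t \<le> t * exp t"
proof -
  assume t: "t \<ge> 0"
  define N where "N = nat \<lfloor>exp t\<rfloor>"
  have N: "N \<ge> 1" "real N \<le> exp t" using floor_exp_ge_1[OF t] floor_exp_le by (auto simp: N_def)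
  have lnN: "ln (real N) \<le> t" using N ln_le_cancel_iff[of "real N" "exp t"] by simp
  have "summatory mangoldt t \<le> (\<Sum>n\<in>{1..N}. t)"
    unfolding summatory_def N_def[symmetric]
  proof (rule sum_mono)
    fix n assume n: "n \<in> {1..N}"
    have "mangoldt n \<le> ln (real n)" using n by (intro mangoldt_le_ln) auto
    also have "\<dots> \<le> ln (real N)" using n by simp
    finally show "mangoldt n \<le> t" using lnN by simp
  qed
  also have "\<dots> \<le> t * exp t" using N t by (simp add: mult.commute mult_left_mono)
  finally show ?thesis by (auto simp: summatory_def intro!: sum_nonneg mangoldt_nonneg)
qed

lemma subexp_linear:
  assumes "f \<in> borel_measurable borel" "\<And>t. t < 0 \<Longrightarrow> f t = 0" "\<And>t. t \<ge> 0 \<Longrightarrow> \<bar>f t\<bar> \<le> 1 + t"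
  shows "subexp f"
  unfolding subexp_def
proof (intro conjI allI impI)
  fix \<sigma> :: real assume s: "\<sigma> > 0"
  have "\<bar>f t\<bar> \<le> (1 + 1 / \<sigma>) * exp (\<sigma> * t)" for t
  proof (cases "t < 0")
    case False
    have "\<sigma> * t \<le> exp (\<sigma> * t)" using exp_ge_add_one_self[of "\<sigma> * t"] by linarith
    moreover have "1 \<le> exp (\<sigma> * t)" using False s by simp
    ultimately have "t \<le> exp (\<sigma> * t) / \<sigma>" "1 \<le> exp (\<sigma> * t)" using s by (auto simp: field_simps)
    moreover have "(1 + 1 / \<sigma>) * exp (\<sigma> * t) = exp (\<sigma> * t) + exp (\<sigma> * t) / \<sigma>"
      by (simp add: distrib_right)
    ultimately show ?thesis using assms(3)[of t] False by linarith
  qed (use assms s in auto)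
  then show "\<exists>C. \<forall>t. \<bar>f t\<bar> \<le> C * exp (\<sigma> * t)" by blast
qed (use assms in auto)

lemma subexp_mu_mean: "subexp mu_mean"
  by (rule subexp_linear) (auto simp: mu_mean_def summatory_neg mu_mean_bound[unfolded mu_mean_def])

lemma subexp_psi_error: "subexp psi_error"
proof (rule subexp_linear)
  show "psi_error \<in> borel_measurable borel" unfolding psi_error_def[abs_def] by measurable
  fix t :: real assume t: "t \<ge> 0"
  have "0 \<le> summatory mangoldt t * exp (- t)" "summatory mangoldt t * exp (- t) \<le> t * exp t * exp (- t)"
    using summatory_mangoldt_bound[OF t] by (auto intro!: mult_right_mono)
  moreover have "t * exp t * exp (- t) = t" by (simp add: exp_minus)
  ultimately show "\<bar>psi_error t\<bar> \<le> 1 + t" using t by (simp add: psi_error_def)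
qed (simp add: psi_error_def)

text \<open>The division by s that comes with summation cancels the numerator of
  \<open>s / szeta s\<close>, the value of the Moebius series.\<close>

lemma laplace_mu_mean:
  assumes s: "s \<in> strip" shows "laplace mu_mean s = 1 / szeta s"
proof -
  have s0: "Re s > 0" "s \<noteq> 0" using s by (auto simp: strip_def)
  have eq: "real (Suc k) powr (- 1 - Re s) = real (Suc k) powr (- Re s) / real (Suc k)" for k
  proof -
    have *: "- 1 - Re s = - Re s - 1" by simp
    show ?thesis unfolding * using powr_diff[of "real (Suc k)" "- Re s" 1] by (simp del: of_nat_Suc)
  qed
  from summable_moebius_series[OF s0(1)] have "summable (\<lambda>k. \<bar>moebius_mu (Suc k) / real (Suc k)\<bar> * real (Suc k) powr (- Re s))"
    by (simp add: norm_mult norm_dterm eq abs_divide del: of_nat_Suc)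
  from summatory_laplace[OF s0(1) this]
  have "(\<lambda>k. of_real (moebius_mu (Suc k) / real (Suc k)) * exp (- s * of_real (ln (real (Suc k)))) / s) sums laplace mu_mean s"
    by (simp add: laplace_def mu_mean_def del: of_nat_Suc)
  also have "(\<lambda>k. of_real (moebius_mu (Suc k) / real (Suc k)) * exp (- s * of_real (ln (real (Suc k)))) / s)
     = (\<lambda>k. of_real (moebius_mu (Suc k)) * dterm s (Suc k) / s)"
  proof
    fix k
    have "dterm s (Suc k) = exp (- of_real (ln (real (Suc k)))) * exp (- s * of_real (ln (real (Suc k))))"
      unfolding dterm_def exp_add[symmetric] by (simp add: algebra_simps)
    also have "exp (- complex_of_real (ln (real (Suc k)))) = of_real (1 / real (Suc k))"
      using exp_of_real[of "- ln (real (Suc k))", where ?'a = complex] by (simp add: exp_minus inverse_eq_divide)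
    finally show "of_real (moebius_mu (Suc k) / real (Suc k)) * exp (- s * of_real (ln (real (Suc k)))) / s
       = of_real (moebius_mu (Suc k)) * dterm s (Suc k) / s" by (simp del: of_nat_Suc)
  qed
  finally have "laplace mu_mean s = s / szeta s / s"
    using sums_divide[OF moebius_series(1)[OF s], of s] sums_unique2 by blast
  then show ?thesis using s0 by simp
qed

text \<open>The factor exp (- t) shifts the argument by 1. Subtracting 1 / s, the transform of the
  constant 1, removes the pole.\<close>

lemma laplace_psi_error:
  assumes s: "s \<in> strip" shows "laplace psi_error s = - ((1 + deriv szeta s / szeta s) / (1 + s))"
proof -
  have s0: "Re s > 0" "s \<noteq> 0" "Re (1 + s) > 0" "1 + s \<noteq> 0" "szeta s \<noteq> 0"
    using s moebius_series(2)[OF s] by (auto simp: strip_def complex_eq_iff)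
  from summable_mangoldt_series[OF s0(1)] have "summable (\<lambda>k. \<bar>mangoldt (Suc k) :: real\<bar> * real (Suc k) powr (- Re (1 + s)))"
    by (simp add: norm_mult norm_dterm del: of_nat_Suc)
  from summatory_laplace[OF s0(3) this]
  have "(\<lambda>k. of_real (mangoldt (Suc k)) * dterm s (Suc k) / (1 + s)) sums
     (LBINT t. of_real (summatory mangoldt t) * exp (- (1 + s) * of_real t))"
    unfolding dterm_def .
  then have I: "(LBINT t. of_real (summatory mangoldt t) * exp (- (1 + s) * of_real t)) = (1 / s - deriv szeta s / szeta s) / (1 + s)"
    using sums_divide[OF mangoldt_series[OF s], of "1 + s"] sums_unique2 by blast
  have "of_real (summatory mangoldt t) * exp (- (1 + s) * of_real t)
     = of_real (psi_error t) * exp (- s * of_real t) + indicator {0..} t *\<^sub>R exp (- s * of_real t)" for t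
  proof -
    have "exp (- (1 + s) * of_real t) = of_real (exp (- t)) * exp (- s * of_real t)"
      unfolding exp_of_real[symmetric] exp_add[symmetric] by (simp add: algebra_simps)
    then show ?thesis by (simp add: psi_error_def summatory_neg algebra_simps)
  qed
  then have "(LBINT t. of_real (summatory mangoldt t) * exp (- (1 + s) * of_real t))
    = laplace psi_error s + (LBINT t. indicator {0..} t *\<^sub>R exp (- s * of_real t))"
    unfolding laplace_def using laplace_integrable[OF subexp_psi_error s0(1)] has_integral_exp_tail(1)[OF s0(1), of 0]
    by (subst Bochner_Integration.integral_add[symmetric]) auto
  also have "(LBINT t. indicator {0..} t *\<^sub>R exp (- s * of_real t)) = 1 / s"
    using has_integral_exp_tail(2)[OF s0(1), of 0] by simp
  finally have "laplace psi_error s = (1 / s - deriv szeta s / szeta s) / (1 + s) - 1 / s"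
    unfolding I by (simp add: algebra_simps)
  also have "\<dots> = ((1 / s - deriv szeta s / szeta s) - (1 + s) / s) / (1 + s)"
    using s0 by (simp add: diff_divide_distrib)
  also have "(1 / s - deriv szeta s / szeta s) - (1 + s) / s = - (1 + deriv szeta s / szeta s)"
    using s0 by (simp add: add_divide_distrib)
  finally show ?thesis by (simp only: minus_divide_left)
qed

lemma deriv_eq_on_strip:
  assumes f: "subexp f" and eq: "\<And>s. s \<in> strip \<Longrightarrow> laplace f s = g s"
    and g: "(g has_field_derivative g') (at s)" and s: "s \<in> strip"
  shows "laplace (\<lambda>t. t * f t) s = - g'"
proof -
  have "(laplace f has_field_derivative - laplace (\<lambda>t. t * f t) s) (at s)"
    using s by (intro laplace_has_derivative f) (auto simp: strip_def)
  then have "(g has_field_derivative - laplace (\<lambda>t. t * f t) s) (at s)"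
    by (rule has_field_derivative_transform_within_open[OF _ open_strip s]) (rule eq)
  then show ?thesis using DERIV_unique[OF g] by simp
qed

lemma laplace_mu_mean2:
  assumes s: "s \<in> strip"
  shows "laplace (\<lambda>t. t * (t * mu_mean t)) s = inverse_szeta_deriv2 s"
proof -
  have nz: "szeta s \<noteq> 0" "s \<in> wide_strip" if "s \<in> strip" for s using that moebius_series(2) strip_subset_wide_strip by auto
  have 1: "laplace (\<lambda>t. t * mu_mean t) s = deriv szeta s / szeta s ^ 2" if "s \<in> strip" for s
  proof -
    have "((\<lambda>s. 1 / szeta s) has_field_derivative (0 * szeta s - 1 * deriv szeta s) / (szeta s * szeta s)) (at s)"
      using nz[OF that] by (intro derivative_intros szeta_deriv)
    from deriv_eq_on_strip[OF subexp_mu_mean laplace_mu_mean this that] show ?thesis by (simp add: power2_eq_square)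
  qed
  have "((\<lambda>s. szeta s ^ 2) has_field_derivative 2 * (deriv szeta s * szeta s)) (at s)"
    using nz[OF s] by (auto intro!: derivative_eq_intros szeta_deriv)
  then have "((\<lambda>s. deriv szeta s / szeta s ^ 2) has_field_derivative
     (deriv (deriv szeta) s * szeta s ^ 2 - deriv szeta s * (2 * (deriv szeta s * szeta s))) / (szeta s ^ 2 * szeta s ^ 2)) (at s)"
    using nz[OF s] by (intro DERIV_divide szeta_deriv2) auto
  from deriv_eq_on_strip[OF subexp_times_t[OF subexp_mu_mean] 1 this s] have "laplace (\<lambda>t. t * (t * mu_mean t)) s
    = - ((deriv (deriv szeta) s * szeta s ^ 2 - deriv szeta s * (2 * (deriv szeta s * szeta s))) / (szeta s ^ 2 * szeta s ^ 2))" .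
  also have "\<dots> = inverse_szeta_deriv2 s"
    using nz[OF s] by (simp add: inverse_szeta_deriv2_def field_simps power2_eq_square power3_eq_cube)
  finally show ?thesis .
qed

lemma laplace_psi_error1:
  assumes s: "s \<in> strip"
  shows "laplace (\<lambda>t. t * psi_error t) s =
     - (psi_transform_deriv s)"
proof -
  have nz: "szeta s \<noteq> 0" "s \<in> wide_strip" "1 + s \<noteq> 0"
    using s moebius_series(2) strip_subset_wide_strip by (auto simp: strip_def complex_eq_iff)
  have "((\<lambda>s. - ((1 + deriv szeta s / szeta s) / (1 + s))) has_field_derivative
     - (((0 + (deriv (deriv szeta) s * szeta s - deriv szeta s * deriv szeta s) / (szeta s * szeta s)) * (1 + s) - (1 + deriv szeta s / szeta s) * (0 + 1))
       / ((1 + s) * (1 + s)))) (at s)"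
    using nz by (intro derivative_intros szeta_deriv szeta_deriv2)
  from deriv_eq_on_strip[OF subexp_psi_error laplace_psi_error this s] show ?thesis
    using nz by (simp add: psi_transform_deriv_def divide_simps power2_eq_square) (simp add: algebra_simps)
qed

theorem gaussian_bounds:
  "\<exists>B\<ge>0. \<forall>\<eta> t0. 0 < \<eta> \<longrightarrow> \<eta> \<le> 1 \<longrightarrow>
     \<bar>LBINT t. (t * (t * mu_mean t)) * normal_density t0 \<eta> t\<bar> \<le> B * \<eta> powr (-2/3) \<and>
     \<bar>LBINT t. (t * psi_error t) * normal_density t0 \<eta> t\<bar> \<le> B * \<eta> powr (-2/3)"
proof -
  obtain B \<delta> where B: "B \<ge> 0" "\<delta> > 0" "\<delta> \<le> 1" "\<And>s. 0 < Re s \<Longrightarrow> Re s \<le> \<delta> \<Longrightarrow>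
     norm (inverse_szeta_deriv2 s) \<le> B * ht s powr (-1/2) \<and>
     norm (psi_transform_deriv s)
       \<le> B * ht s powr (-1/2)"
    using szeta_quotient_bounds by metis
  have b: "norm (laplace (\<lambda>t. t * (t * mu_mean t)) (Complex d y)) \<le> B * (1 + \<bar>y\<bar>) powr (-1/2)"
     "norm (laplace (\<lambda>t. t * psi_error t) (Complex d y)) \<le> B * (1 + \<bar>y\<bar>) powr (-1/2)"
    if "0 < d" "d \<le> \<delta>" for d y
  proof -
    have s: "Complex d y \<in> strip" using that B by (simp add: strip_def)
    show "norm (laplace (\<lambda>t. t * (t * mu_mean t)) (Complex d y)) \<le> B * (1 + \<bar>y\<bar>) powr (-1/2)"
     "norm (laplace (\<lambda>t. t * psi_error t) (Complex d y)) \<le> B * (1 + \<bar>y\<bar>) powr (-1/2)"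
      unfolding laplace_mu_mean2[OF s] laplace_psi_error1[OF s] norm_minus_cancel
      using B(4)[of "Complex d y"] that by (simp_all add: ht_def)
  qed
  show ?thesis
  proof (intro exI[of _ "3 * B"] conjI allI impI)
    fix \<eta> t0 :: real assume e: "0 < \<eta>" "\<eta> \<le> 1"
    show "\<bar>LBINT t. (t * (t * mu_mean t)) * normal_density t0 \<eta> t\<bar> \<le> 3 * B * \<eta> powr (-2/3)"
      by (rule laplace_gaussian_bound[OF subexp_times_t[OF subexp_times_t[OF subexp_mu_mean]] B(2) e B(1) b(1)])
    show "\<bar>LBINT t. (t * psi_error t) * normal_density t0 \<eta> t\<bar> \<le> 3 * B * \<eta> powr (-2/3)"
      by (rule laplace_gaussian_bound[OF subexp_times_t[OF subexp_psi_error] B(2) e B(1) b(2)])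
  qed (use B in simp)
qed

section \<open>Decay of the mean of the Moebius function\<close>

lemma normal_moments:
  assumes "\<eta> > 0"
  shows "has_bochner_integral lborel (\<lambda>t. (t - t0)\<^sup>2 * normal_density t0 \<eta> t) (\<eta>\<^sup>2)"
    "has_bochner_integral lborel (\<lambda>t. (t - t0) ^ 4 * normal_density t0 \<eta> t) (3 * \<eta> ^ 4)"
    "has_bochner_integral lborel (normal_density t0 \<eta>) 1"
    "has_bochner_integral lborel (\<lambda>t. t * normal_density t0 \<eta> t) t0"
proof -
  have "has_bochner_integral lborel (\<lambda>t. normal_density t0 \<eta> t * (t - t0) ^ (2 * 1)) (fact (2 * 1) / ((2 / \<eta>\<^sup>2) ^ 1 * fact 1))"
    by (rule normal_moment_even[OF assms])
  then show "has_bochner_integral lborel (\<lambda>t. (t - t0)\<^sup>2 * normal_density t0 \<eta> t) (\<eta>\<^sup>2)"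
    by (simp add: mult.commute fact_numeral)
  have "has_bochner_integral lborel (\<lambda>t. normal_density t0 \<eta> t * (t - t0) ^ (2 * 2)) (fact (2 * 2) / ((2 / \<eta>\<^sup>2) ^ 2 * fact 2))"
    by (rule normal_moment_even[OF assms])
  also have "fact (2 * 2) / ((2 / \<eta>\<^sup>2) ^ 2 * fact 2) = 3 * \<eta> ^ 4"
    by (simp add: fact_numeral power_divide)
  finally show "has_bochner_integral lborel (\<lambda>t. (t - t0) ^ 4 * normal_density t0 \<eta> t) (3 * \<eta> ^ 4)"
    by (simp add: mult.commute)
  show "has_bochner_integral lborel (normal_density t0 \<eta>) 1"
    using integrable_normal_density[OF assms] integral_normal_density[OF assms] by (simp add: has_bochner_integral_iff)
  show "has_bochner_integral lborel (\<lambda>t. t * normal_density t0 \<eta> t) t0"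
    using normal_moment_nz_1[OF assms, of t0] by (simp add: mult.commute)
qed

text \<open>The comparison functions below all have this shape: the linear part carries the mean
  value, while odd absolute powers of t - t0 are first traded for even ones, whose moments are
  explicit.\<close>

lemma normal_poly_integral:
  assumes "\<eta> > 0"
  shows "has_bochner_integral lborel
    (\<lambda>t. (a + b * t + c * (t - t0)\<^sup>2 + d * (t - t0) ^ 4) * normal_density t0 \<eta> t)
    (a + b * t0 + c * \<eta>\<^sup>2 + d * (3 * \<eta> ^ 4))"
proof -
  have "has_bochner_integral lborel
    (\<lambda>t. a * normal_density t0 \<eta> t + b * (t * normal_density t0 \<eta> t)
      + c * ((t - t0)\<^sup>2 * normal_density t0 \<eta> t) + d * ((t - t0) ^ 4 * normal_density t0 \<eta> t))
    (a * 1 + b * t0 + c * \<eta>\<^sup>2 + d * (3 * \<eta> ^ 4))"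
    using normal_moments[OF assms, of t0]
    by (intro has_bochner_integral_add has_bochner_integral_mult_right)
  then show ?thesis by (simp add: algebra_simps)
qed

lemma sum_inverse_le_ln:
  assumes "1 \<le> A" "A \<le> B"
  shows "(\<Sum>n\<in>{A<..B}. 1 / real n) \<le> ln (real B) - ln (real A)"
  using assms(2)
proof (induction B rule: dec_induct)
  case (step B)
  have "ln (real B / real (Suc B)) \<le> real B / real (Suc B) - 1"
    using step assms by (intro ln_le_minus_one) auto
  then have "1 / real (Suc B) \<le> ln (real (Suc B)) - ln (real B)"
    using step assms by (simp add: ln_div field_simps)
  moreover have "{A<..Suc B} = insert (Suc B) {A<..B}" using step by auto
  ultimately show ?case using step.IH by simp
qed simp

text \<open>The term exp (- a) pays for the first integer A + 1 beyond exp a; the later terms sum to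
  at most ln B - ln (A + 1) \<le> b - a.\<close>

lemma mu_mean_increment:
  assumes "0 \<le> a" "a \<le> b"
  shows "\<bar>mu_mean b - mu_mean a\<bar> \<le> (b - a) + exp (- a)"
proof -
  define A B where "A = nat \<lfloor>exp a\<rfloor>" and "B = nat \<lfloor>exp b\<rfloor>"
  have AB: "1 \<le> A" "A \<le> B" "real B \<le> exp b"
    using floor_exp_ge_1[OF assms(1)] floor_exp_le[of b] assms by (auto simp: A_def B_def intro!: nat_mono floor_mono)
  have A1: "exp a < real (Suc A)" unfolding A_def by linarith
  have "{1..B} = {1..A} \<union> {A<..B}" "{1..A} \<inter> {A<..B} = {}" using AB by auto
  then have "(\<Sum>n\<in>{1..B}. moebius_mu n / real n) = (\<Sum>n\<in>{1..A}. moebius_mu n / real n) + (\<Sum>n\<in>{A<..B}. moebius_mu n / real n)"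
    by (simp add: sum.union_disjoint)
  then have "mu_mean b - mu_mean a = (\<Sum>n\<in>{A<..B}. moebius_mu n / real n)"
    by (simp add: mu_mean_def summatory_def A_def B_def)
  also have "\<bar>\<dots>\<bar> \<le> (\<Sum>n\<in>{A<..B}. \<bar>moebius_mu n / real n\<bar>)" by (rule sum_abs)
  also have "\<dots> \<le> (\<Sum>n\<in>{A<..B}. 1 / real n)"
    by (intro sum_mono) (auto simp: abs_divide intro!: divide_right_mono moebius_bound)
  also have "\<dots> \<le> (b - a) + exp (- a)"
  proof (cases "A = B")
    case False
    then have "Suc A \<le> B" using AB by simp
    have "{A<..B} = insert (Suc A) {Suc A<..B}" using \<open>Suc A \<le> B\<close> by auto
    then have "(\<Sum>n\<in>{A<..B}. 1 / real n) = 1 / real (Suc A) + (\<Sum>n\<in>{Suc A<..B}. 1 / real n)" by simp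
    moreover have "(\<Sum>n\<in>{Suc A<..B}. 1 / real n) \<le> ln (real B) - ln (real (Suc A))"
      using \<open>Suc A \<le> B\<close> by (intro sum_inverse_le_ln) auto
    moreover have "ln (real B) \<le> b" using AB ln_le_cancel_iff[of "real B" "exp b"] by simp
    moreover have "a \<le> ln (real (Suc A))" using A1 ln_le_cancel_iff[of "exp a" "real (Suc A)"] by simp
    moreover have "1 / real (Suc A) \<le> exp (- a)"
      using A1 divide_left_mono[of "exp a" "real (Suc A)" 1] by (simp add: exp_minus inverse_eq_divide)
    ultimately show ?thesis by linarith
  qed (use assms in simp)
  finally show ?thesis .
qed

text \<open>A Gaussian sees all t, so the bound must be global. Where exp (- min t t0) is not small,
  or t is negative, |t - t0| is itself large enough to pay. The rest 8 / t0^2 becomes a constant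
  after multiplication by t0^2.\<close>

lemma mu_mean_diff_bound:
  assumes "t0 \<ge> 1"
  shows "\<bar>mu_mean t - mu_mean t0\<bar> \<le> 3 * \<bar>t - t0\<bar> + 8 / t0\<^sup>2"
proof (cases "t < 0")
  case True
  have "\<bar>mu_mean t0\<bar> \<le> 1 + t0" using assms by (intro mu_mean_bound) auto
  also have "\<dots> \<le> 3 * \<bar>t - t0\<bar>" using True assms by simp
  also have "\<dots> \<le> 3 * \<bar>t - t0\<bar> + 8 / t0\<^sup>2" by simp
  finally show ?thesis using True by (simp add: mu_mean_def summatory_neg)
next
  case False
  define a where "a = min t t0"
  have "\<bar>mu_mean (max t t0) - mu_mean a\<bar> \<le> (max t t0 - a) + exp (- a)"
    using False assms by (intro mu_mean_increment) (auto simp: a_def)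
  then have "\<bar>mu_mean t - mu_mean t0\<bar> \<le> \<bar>t - t0\<bar> + exp (- a)"
    by (cases "t \<le> t0") (auto simp: a_def abs_minus_commute)
  moreover have "exp (- a) \<le> 2 * \<bar>t - t0\<bar> + 8 / t0\<^sup>2"
  proof (cases "a \<ge> t0 / 2")
    case True
    have "1 + t0 / 2 + (t0 / 2)\<^sup>2 / 2 \<le> exp (t0 / 2)" using assms by (intro exp_lower_Taylor_quadratic) auto
    moreover have "(t0 / 2)\<^sup>2 / 2 = t0\<^sup>2 / 8" by (simp add: power_divide)
    ultimately have "t0\<^sup>2 / 8 \<le> exp (t0 / 2)" using assms by linarith
    then have "inverse (exp (t0 / 2)) \<le> inverse (t0\<^sup>2 / 8)" using assms by (intro le_imp_inverse_le) auto
    moreover have "exp (- a) \<le> exp (- (t0 / 2))" using True by simp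
    moreover have "exp (- (t0 / 2)) = inverse (exp (t0 / 2))" by (rule exp_minus)
    moreover have "inverse (t0\<^sup>2 / 8) = 8 / t0\<^sup>2" by (simp add: inverse_eq_divide)
    ultimately show ?thesis by (smt (verit) abs_ge_zero)
  next
    case F: False
    then have "1 \<le> 2 * \<bar>t - t0\<bar>" using assms by (auto simp: a_def)
    moreover have "exp (- a) \<le> 1" using False assms by (simp add: a_def)
    moreover have "0 \<le> 8 / t0\<^sup>2" by simp
    ultimately show ?thesis by linarith
  qed
  from add_left_mono[OF this, of "\<bar>t - t0\<bar>"] have "\<bar>t - t0\<bar> + exp (- a) \<le> 3 * \<bar>t - t0\<bar> + 8 / t0\<^sup>2" by simp
  ultimately show ?thesis by (rule order_trans)
qed

lemma abs_le_amgm: "\<eta> > 0 \<Longrightarrow> \<bar>u::real\<bar> \<le> (u\<^sup>2 / \<eta> + \<eta>) / 2"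
proof -
  assume e: "\<eta> > 0"
  have "0 \<le> (\<bar>u\<bar> - \<eta>)\<^sup>2 / \<eta>" using e by simp
  also have "\<dots> = u\<^sup>2 / \<eta> - 2 * \<bar>u\<bar> + \<eta>" using e by (simp add: power2_eq_square field_simps)
  finally show ?thesis by simp
qed

lemma abs_cube_le_amgm: "\<eta> > 0 \<Longrightarrow> \<bar>u::real\<bar> * u\<^sup>2 \<le> (u ^ 4 / \<eta> + \<eta> * u\<^sup>2) / 2"
proof -
  assume e: "\<eta> > 0"
  have "\<bar>u\<bar> * u\<^sup>2 \<le> (u\<^sup>2 / \<eta> + \<eta>) / 2 * u\<^sup>2"
    using abs_le_amgm[OF e, of u] by (intro mult_right_mono) auto
  also have "\<dots> = (u\<^sup>2 * u\<^sup>2 / \<eta> + \<eta> * u\<^sup>2) / 2" by (simp add: algebra_simps add_divide_distrib)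
  also have "u\<^sup>2 * u\<^sup>2 = u ^ 4" by (simp flip: power_add)
  finally show ?thesis .
qed

text \<open>Product rule for differences. The change of t^2 meets only the trivial bound |mu_mean
  t0| \<le> 2 t0, which is harmless: this part is of order t0^2 |u|, like the contribution of the
  change of the mean.\<close>

lemma mu_mean_weighted_diff:
  fixes t t0 \<eta> :: real
  assumes t0: "t0 \<ge> 1" and e: "0 < \<eta>"
  defines "g \<equiv> \<lambda>t. t * (t * mu_mean t)" and "u \<equiv> t - t0"
  shows "\<bar>g t - g t0\<bar> \<le> 16 + 5 * t0\<^sup>2 * (u\<^sup>2 / \<eta> + \<eta>) + 18 * t0 * u\<^sup>2 + 3 * (u ^ 4 / \<eta> + \<eta> * u\<^sup>2)"
proof -
  have "g t - g t0 = (u\<^sup>2 + 2 * t0 * u) * mu_mean t0 + t\<^sup>2 * (mu_mean t - mu_mean t0)"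
    by (simp add: g_def u_def power2_eq_square algebra_simps)
  then have "\<bar>g t - g t0\<bar> \<le> \<bar>(u\<^sup>2 + 2 * t0 * u) * mu_mean t0\<bar> + \<bar>t\<^sup>2 * (mu_mean t - mu_mean t0)\<bar>"
    by (simp only: abs_triangle_ineq)
  also have "\<dots> = \<bar>u\<^sup>2 + 2 * t0 * u\<bar> * \<bar>mu_mean t0\<bar> + t\<^sup>2 * \<bar>mu_mean t - mu_mean t0\<bar>"
    unfolding abs_mult by simp
  also have "\<dots> \<le> (u\<^sup>2 + 2 * t0 * \<bar>u\<bar>) * (2 * t0) + (2 * t0\<^sup>2 + 2 * u\<^sup>2) * (3 * \<bar>u\<bar> + 8 / t0\<^sup>2)"
  proof (intro add_mono mult_mono)
    show "\<bar>u\<^sup>2 + 2 * t0 * u\<bar> \<le> u\<^sup>2 + 2 * t0 * \<bar>u\<bar>"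
      using abs_triangle_ineq[of "u\<^sup>2" "2 * t0 * u"] t0 by (simp add: abs_mult)
    show "\<bar>mu_mean t0\<bar> \<le> 2 * t0" using mu_mean_bound[of t0] t0 by simp
    have "0 \<le> (t0 - u)\<^sup>2" by simp
    then show "t\<^sup>2 \<le> 2 * t0\<^sup>2 + 2 * u\<^sup>2" by (simp add: u_def power2_eq_square algebra_simps)
    show "\<bar>mu_mean t - mu_mean t0\<bar> \<le> 3 * \<bar>u\<bar> + 8 / t0\<^sup>2" unfolding u_def by (rule mu_mean_diff_bound[OF t0])
  qed (use t0 in auto)
  also have "\<dots> = 10 * t0\<^sup>2 * \<bar>u\<bar> + 16 + 2 * t0 * u\<^sup>2 + 6 * (\<bar>u\<bar> * u\<^sup>2) + 16 * (u\<^sup>2 / t0\<^sup>2)"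
    using t0 by (simp add: field_simps power2_eq_square)
  also have "u\<^sup>2 / t0\<^sup>2 \<le> u\<^sup>2 / 1" using t0 by (intro divide_left_mono) auto
  also have "u\<^sup>2 / 1 \<le> t0 * u\<^sup>2" using t0 mult_right_mono[of 1 t0 "u\<^sup>2"] by simp
  also have "10 * t0\<^sup>2 * \<bar>u\<bar> \<le> 10 * t0\<^sup>2 * ((u\<^sup>2 / \<eta> + \<eta>) / 2)"
    by (intro mult_left_mono abs_le_amgm e) auto
  also have "\<bar>u\<bar> * u\<^sup>2 \<le> (u ^ 4 / \<eta> + \<eta> * u\<^sup>2) / 2" by (rule abs_cube_le_amgm[OF e])
  finally show ?thesis by (simp add: algebra_simps add_divide_distrib)
qed

text \<open>The mean is Lipschitz up to negligible errors, so replacing it by its Gaussian mean costs \<open>O(\<eta>)\<close>; the choice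
  \<open>\<eta> = t powr (-6/5)\<close> balances this against the bound \<open>t powr (-2) * \<eta> powr (-2/3)\<close>.\<close>

theorem mu_mean_decay: "\<exists>C\<ge>0. \<forall>t\<ge>1. \<bar>mu_mean t\<bar> \<le> C * t powr (-6/5)"
proof -
  obtain B where B: "B \<ge> 0" "\<And>\<eta> t0. 0 < \<eta> \<Longrightarrow> \<eta> \<le> 1 \<Longrightarrow>
     \<bar>LBINT t. (t * (t * mu_mean t)) * normal_density t0 \<eta> t\<bar> \<le> B * \<eta> powr (-2/3)"
    using gaussian_bounds by metis
  \<comment> \<open>56 = 16 + 10 + 18 + 12 collects the coefficients of four terms, each at most
    \<open>t0 powr (4/5)\<close>.\<close>
  have "\<bar>mu_mean t0\<bar> \<le> (B + 56) * t0 powr (-6/5)" if t0: "t0 \<ge> 1" for t0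
  proof -
    define \<eta> where "\<eta> = t0 powr (-6/5)"
    have e: "0 < \<eta>" "\<eta> \<le> 1" using t0 powr_mono2'[of "-6/5" 1 t0] by (auto simp: \<eta>_def)
    define g where "g = (\<lambda>t. t * (t * mu_mean t))"
    define nd where "nd = normal_density t0 \<eta>"
    define J where "J = (LBINT t. g t * nd t)"
    have ig: "integrable lborel (\<lambda>t. g t * nd t)"
      unfolding g_def nd_def
      by (intro laplace_gaussian_integrable subexp_times_t subexp_mu_mean e)
    have hb1: "has_bochner_integral lborel (\<lambda>t. g t0 * nd t) (g t0 * 1)"
      unfolding nd_def by (intro has_bochner_integral_mult_right normal_moments(3) e)
    define q where "q = (\<lambda>t. (16 + 5 * t0\<^sup>2 * \<eta>) + 0 * t + (5 * t0\<^sup>2 / \<eta> + 18 * t0 + 3 * \<eta>) * (t - t0)\<^sup>2 + (3 / \<eta>) * (t - t0) ^ 4)"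
    have hq: "has_bochner_integral lborel (\<lambda>t. q t * nd t)
        ((16 + 5 * t0\<^sup>2 * \<eta>) + 0 * t0 + (5 * t0\<^sup>2 / \<eta> + 18 * t0 + 3 * \<eta>) * \<eta>\<^sup>2 + (3 / \<eta>) * (3 * \<eta> ^ 4))"
      unfolding q_def nd_def by (rule normal_poly_integral[OF e(1)])
    have "\<bar>J - g t0\<bar> = \<bar>LBINT t. g t * nd t - g t0 * nd t\<bar>"
      unfolding J_def using ig hb1 by (subst Bochner_Integration.integral_diff) (auto simp: has_bochner_integral_iff)
    also have "\<dots> \<le> (LBINT t. q t * nd t)"
    proof (rule integral_abs_bound_integral)
      fix t
      have "\<bar>g t * nd t - g t0 * nd t\<bar> = \<bar>g t - g t0\<bar> * nd t"
        by (simp add: nd_def abs_mult flip: left_diff_distrib)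
      also have "\<dots> \<le> q t * nd t"
      proof (rule mult_right_mono)
        show "\<bar>g t - g t0\<bar> \<le> q t"
          using mu_mean_weighted_diff[OF t0 e(1), of t] by (simp add: g_def q_def algebra_simps)
      qed (simp add: nd_def)
      finally show "\<bar>g t * nd t - g t0 * nd t\<bar> \<le> q t * nd t" .
    qed (use ig hb1 hq in \<open>auto simp: has_bochner_integral_iff\<close>)
    also have "\<dots> = (16 + 5 * t0\<^sup>2 * \<eta>) + 0 * t0 + (5 * t0\<^sup>2 / \<eta> + 18 * t0 + 3 * \<eta>) * \<eta>\<^sup>2 + (3 / \<eta>) * (3 * \<eta> ^ 4)"
      using hq by (simp only: has_bochner_integral_iff)
    also have "\<dots> = 16 + 10 * (t0\<^sup>2 * \<eta>) + 18 * (t0 * \<eta>\<^sup>2) + 12 * \<eta> ^ 3"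
      using e by (simp add: field_simps eval_nat_numeral)
    finally have "\<bar>J - g t0\<bar> \<le> 16 + 10 * (t0\<^sup>2 * \<eta>) + 18 * (t0 * \<eta>\<^sup>2) + 12 * \<eta> ^ 3" .
    moreover have "\<bar>J\<bar> \<le> B * t0 powr (4/5)"
    proof -
      have "\<eta> powr (-2/3) = t0 powr (4/5)" by (simp add: \<eta>_def powr_powr)
      then show ?thesis using B(2)[OF e, of t0] by (simp add: J_def g_def nd_def)
    qed
    moreover have "t0 * \<eta>\<^sup>2 \<le> t0\<^sup>2 * \<eta>"
      using t0 e mult_mono[of t0 "t0\<^sup>2" "\<eta>\<^sup>2" \<eta>] by (simp add: power2_eq_square mult_le_cancel_left1 mult_left_le)
    moreover have "\<eta> ^ 3 \<le> t0\<^sup>2 * \<eta>"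
    proof -
      have "\<eta> ^ 3 = \<eta>\<^sup>2 * \<eta>" by (simp add: eval_nat_numeral)
      also have "\<dots> \<le> t0\<^sup>2 * \<eta>" using e t0 by (intro mult_right_mono power_mono) auto
      finally show ?thesis .
    qed

    moreover have "t0\<^sup>2 * \<eta> = t0 powr (4/5)"
    proof -
      have "t0\<^sup>2 * \<eta> = t0 powr 2 * t0 powr (-6/5)" using t0 by (simp add: \<eta>_def)
      also have "\<dots> = t0 powr (4/5)" unfolding powr_add[symmetric] by simp
      finally show ?thesis .
    qed
    moreover have "1 \<le> t0 powr (4/5)" using t0 by (intro ge_one_powr_ge_zero) auto
    ultimately have "\<bar>g t0\<bar> \<le> B * t0 powr (4/5) + 56 * t0 powr (4/5)" by linarith
    also have "\<bar>g t0\<bar> = t0\<^sup>2 * \<bar>mu_mean t0\<bar>" using t0 by (simp add: g_def abs_mult power2_eq_square)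
    finally have "t0\<^sup>2 * \<bar>mu_mean t0\<bar> \<le> (B + 56) * t0 powr (4/5)" by (simp add: algebra_simps)
    also have "t0 powr (4/5) = t0\<^sup>2 * t0 powr (-6/5)"
      using \<open>t0\<^sup>2 * \<eta> = t0 powr (4/5)\<close> by (simp add: \<eta>_def)
    finally have "t0\<^sup>2 * \<bar>mu_mean t0\<bar> \<le> t0\<^sup>2 * ((B + 56) * t0 powr (-6/5))" by (simp add: mult_ac)
    then show ?thesis using t0 by (simp add: mult_le_cancel_left)
  qed
  then show ?thesis using B(1) by (intro exI[of _ "B + 56"]) auto
qed

section \<open>The prime number theorem\<close>

definition psi_ratio :: "real \<Rightarrow> real" where
  "psi_ratio t = summatory mangoldt t * exp (- t)"

lemma psi_ratio_nonneg: "psi_ratio t \<ge> 0"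
  by (auto simp: psi_ratio_def summatory_def intro!: mult_nonneg_nonneg sum_nonneg mangoldt_nonneg)

lemma psi_ratio_neg: "t < 0 \<Longrightarrow> psi_ratio t = 0"
  by (simp add: psi_ratio_def summatory_neg)

lemma psi_ratio_le: "t \<ge> 0 \<Longrightarrow> psi_ratio t \<le> t"
proof -
  assume "t \<ge> 0"
  then have "summatory mangoldt t * exp (- t) \<le> t * exp t * exp (- t)"
    using summatory_mangoldt_bound by (intro mult_right_mono) auto
  also have "t * exp t * exp (- t) = t" by (simp add: exp_minus)
  finally show ?thesis by (simp add: psi_ratio_def)
qed

text \<open>The Tauberian condition: as \<psi> increases, the ratio can drop by at most the factor
  exp (- d) over a distance d.\<close>

lemma psi_ratio_mono:
  assumes "s \<le> t" shows "psi_ratio s * exp (s - t) \<le> psi_ratio t"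
proof -
  have "summatory mangoldt s \<le> summatory mangoldt t"
    unfolding summatory_def using assms
    by (intro sum_mono2) (auto simp: mangoldt_nonneg intro: order_trans nat_mono floor_mono)
  then have "summatory mangoldt s * exp (- t) \<le> summatory mangoldt t * exp (- t)"
    by (intro mult_right_mono) auto
  then show ?thesis by (simp add: psi_ratio_def mult.assoc flip: exp_add)
qed

definition psi_smooth :: "real \<Rightarrow> real \<Rightarrow> real" where
  "psi_smooth \<eta> t0 = (LBINT t. t * psi_ratio t * normal_density t0 \<eta> t)"

text \<open>The weight \<open>max t 0\<close> is t times the constant 1 that
  \<open>psi_error\<close> subtracts for t \<ge> 0 only.\<close>

lemma psi_smooth_integrable:
  assumes "\<eta> > 0"
  shows "integrable lborel (\<lambda>t. t * psi_ratio t * normal_density t0 \<eta> t)"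
    "integrable lborel (\<lambda>t. max t 0 * normal_density t0 \<eta> t)"
    "psi_smooth \<eta> t0 = (LBINT t. (t * psi_error t) * normal_density t0 \<eta> t) + (LBINT t. max t 0 * normal_density t0 \<eta> t)"
proof -
  have 1: "integrable lborel (\<lambda>t. (t * psi_error t) * normal_density t0 \<eta> t)"
    by (intro laplace_gaussian_integrable subexp_times_t subexp_psi_error assms)
  have "integrable lborel (\<lambda>t. t * normal_density t0 \<eta> t)"
    using normal_moments(4)[OF assms] by (simp add: has_bochner_integral_iff)
  then show 2: "integrable lborel (\<lambda>t. max t 0 * normal_density t0 \<eta> t)"
    by (rule Bochner_Integration.integrable_bound) (auto intro!: AE_I2 simp: abs_mult mult_right_mono)
  have eq: "t * psi_ratio t * normal_density t0 \<eta> t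
     = (t * psi_error t) * normal_density t0 \<eta> t + max t 0 * normal_density t0 \<eta> t" for t
    by (cases "t < 0") (auto simp: psi_error_def psi_ratio_def summatory_neg algebra_simps)
  show "integrable lborel (\<lambda>t. t * psi_ratio t * normal_density t0 \<eta> t)"
    unfolding eq by (intro Bochner_Integration.integrable_add 1 2)
  show "psi_smooth \<eta> t0 = (LBINT t. (t * psi_error t) * normal_density t0 \<eta> t) + (LBINT t. max t 0 * normal_density t0 \<eta> t)"
    unfolding psi_smooth_def eq by (intro Bochner_Integration.integral_add 1 2)
qed

text \<open>As t0 \<ge> 0, the function \<open>max t 0\<close> lies between t and t + |t - t0|, so
  its Gaussian mean lies between t0 and t0 + \<eta>.\<close>

lemma psi_smooth_approx:
  "\<exists>B\<ge>0. \<forall>\<eta> t0. 0 < \<eta> \<longrightarrow> \<eta> \<le> 1 \<longrightarrow> 0 \<le> t0 \<longrightarrow> \<bar>psi_smooth \<eta> t0 - t0\<bar> \<le> B * \<eta> powr (-2/3) + \<eta>"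
proof -
  obtain B where B: "B \<ge> 0" "\<And>\<eta> t0. 0 < \<eta> \<Longrightarrow> \<eta> \<le> 1 \<Longrightarrow>
     \<bar>LBINT t. (t * psi_error t) * normal_density t0 \<eta> t\<bar> \<le> B * \<eta> powr (-2/3)"
    using gaussian_bounds by metis
  have "\<bar>psi_smooth \<eta> t0 - t0\<bar> \<le> B * \<eta> powr (-2/3) + \<eta>" if e: "0 < \<eta>" "\<eta> \<le> 1" "0 \<le> t0" for \<eta> t0
  proof -
    define A where "A = (LBINT t. max t 0 * normal_density t0 \<eta> t)"
    have "t0 \<le> A"
    proof -
      have "t0 = (LBINT t. t * normal_density t0 \<eta> t)"
        using normal_moments(4)[OF e(1)] by (simp add: has_bochner_integral_iff)
      also have "\<dots> \<le> A" unfolding A_def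
        using normal_moments(4)[OF e(1)] psi_smooth_integrable(2)[OF e(1)]
        by (intro Bochner_Integration.integral_mono mult_right_mono) (auto simp: has_bochner_integral_iff)
      finally show ?thesis .
    qed
    moreover have "A \<le> t0 + \<eta>"
    proof -
      define q where "q = (\<lambda>t. \<eta> / 2 + 1 * t + 1 / (2 * \<eta>) * (t - t0)\<^sup>2 + 0 * (t - t0) ^ 4)"
      have hb: "has_bochner_integral lborel (\<lambda>t. q t * normal_density t0 \<eta> t)
        (\<eta> / 2 + 1 * t0 + 1 / (2 * \<eta>) * \<eta>\<^sup>2 + 0 * (3 * \<eta> ^ 4))"
        unfolding q_def by (rule normal_poly_integral[OF e(1)])
      have "A \<le> (LBINT t. q t * normal_density t0 \<eta> t)"
        unfolding A_def
      proof (rule Bochner_Integration.integral_mono)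
        fix t
        have "max t 0 \<le> t + \<bar>t - t0\<bar>" using e by auto
        also have "\<bar>t - t0\<bar> \<le> ((t - t0)\<^sup>2 / \<eta> + \<eta>) / 2" by (rule abs_le_amgm[OF e(1)])
        finally have "max t 0 \<le> q t"
          by (simp add: q_def add_divide_distrib algebra_simps)
        then show "max t 0 * normal_density t0 \<eta> t \<le> q t * normal_density t0 \<eta> t"
          by (intro mult_right_mono) auto
      qed (use hb psi_smooth_integrable(2)[OF e(1)] in \<open>auto simp: has_bochner_integral_iff\<close>)
      also have "\<dots> = \<eta> / 2 + 1 * t0 + 1 / (2 * \<eta>) * \<eta>\<^sup>2 + 0 * (3 * \<eta> ^ 4)"
        using hb by (simp only: has_bochner_integral_iff)
      also have "\<dots> = t0 + \<eta>" using e by (simp add: power2_eq_square)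
      finally show ?thesis .
    qed
    ultimately show ?thesis
      using B(2)[OF e(1,2), of t0] psi_smooth_integrable(3)[OF e(1), of t0] by (simp add: A_def)
  qed
  then show ?thesis using B(1) by blast
qed

text \<open>The quadratic \<open>1 - u\<^sup>2 / \<eta>\<close> is a minorant of the indicator of \<open>|u| \<le> sqrt \<eta>\<close> with computable Gaussian mean.\<close>

lemma psi_ratio_upper:
  "\<exists>B\<ge>0. \<forall>\<eta> s. 0 < \<eta> \<longrightarrow> \<eta> < 1 \<longrightarrow> 0 < s \<longrightarrow>
     psi_ratio s \<le> (1 + (sqrt \<eta> + B * \<eta> powr (-2/3) + \<eta>) / s) * exp (2 * sqrt \<eta>) / (1 - \<eta>)"
proof -
  obtain B where B: "B \<ge> 0" "\<And>\<eta> t0. 0 < \<eta> \<Longrightarrow> \<eta> \<le> 1 \<Longrightarrow> 0 \<le> t0 \<Longrightarrow>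
     \<bar>psi_smooth \<eta> t0 - t0\<bar> \<le> B * \<eta> powr (-2/3) + \<eta>"
    using psi_smooth_approx by metis
  have "psi_ratio s \<le> (1 + (sqrt \<eta> + B * \<eta> powr (-2/3) + \<eta>) / s) * exp (2 * sqrt \<eta>) / (1 - \<eta>)"
    if e: "0 < \<eta>" "\<eta> < 1" "0 < s" for \<eta> s
  proof -
    \<comment> \<open>The window |t - t0| \<le> r is [s, s + 2 r], to the right of s, where the
      ratio is at least \<open>psi_ratio s * exp (- (2 * r))\<close>. Its radius sqrt \<eta> far
      exceeds the deviation \<eta>, so the quadratic loses only \<eta>^2 / \<eta> = \<eta>.\<close>
    define r t0 where "r = sqrt \<eta>" and "t0 = s + r"
    have r: "r > 0" "r\<^sup>2 = \<eta>" using e by (auto simp: r_def)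
    define Y where "Y = s * psi_ratio s * exp (- (2 * r))"
    have Y0: "Y \<ge> 0" using e psi_ratio_nonneg by (simp add: Y_def)
    define q where "q = (\<lambda>t. Y + 0 * t + (- Y / \<eta>) * (t - t0)\<^sup>2 + 0 * (t - t0) ^ 4)"
    have hb: "has_bochner_integral lborel (\<lambda>t. q t * normal_density t0 \<eta> t)
      (Y + 0 * t0 + (- Y / \<eta>) * \<eta>\<^sup>2 + 0 * (3 * \<eta> ^ 4))"
      unfolding q_def by (rule normal_poly_integral[OF e(1)])
    have "Y * (1 - \<eta>) = Y + 0 * t0 + (- Y / \<eta>) * \<eta>\<^sup>2 + 0 * (3 * \<eta> ^ 4)"
      using e by (simp add: power2_eq_square algebra_simps)
    also have "\<dots> = (LBINT t. q t * normal_density t0 \<eta> t)"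
      using hb by (simp only: has_bochner_integral_iff)
    also have "\<dots> \<le> psi_smooth \<eta> t0" unfolding psi_smooth_def
    proof (rule Bochner_Integration.integral_mono)
      fix t
      have "Y * (1 - (t - t0)\<^sup>2 / \<eta>) \<le> t * psi_ratio t"
      proof (cases "\<bar>t - t0\<bar> \<le> r")
        case True
        then have t: "s \<le> t" "t \<le> s + 2 * r" by (auto simp: t0_def abs_le_iff)
        have "Y * (1 - (t - t0)\<^sup>2 / \<eta>) \<le> Y * 1" using e Y0 by (intro mult_left_mono) auto
        also have "\<dots> = s * (psi_ratio s * exp (- (2 * r)))" by (simp add: Y_def)
        also have "\<dots> \<le> s * (psi_ratio s * exp (s - t))"
          using t e psi_ratio_nonneg by (intro mult_left_mono) auto
        also have "\<dots> \<le> t * psi_ratio t"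
          using psi_ratio_mono[OF t(1)] t e psi_ratio_nonneg by (intro mult_mono) auto
        finally show ?thesis .
      next
        case False
        then have "r\<^sup>2 \<le> \<bar>t - t0\<bar>\<^sup>2" using r by (intro power_mono) auto
        then have "1 \<le> (t - t0)\<^sup>2 / \<eta>" using r e by (simp add: field_simps)
        then have "Y * (1 - (t - t0)\<^sup>2 / \<eta>) \<le> 0" using Y0 by (intro mult_nonneg_nonpos) auto
        also have "0 \<le> t * psi_ratio t"
          using psi_ratio_nonneg psi_ratio_neg by (cases "t < 0") auto
        finally show ?thesis .
      qed
      then have "q t \<le> t * psi_ratio t"
        by (simp add: q_def algebra_simps)
      then show "q t * normal_density t0 \<eta> t
         \<le> t * psi_ratio t * normal_density t0 \<eta> t"
        by (intro mult_right_mono) auto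
    qed (use hb psi_smooth_integrable(1)[OF e(1)] in \<open>auto simp: has_bochner_integral_iff\<close>)
    also have "\<dots> \<le> s + (r + B * \<eta> powr (-2/3) + \<eta>)"
      using B(2)[of \<eta> t0] e r by (simp add: t0_def abs_le_iff)
    finally have "s * psi_ratio s * (exp (- (2 * r)) * (1 - \<eta>)) \<le> s + (r + B * \<eta> powr (-2/3) + \<eta>)"
      by (simp add: Y_def mult_ac)
    then have "psi_ratio s * (exp (- (2 * r)) * (1 - \<eta>)) \<le> 1 + (r + B * \<eta> powr (-2/3) + \<eta>) / s"
      using e by (simp add: field_simps)
    then show ?thesis using e by (simp add: r_def exp_minus field_simps)
  qed
  then show ?thesis using B(1) by blast
qed

text \<open>Chebyshev's bound \<psi>(x) = O(x), from the upper estimate at the fixed value \<eta> =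
  1/2. It controls the Gaussian tails in the lower estimate.\<close>

lemma psi_ratio_bounded: "\<exists>M\<ge>1. \<forall>t. psi_ratio t \<le> M"
proof -
  obtain B where B: "B \<ge> 0" "\<And>\<eta> s. 0 < \<eta> \<Longrightarrow> \<eta> < 1 \<Longrightarrow> 0 < s \<Longrightarrow>
     psi_ratio s \<le> (1 + (sqrt \<eta> + B * \<eta> powr (-2/3) + \<eta>) / s) * exp (2 * sqrt \<eta>) / (1 - \<eta>)"
    using psi_ratio_upper by metis
  define K where "K = sqrt (1/2) + B * (1/2) powr (-2/3) + (1/2 :: real)"
  define M where "M = max 1 ((1 + K) * exp (2 * sqrt (1/2)) / (1/2))"
  have K: "K \<ge> 0" using B by (simp add: K_def)
  have "psi_ratio t \<le> M" for t
  proof (cases "t \<ge> 1")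
    case True
    have "psi_ratio t \<le> (1 + K / t) * exp (2 * sqrt (1/2)) / (1/2)"
      using B(2)[of "1/2" t] True by (simp add: K_def)
    also have "\<dots> \<le> (1 + K) * exp (2 * sqrt (1/2)) / (1/2)"
    proof -
      have "K / t \<le> K / 1" using K True by (intro divide_left_mono) auto
      then show ?thesis by (intro divide_right_mono mult_right_mono) auto
    qed
    finally show ?thesis by (simp add: M_def)
  next
    case False
    then show ?thesis using psi_ratio_le[of t] psi_ratio_neg[of t] by (cases "t < 0") (auto simp: M_def)
  qed
  then show ?thesis by (intro exI[of _ M]) (auto simp: M_def)
qed

text \<open>Mirror image of the upper estimate, with the window [s - 2 r, s]. A majorant now has to
  cover the tails as well: there t psi_ratio t is at most M (t0 + |u|), and the factor u^2 / \<eta>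
  \<ge> 1 turns this into a polynomial.\<close>

lemma psi_ratio_lower:
  "\<exists>B\<ge>0. \<exists>M\<ge>1. \<forall>\<eta> s. 0 < \<eta> \<longrightarrow> \<eta> \<le> 1 \<longrightarrow> 1 < s \<longrightarrow>
     exp (- (2 * sqrt \<eta>)) * ((1 - M * \<eta>) - (1 + B * \<eta> powr (-2/3) + \<eta> + 2 * M * \<eta>\<^sup>2) / s) \<le> psi_ratio s"
proof -
  obtain B where B: "B \<ge> 0" "\<And>\<eta> t0. 0 < \<eta> \<Longrightarrow> \<eta> \<le> 1 \<Longrightarrow> 0 \<le> t0 \<Longrightarrow>
     \<bar>psi_smooth \<eta> t0 - t0\<bar> \<le> B * \<eta> powr (-2/3) + \<eta>"
    using psi_smooth_approx by metis
  obtain M where M: "M \<ge> 1" "\<And>t. psi_ratio t \<le> M" using psi_ratio_bounded by metis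
  have "exp (- (2 * sqrt \<eta>)) * ((1 - M * \<eta>) - (1 + B * \<eta> powr (-2/3) + \<eta> + 2 * M * \<eta>\<^sup>2) / s) \<le> psi_ratio s"
    if e: "0 < \<eta>" "\<eta> \<le> 1" "1 < s" for \<eta> s
  proof -
    define r t0 where "r = sqrt \<eta>" and "t0 = s - r"
    have r: "r > 0" "r\<^sup>2 = \<eta>" "r \<le> 1" using e by (auto simp: r_def)
    have t0: "t0 \<ge> 0" "t0 \<le> s" using e r by (auto simp: t0_def)
    define Y where "Y = s * psi_ratio s * exp (2 * r)"
    have Y0: "Y \<ge> 0" using e psi_ratio_nonneg by (simp add: Y_def)
    define q where "q = (\<lambda>t. Y + 0 * t + (M * t0 / \<eta> + M / 2) * (t - t0)\<^sup>2 + M / (2 * \<eta>\<^sup>2) * (t - t0) ^ 4)"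
    have hb: "has_bochner_integral lborel (\<lambda>t. q t * normal_density t0 \<eta> t)
      (Y + 0 * t0 + (M * t0 / \<eta> + M / 2) * \<eta>\<^sup>2 + M / (2 * \<eta>\<^sup>2) * (3 * \<eta> ^ 4))"
      unfolding q_def by (rule normal_poly_integral[OF e(1)])
    have "psi_smooth \<eta> t0 \<le> (LBINT t. q t * normal_density t0 \<eta> t)"
      unfolding psi_smooth_def
    proof (rule Bochner_Integration.integral_mono)
      fix t
      define u where "u = t - t0"
      have "t * psi_ratio t \<le> Y + (M * t0 / \<eta> + M / 2) * u\<^sup>2 + M / (2 * \<eta>\<^sup>2) * u ^ 4"
      proof (cases "\<bar>u\<bar> \<le> r")
        case True
        then have t: "t \<le> s" "s - 2 * r \<le> t" by (auto simp: t0_def u_def abs_le_iff)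
        have "t * psi_ratio t \<le> Y"
        proof (cases "t < 0")
          case False
          have "psi_ratio t * exp (- (2 * r)) \<le> psi_ratio t * exp (t - s)"
            using t psi_ratio_nonneg by (intro mult_left_mono) auto
          also have "\<dots> \<le> psi_ratio s" by (rule psi_ratio_mono[OF t(1)])
          finally have "psi_ratio t \<le> psi_ratio s * exp (2 * r)" by (simp add: exp_minus field_simps)
          then have "t * psi_ratio t \<le> s * (psi_ratio s * exp (2 * r))"
            using t False psi_ratio_nonneg by (intro mult_mono) auto
          then show ?thesis by (simp add: Y_def)
        qed (use Y0 psi_ratio_neg in simp)
        moreover have "0 \<le> (M * t0 / \<eta> + M / 2) * u\<^sup>2 + M / (2 * \<eta>\<^sup>2) * u ^ 4"
          using M t0 e by (intro add_nonneg_nonneg mult_nonneg_nonneg) auto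
        ultimately show ?thesis by linarith
      next
        case False
        then have "r\<^sup>2 \<le> \<bar>u\<bar>\<^sup>2" using r by (intro power_mono) auto
        then have u1: "1 \<le> u\<^sup>2 / \<eta>" using r e by (simp add: field_simps)
        have "t * psi_ratio t \<le> (t0 + \<bar>u\<bar>) * M"
          using M psi_ratio_nonneg t0 by (intro mult_mono) (auto simp: u_def)
        also have "\<dots> \<le> (t0 + \<bar>u\<bar>) * M * (u\<^sup>2 / \<eta>)"
          using u1 M t0 mult_left_mono[OF u1, of "(t0 + \<bar>u\<bar>) * M"] by simp
        also have "\<dots> = M * t0 / \<eta> * u\<^sup>2 + M / \<eta> * (\<bar>u\<bar> * u\<^sup>2)" by (simp add: algebra_simps add_divide_distrib)
        also have "\<dots> \<le> M * t0 / \<eta> * u\<^sup>2 + M / \<eta> * ((u ^ 4 / \<eta> + \<eta> * u\<^sup>2) / 2)"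
          using M e by (intro add_left_mono mult_left_mono abs_cube_le_amgm) auto
        also have "\<dots> = (M * t0 / \<eta> + M / 2) * u\<^sup>2 + M / (2 * \<eta>\<^sup>2) * u ^ 4"
          using e by (simp add: field_simps power2_eq_square)
        finally show ?thesis using Y0 by linarith
      qed
      then have "t * psi_ratio t \<le> q t"
        by (simp add: q_def u_def)
      then show "t * psi_ratio t * normal_density t0 \<eta> t
         \<le> q t * normal_density t0 \<eta> t"
        by (intro mult_right_mono) auto
    qed (use hb psi_smooth_integrable(1)[OF e(1)] in \<open>auto simp: has_bochner_integral_iff\<close>)
    also have "\<dots> = Y + 0 * t0 + (M * t0 / \<eta> + M / 2) * \<eta>\<^sup>2 + M / (2 * \<eta>\<^sup>2) * (3 * \<eta> ^ 4)"
      using hb by (simp only: has_bochner_integral_iff)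
    also have "\<dots> = Y + M * t0 * \<eta> + 2 * M * \<eta>\<^sup>2"
      using e by (simp add: field_simps eval_nat_numeral)
    also have "M * t0 * \<eta> \<le> M * s * \<eta>" using M e t0 by (intro mult_right_mono mult_left_mono) auto
    finally have "t0 - (B * \<eta> powr (-2/3) + \<eta>) \<le> Y + M * s * \<eta> + 2 * M * \<eta>\<^sup>2"
      using B(2)[of \<eta> t0] e t0 by (simp add: abs_le_iff)
    moreover have "s - 1 \<le> t0" using r by (simp add: t0_def)
    ultimately have "s * (1 - M * \<eta>) - (1 + B * \<eta> powr (-2/3) + \<eta> + 2 * M * \<eta>\<^sup>2) \<le> s * (psi_ratio s * exp (2 * r))"
      by (simp add: Y_def algebra_simps)
    then have "(s * (1 - M * \<eta>) - (1 + B * \<eta> powr (-2/3) + \<eta> + 2 * M * \<eta>\<^sup>2)) / s \<le> psi_ratio s * exp (2 * r)"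
      using e by (simp add: divide_le_eq mult.commute)
    then have "(1 - M * \<eta>) - (1 + B * \<eta> powr (-2/3) + \<eta> + 2 * M * \<eta>\<^sup>2) / s \<le> psi_ratio s * exp (2 * r)"
      using e by (simp add: diff_divide_distrib)
    then have "exp (- (2 * r)) * ((1 - M * \<eta>) - (1 + B * \<eta> powr (-2/3) + \<eta> + 2 * M * \<eta>\<^sup>2) / s)
      \<le> exp (- (2 * r)) * (psi_ratio s * exp (2 * r))"
      by (intro mult_left_mono) auto
    also have "\<dots> = psi_ratio s" by (simp add: exp_minus)
    finally show ?thesis by (simp add: r_def)
  qed
  then show ?thesis using B(1) M(1) by blast
qed

text \<open>For fixed \<eta> the terms divided by s disappear as s grows, and what remains tends to
  1 as \<eta> tends to 0. So \<eta> is fixed before s.\<close>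

theorem psi_ratio_tendsto: "(psi_ratio \<longlongrightarrow> 1) at_top"
proof (rule order_tendstoI)
  fix a :: real assume a: "a > 1"
  obtain B where B: "\<And>\<eta> s. 0 < \<eta> \<Longrightarrow> \<eta> < 1 \<Longrightarrow> 0 < s \<Longrightarrow>
     psi_ratio s \<le> (1 + (sqrt \<eta> + B * \<eta> powr (-2/3) + \<eta>) / s) * exp (2 * sqrt \<eta>) / (1 - \<eta>)"
    using psi_ratio_upper by metis
  have "((\<lambda>\<eta>::real. exp (2 * sqrt \<eta>) / (1 - \<eta>)) \<longlongrightarrow> 1) (at_right 0)" by real_asymp
  then have "eventually (\<lambda>\<eta>::real. exp (2 * sqrt \<eta>) / (1 - \<eta>) < a) (at_right 0)" using a by (rule order_tendstoD)
  moreover have "eventually (\<lambda>\<eta>::real. 0 < \<eta> \<and> \<eta> < 1) (at_right 0)" by (auto simp: eventually_at_right_field intro!: exI[of _ 1])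
  ultimately have "eventually (\<lambda>\<eta>::real. exp (2 * sqrt \<eta>) / (1 - \<eta>) < a \<and> 0 < \<eta> \<and> \<eta> < 1) (at_right 0)" by eventually_elim simp
  then obtain \<eta> :: real where e: "exp (2 * sqrt \<eta>) / (1 - \<eta>) < a" "0 < \<eta>" "\<eta> < 1"
    using eventually_happens'[OF trivial_limit_at_right_real] by blast
  define K L where "K = sqrt \<eta> + B * \<eta> powr (-2/3) + \<eta>" and "L = exp (2 * sqrt \<eta>) / (1 - \<eta>)"
  have "((\<lambda>s. (1 + K / s) * L) \<longlongrightarrow> (1 + 0) * L) at_top"
    by (intro tendsto_intros tendsto_divide_0[OF tendsto_const] filterlim_at_top_imp_at_infinity filterlim_ident)
  then have "eventually (\<lambda>s. (1 + K / s) * L < a) at_top"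
    by (rule order_tendstoD) (use e in \<open>simp add: L_def\<close>)
  then show "eventually (\<lambda>s. psi_ratio s < a) at_top"
    using eventually_gt_at_top[of 0]
  proof eventually_elim
    case (elim s)
    then show ?case using B[OF e(2,3), of s] by (simp add: K_def L_def)
  qed
next
  fix a :: real assume a: "a < 1"
  obtain B M where B: "\<And>\<eta> s. 0 < \<eta> \<Longrightarrow> \<eta> \<le> 1 \<Longrightarrow> 1 < s \<Longrightarrow>
     exp (- (2 * sqrt \<eta>)) * ((1 - M * \<eta>) - (1 + B * \<eta> powr (-2/3) + \<eta> + 2 * M * \<eta>\<^sup>2) / s) \<le> psi_ratio s"
    using psi_ratio_lower by metis
  have "((\<lambda>\<eta>::real. exp (- (2 * sqrt \<eta>)) * (1 - M * \<eta>)) \<longlongrightarrow> exp (- (2 * sqrt 0)) * (1 - M * 0)) (at_right 0)"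
    by (intro tendsto_intros)
  then have "eventually (\<lambda>\<eta>::real. a < exp (- (2 * sqrt \<eta>)) * (1 - M * \<eta>)) (at_right 0)"
    by (rule order_tendstoD) (use a in simp)
  moreover have "eventually (\<lambda>\<eta>::real. 0 < \<eta> \<and> \<eta> < 1) (at_right 0)" by (auto simp: eventually_at_right_field intro!: exI[of _ 1])
  ultimately have "eventually (\<lambda>\<eta>::real. a < exp (- (2 * sqrt \<eta>)) * (1 - M * \<eta>) \<and> 0 < \<eta> \<and> \<eta> < 1) (at_right 0)" by eventually_elim simp
  then obtain \<eta> :: real where e: "a < exp (- (2 * sqrt \<eta>)) * (1 - M * \<eta>)" "0 < \<eta>" "\<eta> < 1"
    using eventually_happens'[OF trivial_limit_at_right_real] by blast
  define K where "K = 1 + B * \<eta> powr (-2/3) + \<eta> + 2 * M * \<eta>\<^sup>2"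
  have "((\<lambda>s. exp (- (2 * sqrt \<eta>)) * ((1 - M * \<eta>) - K / s)) \<longlongrightarrow> exp (- (2 * sqrt \<eta>)) * ((1 - M * \<eta>) - 0)) at_top"
    by (intro tendsto_intros tendsto_divide_0[OF tendsto_const] filterlim_at_top_imp_at_infinity filterlim_ident)
  then have "eventually (\<lambda>s. a < exp (- (2 * sqrt \<eta>)) * ((1 - M * \<eta>) - K / s)) at_top"
    by (rule order_tendstoD) (use e in simp)
  then show "eventually (\<lambda>s. a < psi_ratio s) at_top"
    using eventually_gt_at_top[of 1]
  proof eventually_elim
    case (elim s)
    have "exp (- (2 * sqrt \<eta>)) * ((1 - M * \<eta>) - K / s) \<le> psi_ratio s"
      using B[of \<eta> s] e elim by (simp add: K_def)
    then show ?case using elim by linarith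
  qed
qed

lemma psi_tendsto: "((\<lambda>x. summatory mangoldt (ln x) / x) \<longlongrightarrow> 1) at_top"
proof -
  have "((\<lambda>x. psi_ratio (ln x)) \<longlongrightarrow> 1) at_top"
    by (rule filterlim_compose[OF psi_ratio_tendsto ln_at_top])
  moreover have "eventually (\<lambda>x. psi_ratio (ln x) = summatory mangoldt (ln x) / x) at_top"
    using eventually_gt_at_top[of 0]
    by eventually_elim (simp add: psi_ratio_def exp_minus divide_inverse)
  ultimately show ?thesis by (rule Lim_transform_eventually)
qed

section \<open>From \<psi> to the counting of primes\<close>

lemma finite_primes_le: "finite {p::nat. prime p \<and> real p \<le> x}"
  by (rule finite_subset[of _ "{..nat \<lfloor>x\<rfloor>}"]) (auto simp: le_nat_floor)

lemma summatory_ln: "x > 0 \<Longrightarrow> summatory a (ln x) = (\<Sum>n\<in>{1..nat \<lfloor>x\<rfloor>}. a n)"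
  by (simp add: summatory_def)

text \<open>Grouped by their prime, the powers of p up to x contribute floor (ln x / ln p) ln p
  \<le> ln x.\<close>

lemma psi_le_pi_ln:
  assumes x: "x \<ge> 1"
  shows "summatory mangoldt (ln x) \<le> prime_pi x * ln x"
proof -
  define N where "N = nat \<lfloor>x\<rfloor>"
  have N: "n \<le> N \<longleftrightarrow> real n \<le> x" for n using x by (simp add: N_def le_nat_iff le_floor_iff)
  define P where "P = {p::nat. prime p \<and> real p \<le> x}"
  define Q where "Q = {n\<in>{1..N}. primepow n}"
  have fin: "finite P" "finite Q" using finite_primes_le by (auto simp: P_def Q_def)
  have "summatory mangoldt (ln x) = (\<Sum>n\<in>Q. ln (real (aprimedivisor n)))"
    using x unfolding summatory_ln[OF less_le_trans[OF zero_less_one x]] N_def[symmetric] Q_def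
    by (intro sum.mono_neutral_cong_right) (auto simp: mangoldt_def)
  also have "\<dots> = (\<Sum>p\<in>P. \<Sum>n\<in>{n\<in>Q. aprimedivisor n = p}. ln (real (aprimedivisor n)))"
  proof (rule sum.group[symmetric, OF fin(2,1)])
    show "aprimedivisor ` Q \<subseteq> P"
    proof
      fix p assume "p \<in> aprimedivisor ` Q"
      then obtain n where n: "n \<in> Q" "p = aprimedivisor n" by blast
      then have "n > 1" "n \<le> N" by (auto simp: Q_def primepow_gt_Suc_0)
      then have "prime p" "p dvd n" using n(2) by (auto simp: prime_aprimedivisor' aprimedivisor_dvd')
      then show "p \<in> P" using \<open>n \<le> N\<close> \<open>n > 1\<close> N[of p] dvd_imp_le[of p n] by (auto simp: P_def)
    qed
  qed
  also have "\<dots> \<le> (\<Sum>p\<in>P. ln x)"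
  proof (rule sum_mono)
    fix p assume p: "p \<in> P"
    then have pp: "prime p" "real p \<le> x" by (auto simp: P_def)
    have p1: "real p > 1" using prime_gt_1_nat[OF pp(1)] by simp
    define K where "K = nat \<lfloor>ln x / ln (real p)\<rfloor>"
    have "{n\<in>Q. aprimedivisor n = p} \<subseteq> (\<lambda>k. p ^ k) ` {1..K}"
    proof
      fix n assume n: "n \<in> {n\<in>Q. aprimedivisor n = p}"
      then have "primepow n" by (simp add: Q_def)
      then obtain q k where qk: "prime q" "k > 0" "n = q ^ k" by (auto simp: primepow_def)
      then have "q = p" using n by (simp add: aprimedivisor_prime_power)
      have "real (p ^ k) \<le> x" using n N[of n] qk \<open>q = p\<close> by (auto simp: Q_def)
      then have "ln (real p ^ k) \<le> ln x" using p1 x by (subst ln_le_cancel_iff) auto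
      then have "real k * ln (real p) \<le> ln x" using p1 by (simp add: ln_realpow)
      then have "real k \<le> ln x / ln (real p)" using p1 by (simp add: le_divide_eq)
      then have "k \<le> K" by (simp add: K_def le_nat_floor)
      then show "n \<in> (\<lambda>k. p ^ k) ` {1..K}" using qk \<open>q = p\<close> by auto
    qed
    then have "card {n\<in>Q. aprimedivisor n = p} \<le> card ((\<lambda>k. p ^ k) ` {1..K})"
      by (intro card_mono) auto
    also have "\<dots> \<le> K" using card_image_le[of "{1..K}" "\<lambda>k. p ^ k"] by simp
    finally have "(\<Sum>n\<in>{n\<in>Q. aprimedivisor n = p}. ln (real (aprimedivisor n))) \<le> real K * ln (real p)"
      using p1 by (simp add: mult_right_mono)
    also have "real K \<le> ln x / ln (real p)"
      unfolding K_def using x p1 by (simp add: of_nat_nat)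
    then have "real K * ln (real p) \<le> ln x / ln (real p) * ln (real p)"
      using p1 by (intro mult_right_mono) auto
    also have "\<dots> = ln x" using p1 by simp
    finally show "(\<Sum>n\<in>{n\<in>Q. aprimedivisor n = p}. ln (real (aprimedivisor n))) \<le> ln x" .
  qed
  also have "\<dots> = prime_pi x * ln x" by (simp add: prime_pi_def P_def)
  finally show ?thesis .
qed

text \<open>Primes up to y are counted trivially; each prime in (y, x] contributes at least ln y to
  \<psi>.\<close>

lemma pi_le_psi:
  assumes "1 < y" "y \<le> x"
  shows "prime_pi x \<le> y + summatory mangoldt (ln x) / ln y"
proof -
  define P1 P2 where "P1 = {p::nat. prime p \<and> real p \<le> y}" and "P2 = {p::nat. prime p \<and> y < real p \<and> real p \<le> x}"
  have fin: "finite P1" "finite P2"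
    using finite_primes_le[of y] finite_subset[OF _ finite_primes_le[of x], of P2] by (auto simp: P1_def P2_def)
  have "{p::nat. prime p \<and> real p \<le> x} = P1 \<union> P2" "P1 \<inter> P2 = {}"
    using assms by (auto simp: P1_def P2_def)
  then have pi: "prime_pi x = real (card P1) + real (card P2)"
    using fin by (simp add: prime_pi_def card_Un_disjoint)
  have "P1 \<subseteq> {1..nat \<lfloor>y\<rfloor>}" using assms by (auto simp: P1_def le_nat_floor Suc_le_eq prime_gt_0_nat)
  then have "card P1 \<le> nat \<lfloor>y\<rfloor>" using card_mono[of "{1..nat \<lfloor>y\<rfloor>}" P1] by simp
  then have 1: "real (card P1) \<le> y" using assms by linarith
  have lny: "ln y > 0" using assms by simp
  have "real (card P2) * ln y = (\<Sum>p\<in>P2. ln y)" by simp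
  also have "\<dots> \<le> (\<Sum>p\<in>P2. mangoldt p)"
    using assms by (intro sum_mono) (auto simp: P2_def)
  also have "\<dots> \<le> summatory mangoldt (ln x)"
  proof -
    have "P2 \<subseteq> {1..nat \<lfloor>x\<rfloor>}" by (auto simp: P2_def le_nat_floor Suc_le_eq prime_gt_0_nat)
    then have "(\<Sum>p\<in>P2. mangoldt p :: real) \<le> (\<Sum>n\<in>{1..nat \<lfloor>x\<rfloor>}. mangoldt n)"
      by (intro sum_mono2) (auto simp: mangoldt_nonneg)
    then show ?thesis using summatory_ln[of x mangoldt] assms by simp
  qed
  finally have "real (card P2) \<le> summatory mangoldt (ln x) / ln y" using lny by (simp add: le_divide_eq)
  then show ?thesis using pi 1 by simp
qed

theorem prime_pi_asymp: "prime_pi \<sim>[at_top] (\<lambda>x. x / ln x)"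
proof (rule asymp_equivI')
  define \<psi> where "\<psi> = (\<lambda>x. summatory mangoldt (ln x))"
  have lim: "((\<lambda>x. \<psi> x / x) \<longlongrightarrow> 1) at_top" unfolding \<psi>_def by (rule psi_tendsto)
  show "((\<lambda>x. prime_pi x / (x / ln x)) \<longlongrightarrow> 1) at_top"
  proof (rule tendsto_sandwich[OF _ _ lim])
    show "eventually (\<lambda>x. \<psi> x / x \<le> prime_pi x / (x / ln x)) at_top"
      using eventually_gt_at_top[of 1]
    proof eventually_elim
      case (elim x)
      then have "\<psi> x / x \<le> prime_pi x * ln x / x"
        using psi_le_pi_ln[of x] by (intro divide_right_mono) (auto simp: \<psi>_def)
      then show ?case by simp
    qed
    \<comment> \<open>The threshold y = x / (ln x)^2 is o(x / ln x), while ln y is still asymptotic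
      to ln x.\<close>
    have "eventually (\<lambda>x::real. 1 < x / (ln x)\<^sup>2 \<and> x / (ln x)\<^sup>2 \<le> x) at_top"
    proof (rule eventually_conj)
      have "filterlim (\<lambda>x::real. x / (ln x)\<^sup>2) at_top at_top" by real_asymp
      then show "eventually (\<lambda>x::real. 1 < x / (ln x)\<^sup>2) at_top" by (simp add: filterlim_at_top_dense)
      show "eventually (\<lambda>x::real. x / (ln x)\<^sup>2 \<le> x) at_top" by real_asymp
    qed
    then show "eventually (\<lambda>x. prime_pi x / (x / ln x) \<le> 1 / ln x + \<psi> x / x * (ln x / ln (x / (ln x)\<^sup>2))) at_top"
      using eventually_gt_at_top[of 1]
    proof eventually_elim
      case (elim x)
      define y where "y = x / (ln x)\<^sup>2"
      have lnx: "ln x > 0" using elim by simp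
      have "prime_pi x * (ln x / x) \<le> (y + \<psi> x / ln y) * (ln x / x)"
        using pi_le_psi[of y x] elim by (intro mult_right_mono) (auto simp: y_def \<psi>_def)
      also have "\<dots> = 1 / ln x + \<psi> x / x * (ln x / ln y)"
      proof -
        have "y * (ln x / x) = 1 / ln x" using lnx elim by (simp add: y_def power2_eq_square)
        moreover have "\<psi> x / ln y * (ln x / x) = \<psi> x / x * (ln x / ln y)" by simp
        ultimately show ?thesis by (simp only: distrib_right)
      qed
      finally show ?case by (simp add: y_def)
    qed
    have "((\<lambda>x::real. 1 / ln x) \<longlongrightarrow> 0) at_top" "((\<lambda>x::real. ln x / ln (x / (ln x)\<^sup>2)) \<longlongrightarrow> 1) at_top"
      by real_asymp+
    then have "((\<lambda>x. 1 / ln x + \<psi> x / x * (ln x / ln (x / (ln x)\<^sup>2))) \<longlongrightarrow> 0 + 1 * 1) at_top"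
      by (intro tendsto_add tendsto_mult lim)
    then show "((\<lambda>x. 1 / ln x + \<psi> x / x * (ln x / ln (x / (ln x)\<^sup>2))) \<longlongrightarrow> 1) at_top" by simp
  qed
qed

section \<open>The Riemann function\<close>

definition mu_sum :: "nat \<Rightarrow> real" where
  "mu_sum N = (\<Sum>n\<in>{1..N}. moebius_mu n / real n)"

lemma mu_sum_bound: "\<exists>C\<ge>0. \<forall>N\<ge>3. \<bar>mu_sum N\<bar> \<le> C * ln (real N) powr (-6/5)"
proof -
  obtain C where C: "C \<ge> 0" "\<And>t. t \<ge> 1 \<Longrightarrow> \<bar>mu_mean t\<bar> \<le> C * t powr (-6/5)" using mu_mean_decay by metis
  have "\<bar>mu_sum N\<bar> \<le> C * ln (real N) powr (-6/5)" if "N \<ge> 3" for N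
    using C(2)[of "ln (real N)"] ln_ge_1[of "real N"] that by (simp add: mu_mean_def summatory_def mu_sum_def)
  then show ?thesis using C(1) by blast
qed

lemma ln_at_top_nat: "filterlim (\<lambda>N. ln (real N)) at_top sequentially"
  by (rule filterlim_compose[OF ln_at_top filterlim_real_sequentially])

lemma mu_sum_tendsto: "(\<lambda>N. mu_sum N * ln (real N)) \<longlonglongrightarrow> 0" "mu_sum \<longlonglongrightarrow> 0"
proof -
  obtain C where C: "C \<ge> 0" "\<And>N. N \<ge> 3 \<Longrightarrow> \<bar>mu_sum N\<bar> \<le> C * ln (real N) powr (-6/5)"
    using mu_sum_bound by metis
  have lim: "((\<lambda>N. C * ln (real N) powr a) \<longlonglongrightarrow> 0)" if "a < 0" for a
    using tendsto_mult_right_zero[OF tendsto_neg_powr[OF that ln_at_top_nat]] by simp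
  show "mu_sum \<longlonglongrightarrow> 0"
    by (rule Lim_null_comparison[OF _ lim[of "-6/5"]])
       (use C in \<open>auto intro!: eventually_mono[OF eventually_ge_at_top[of 3]]\<close>)
  have "\<bar>mu_sum N * ln (real N)\<bar> \<le> C * ln (real N) powr (-1/5)" if N: "N \<ge> 3" for N
  proof -
    have l: "ln (real N) \<ge> 1" using ln_ge_1[of "real N"] N by simp
    have "\<bar>mu_sum N * ln (real N)\<bar> \<le> C * ln (real N) powr (-6/5) * ln (real N)"
      using C(2)[OF N] l by (simp add: abs_mult mult_right_mono)
    also have "\<dots> = C * (ln (real N) powr (-6/5) * ln (real N) powr 1)" using l by simp
    also have "ln (real N) powr (-6/5) * ln (real N) powr 1 = ln (real N) powr (-1/5)"
      unfolding powr_add[symmetric] by simp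
    finally show ?thesis .
  qed
  then show "(\<lambda>N. mu_sum N * ln (real N)) \<longlonglongrightarrow> 0"
    by (intro Lim_null_comparison[OF _ lim[of "-1/5"]])
       (auto intro!: eventually_mono[OF eventually_ge_at_top[of 3]])
qed

lemma summable_mu: "summable (\<lambda>k. moebius_mu (Suc k) / real (Suc k))"
proof -
  have "(\<lambda>k. moebius_mu (Suc k) / real (Suc k)) sums 0"
    unfolding sums_def
  proof -
    have "(\<Sum>k<N. moebius_mu (Suc k) / real (Suc k)) = mu_sum N" for N
      unfolding mu_sum_def by (rule sum.reindex_bij_witness[of _ "\<lambda>n. n - 1" Suc]) auto
    then show "(\<lambda>N. \<Sum>k<N. moebius_mu (Suc k) / real (Suc k)) \<longlonglongrightarrow> 0" using mu_sum_tendsto(2) by simp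
  qed
  then show ?thesis by (rule sums_summable)
qed

text \<open>Here an exponent below -1 in the decay of the mean is indispensable.\<close>

lemma summable_mu_ln_increments: "summable (\<lambda>k. mu_sum k * (ln (real (Suc k)) - ln (real k)))"
proof -
  obtain C where C: "C \<ge> 0" "\<And>N. N \<ge> 3 \<Longrightarrow> \<bar>mu_sum N\<bar> \<le> C * ln (real N) powr (-6/5)"
    using mu_sum_bound by metis
  \<comment> \<open>A telescoping majorant: t^(-1/5) has derivative -(1/5) t^(-6/5). The factor 5
    undoes the 1/5, and \<open>2 powr (6/5)\<close> pays for an intermediate point z < 2 ln k in
    place of ln k.\<close>
  define \<phi> where "\<phi> = (\<lambda>k. ln (real k) powr (-1/5))"
  have "\<phi> \<longlonglongrightarrow> 0" unfolding \<phi>_def by (rule tendsto_neg_powr[OF _ ln_at_top_nat]) simp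
  then have "summable (\<lambda>k. \<phi> k - \<phi> (Suc k))" by (rule telescope_summable')
  then have sm: "summable (\<lambda>k. C * 5 * 2 powr (6/5) * (\<phi> k - \<phi> (Suc k)))" by (rule summable_mult)
  show ?thesis
  proof (rule summable_comparison_test'[OF sm, of 3])
    fix k :: nat assume k: "k \<ge> 3"
    define a b where "a = ln (real k)" and "b = ln (real (Suc k))"
    have ab: "1 \<le> a" "a < b" using k ln_ge_1[of "real k"] by (auto simp: a_def b_def)
    have "b \<le> ln (real k ^ 2)"
    proof -
      have "real (Suc k) \<le> real k * 2" using k by simp
      also have "\<dots> \<le> real k * real k" using k by (intro mult_left_mono) auto
      finally show ?thesis using k unfolding b_def by (subst ln_le_cancel_iff) (auto simp: power2_eq_square)
    qed
    then have b2: "b \<le> 2 * a" using k by (simp add: a_def ln_realpow)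
    obtain z where z: "a < z" "z < b" "b powr (-1/5) - a powr (-1/5) = (b - a) * (-1/5 * z powr (-1/5 - 1))"
      using MVT2[OF ab(2), of "\<lambda>x. x powr (-1/5)" "\<lambda>x. -1/5 * x powr (-1/5 - 1)"] ab
      by (force intro!: derivative_eq_intros)
    have e: "-1/5 - 1 = (-6/5 :: real)" by simp
    have "2 powr (-6/5) * a powr (-6/5) = (2 * a) powr (-6/5)" using ab by (simp add: powr_mult)
    also have "\<dots> \<le> z powr (-6/5)" using z b2 ab by (intro powr_mono2') auto
    finally have "2 powr (6/5) * (2 powr (-6/5) * a powr (-6/5)) \<le> 2 powr (6/5) * z powr (-6/5)"
      by (intro mult_left_mono) auto
    moreover have "2 powr (6/5) * 2 powr (-6/5) = (1 :: real)" unfolding powr_add[symmetric] by simp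
    ultimately have "a powr (-6/5) \<le> 2 powr (6/5) * z powr (-6/5)"
      by (simp only: mult.assoc[symmetric] mult_1)
    then have "(b - a) * a powr (-6/5) \<le> (b - a) * (2 powr (6/5) * z powr (-6/5))"
      using ab by (intro mult_left_mono) auto
    also have "\<dots> = 2 powr (6/5) * ((b - a) * z powr (-6/5))" by simp
    also have "(b - a) * z powr (-6/5) = 5 * (a powr (-1/5) - b powr (-1/5))"
    proof -
      have "5 * (b powr (-1/5) - a powr (-1/5)) = - ((b - a) * z powr (-6/5))" unfolding z(3) e by simp
      then show ?thesis by argo
    qed
    also have "2 powr (6/5) * (5 * (a powr (-1/5) - b powr (-1/5))) = 5 * 2 powr (6/5) * (a powr (-1/5) - b powr (-1/5))"
      by simp
    finally have *: "(b - a) * a powr (-6/5) \<le> 5 * 2 powr (6/5) * (a powr (-1/5) - b powr (-1/5))" .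
    have "\<bar>mu_sum k * (b - a)\<bar> = \<bar>mu_sum k\<bar> * (b - a)" using ab by (simp add: abs_mult)
    also have "\<dots> \<le> C * a powr (-6/5) * (b - a)" using C(2)[OF k] ab by (intro mult_right_mono) (auto simp: a_def)
    also have "\<dots> \<le> C * (5 * 2 powr (6/5) * (a powr (-1/5) - b powr (-1/5)))"
      using mult_left_mono[OF * C(1)] by (simp add: mult_ac)
    finally show "norm (mu_sum k * (ln (real (Suc k)) - ln (real k))) \<le> C * 5 * 2 powr (6/5) * (\<phi> k - \<phi> (Suc k))"
      by (simp add: a_def b_def \<phi>_def mult_ac)
  qed
qed

text \<open>Abel summation, with a boundary term tending to 0. At k = 0 the formal value
  \<open>ln 0\<close> is multiplied by \<open>mu_sum 0 = 0\<close>.\<close>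

lemma summable_mu_ln: "summable (\<lambda>k. moebius_mu (Suc k) / real (Suc k) * ln (real (Suc k)))"
proof -
  have part: "(\<Sum>k<N. moebius_mu (Suc k) / real (Suc k) * ln (real (Suc k)))
     = mu_sum N * ln (real N) - (\<Sum>k<N. mu_sum k * (ln (real (Suc k)) - ln (real k)))" for N
  proof (induction N)
    case 0
    then show ?case by (simp add: mu_sum_def)
  next
    case (Suc N)
    have "mu_sum (Suc N) = mu_sum N + moebius_mu (Suc N) / real (Suc N)" by (simp add: mu_sum_def)
    then show ?case using Suc by (simp add: algebra_simps del: of_nat_Suc)
  qed
  have "convergent (\<lambda>N. mu_sum N * ln (real N) - (\<Sum>k<N. mu_sum k * (ln (real (Suc k)) - ln (real k))))"
    using mu_sum_tendsto(1) summable_mu_ln_increments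
    by (intro convergent_diff) (auto simp: convergent_def summable_iff_convergent)
  then show ?thesis unfolding summable_iff_convergent part .
qed

text \<open>For large \<open>k\<close>, \<open>li (x\<^bsup>1/k\<^esup>)\<close> is \<open>ln ln x - ln k + const\<close> up to a summable error, so the convergence of the series rests
  on that of \<open>\<Sum>\<mu>(k) / k\<close> and \<open>\<Sum>\<mu>(k) ln k / k\<close>; the values of these two sums do not matter.\<close>

theorem riemann_R_bigo: "(\<lambda>x. riemann_R x - li x) \<in> O(\<lambda>x. sqrt x * ln x)"
proof -
  obtain K where K: "\<And>x. x > 1 \<Longrightarrow> li x = K + li_prim x" using li_eq by blast
  define c where "c = (\<lambda>k. moebius_mu (Suc k) / real (Suc k))"
  define S0 S1 where "S0 = suminf c" and "S1 = (\<Sum>k. c k * ln (real (Suc k)))"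
  define K2 where "K2 = (\<Sum>k. 1 / real (Suc k) ^ 2)"
  have sm0: "summable c" and sm1: "summable (\<lambda>k. c k * ln (real (Suc k)))"
    unfolding c_def using summable_mu summable_mu_ln by auto
  have sm2: "summable (\<lambda>k. 1 / real (Suc k) ^ 2)"
    using inverse_power_summable[of 2, where ?'a = real] summable_Suc_iff[of "\<lambda>n. inverse (real n ^ 2)"]
    by (simp add: inverse_eq_divide del: of_nat_Suc)
  have cb: "\<bar>c k\<bar> \<le> 1 / real (Suc k)" for k
    by (simp add: c_def abs_divide divide_right_mono moebius_bound del: of_nat_Suc)
  define D where "D = \<bar>K + ein 0\<bar> * \<bar>S0 - 1\<bar> + \<bar>S1\<bar>"
  have main: "\<bar>riemann_R x - li x\<bar> \<le> D + \<bar>S0 - 1\<bar> * \<bar>ln (ln x)\<bar> + K2 * (sqrt x * ln x)" if x: "x > 1" for x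
  proof -
    define L where "L = ln x"
    have L: "L > 0" using x by (simp add: L_def)
    define e where "e = (\<lambda>k. ein (L / real (Suc k)) - ein 0)"
    have li_k: "li (x powr (1 / real (Suc k))) = (K + ein 0 + ln L) - ln (real (Suc k)) + e k" for k
    proof -
      have y1: "x powr (1 / real (Suc k)) > 1" using x by (intro gr_one_powr) auto
      have lny: "ln (x powr (1 / real (Suc k))) = L / real (Suc k)"
        using x by (simp add: ln_powr L_def del: of_nat_Suc)
      have "li (x powr (1 / real (Suc k))) = K + (ln \<bar>L / real (Suc k)\<bar> + ein (L / real (Suc k)))"
        using K[OF y1] unfolding li_prim_def lny .
      also have "ln \<bar>L / real (Suc k)\<bar> = ln L - ln (real (Suc k))"
        using L by (simp add: ln_div del: of_nat_Suc)
      finally show ?thesis by (simp add: e_def)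
    qed
    have eb: "\<bar>c k * e k\<bar> \<le> (L * exp (L / real (Suc k))) * (1 / real (Suc k) ^ 2)" for k
    proof -
      have "\<bar>c k * e k\<bar> \<le> 1 / real (Suc k) * (L / real (Suc k) * exp (L / real (Suc k)))"
        unfolding abs_mult e_def using L by (intro mult_mono cb ein_bound) auto
      then show ?thesis by (simp add: power2_eq_square del: of_nat_Suc)
    qed
    \<comment> \<open>Of size x ln x, this bound serves only for convergence at fixed x; the
      quantitative estimate leaves the index 0 aside.\<close>
    have eb1: "\<bar>c k * e k\<bar> \<le> (L * exp L) * (1 / real (Suc k) ^ 2)" for k
    proof (rule order_trans[OF eb], intro mult_right_mono mult_left_mono)
      have "L / real (Suc k) \<le> L / 1" using L by (intro divide_left_mono) auto
      then show "exp (L / real (Suc k)) \<le> exp L" by simp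
    qed (use L in auto)
    have sme: "summable (\<lambda>k. c k * e k)"
      by (rule summable_comparison_test'[OF summable_mult[OF sm2], of 0 _ "L * exp L"]) (use eb1 in auto)
    have "(\<lambda>k. c k * li (x powr (1 / real (Suc k)))) sums ((K + ein 0 + ln L) * S0 - S1 + suminf (\<lambda>k. c k * e k))"
    proof -
      have "(\<lambda>k. (K + ein 0 + ln L) * c k - c k * ln (real (Suc k)) + c k * e k) sums
         ((K + ein 0 + ln L) * S0 - S1 + suminf (\<lambda>k. c k * e k))"
        unfolding S0_def S1_def
        by (intro sums_add sums_diff sums_mult summable_sums sm0 sm1 sme)
      then show ?thesis unfolding li_k by (simp add: algebra_simps del: of_nat_Suc)
    qed
    then have R: "riemann_R x = (K + ein 0 + ln L) * S0 - S1 + suminf (\<lambda>k. c k * e k)"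
      unfolding riemann_R_def c_def by (rule sums_unique[symmetric])
    \<comment> \<open>Index 0 is the term k = 1, with coefficient 1: its error \<open>e 0\<close>
      also occurs in \<open>li x\<close> and cancels in the difference. The remaining exponentials
      are at most exp (L / 2) = sqrt x.\<close>
    have c0: "c 0 * e 0 = e 0" by (simp add: c_def moebius_mu_def)
    have split: "suminf (\<lambda>k. c k * e k) = e 0 + (\<Sum>k. c (Suc k) * e (Suc k))"
      using suminf_split_head[OF sme] c0 by simp
    have "li x = K + ein 0 + ln L + e 0" using li_k[of 0] x by simp
    then have diff: "riemann_R x - li x = (K + ein 0) * (S0 - 1) - S1 + (S0 - 1) * ln L + (\<Sum>k. c (Suc k) * e (Suc k))"
      unfolding R split by (simp add: algebra_simps)
    have sq: "exp (L / 2) = sqrt x" using x by (simp add: L_def powr_half_sqrt[symmetric] powr_def)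
    have tail: "\<bar>\<Sum>k. c (Suc k) * e (Suc k)\<bar> \<le> K2 * (sqrt x * ln x)"
    proof -
      have tb: "\<bar>c (Suc k) * e (Suc k)\<bar> \<le> (L * sqrt x) * (1 / real (Suc (Suc k)) ^ 2)" for k
      proof (rule order_trans[OF eb], intro mult_right_mono mult_left_mono)
        have "L / real (Suc (Suc k)) \<le> L / 2" using L by (intro divide_left_mono) auto
        then show "exp (L / real (Suc (Suc k))) \<le> sqrt x" unfolding sq[symmetric] by simp
      qed (use L in auto)
      have sm3: "summable (\<lambda>k. 1 / real (Suc (Suc k)) ^ 2)" using sm2 by (subst summable_Suc_iff)
      have smt: "summable (\<lambda>k. \<bar>c (Suc k) * e (Suc k)\<bar>)"
        by (rule summable_comparison_test'[OF summable_mult[OF sm3], of 0 _ "L * sqrt x"]) (use tb in auto)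
      have "\<bar>\<Sum>k. c (Suc k) * e (Suc k)\<bar> \<le> (\<Sum>k. \<bar>c (Suc k) * e (Suc k)\<bar>)" by (rule summable_rabs[OF smt])
      also have "\<dots> \<le> (\<Sum>k. (L * sqrt x) * (1 / real (Suc (Suc k)) ^ 2))"
        by (intro suminf_le tb smt summable_mult sm3)
      also have "\<dots> = (L * sqrt x) * (\<Sum>k. 1 / real (Suc (Suc k)) ^ 2)" by (rule suminf_mult[OF sm3])
      also have "(\<Sum>k. 1 / real (Suc (Suc k)) ^ 2) \<le> K2"
        using suminf_split_head[OF sm2] unfolding K2_def by simp
      then have "(L * sqrt x) * (\<Sum>k. 1 / real (Suc (Suc k)) ^ 2) \<le> (L * sqrt x) * K2"
        using L x by (intro mult_left_mono) auto
      finally show ?thesis by (simp add: L_def mult_ac)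
    qed
    have "\<bar>(K + ein 0) * (S0 - 1)\<bar> = \<bar>K + ein 0\<bar> * \<bar>S0 - 1\<bar>" "\<bar>(S0 - 1) * ln L\<bar> = \<bar>S0 - 1\<bar> * \<bar>ln (ln x)\<bar>"
      by (simp_all add: abs_mult L_def)
    then show ?thesis unfolding diff D_def using tail by linarith
  qed
  have "(\<lambda>x. riemann_R x - li x) \<in> O(\<lambda>x. D + \<bar>S0 - 1\<bar> * \<bar>ln (ln x)\<bar> + K2 * (sqrt x * ln x))"
    by (rule bigoI[of _ 1], rule eventually_mono[OF eventually_gt_at_top[of 1]])
       (use main in \<open>force intro: order_trans[OF _ abs_ge_self]\<close>)
  also have "(\<lambda>x. D + \<bar>S0 - 1\<bar> * \<bar>ln (ln x)\<bar> + K2 * (sqrt x * ln x)) \<in> O(\<lambda>x. sqrt x * ln x)"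
  proof (intro sum_in_bigo)
    show "(\<lambda>_. D) \<in> O(\<lambda>x::real. sqrt x * ln x)" by real_asymp
    have "(\<lambda>x::real. \<bar>ln (ln x)\<bar>) \<in> O(\<lambda>x. sqrt x * ln x)" by real_asymp
    then show "(\<lambda>x::real. \<bar>S0 - 1\<bar> * \<bar>ln (ln x)\<bar>) \<in> O(\<lambda>x. sqrt x * ln x)"
      by (cases "S0 = 1") simp_all
    show "(\<lambda>x::real. K2 * (sqrt x * ln x)) \<in> O(\<lambda>x. sqrt x * ln x)" by (cases "K2 = 0") simp_all
  qed
  finally show ?thesis .
qed

theorem proposition4p6:
  fixes l :: nat and c :: real
  assumes "l \<ge> 1"
  shows "S_shift l c \<sim>[at_top] S_hat l
    \<and> S_hat l \<sim>[at_top] li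
    \<and> li \<sim>[at_top] prime_pi
    \<and> prime_pi \<sim>[at_top] riemann_R
    \<and> ((\<lambda>x. S_shift l c x / riemann_R x) \<longlongrightarrow> 1) at_top"
proof -
  have R: "riemann_R \<sim>[at_top] (\<lambda>x. x / ln x)"
    by (rule asymp_equiv_perturb[OF li_asymp riemann_R_bigo])
  have eq: "f \<sim>[at_top] g" if "f \<sim>[at_top] (\<lambda>x::real. x / ln x)" "g \<sim>[at_top] (\<lambda>x. x / ln x)" for f g :: "real \<Rightarrow> real"
    using that asymp_equiv_sym asymp_equiv_trans by blast
  \<comment> \<open>Asymptotic equivalence counts 0 / 0 as 1, so the limit of the plain quotient
    also calls for \<open>riemann_R\<close> to be eventually nonzero.\<close>
  have "eventually (\<lambda>x::real. x / ln x \<noteq> 0) at_top"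
    using eventually_gt_at_top[of 1] by eventually_elim simp
  then have "eventually (\<lambda>x. riemann_R x \<noteq> 0) at_top"
    using asymp_equiv_eventually_zeros[OF R] by eventually_elim simp
  then have "((\<lambda>x. S_shift l c x / riemann_R x) \<longlongrightarrow> 1) at_top"
    by (intro asymp_equivD_strong eq[OF S_shift_asymp[OF assms] R]) (auto elim: eventually_mono)
  then show ?thesis
    using eq S_shift_asymp[OF assms] S_hat_asymp[OF assms] li_asymp prime_pi_asymp R by blast
qed


end
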